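(* Let $\beta\in[-1,1]$, $p\in(1,p_F)$ with $p_F=1+2/n$, let $\ell\in\mathbb N$ with $\ell>2p'$, $p'=p/(p-1)$, and let $(u_0,u_1)=\varepsilon(a_0,a_1)$ with $\varepsilon>0$. Let $R>0$ and assume that $(a_0,a_1)\in(H^1(\mathbb R^n)\cap L^1(\mathbb R^n))\times(L^2(\mathbb R^n)\cap L^1(\mathbb R^n))$ satisfy $$I_0=\int_{|x|<R}a_0(x)\,dx>0,\qquad I_1=\int_{|x|<R}a_1(x)\,dx>0 .$$ For $\varepsilon>0$ let $$R(\varepsilon)=A(n,p,\ell,\psi)^{\frac{p-1}{n(p_F-p)}}\Bigl(\frac{\varepsilon}{4}I_0\Bigr)^{-\frac{p-1}{n(p_F-p)}},$$ and let $\varepsilon_0>0$ satisfy $$\int_{\mathbb R^n}\psi_{R(\varepsilon_0)}^\ell(x)a_0(x)\,dx\ge\tfrac12 I_0,\qquad \int_{\mathbb R^n}\psi_{R(\varepsilon_0)}^\ell(x)a_1(x)\,dx\ge\tfrac12 I_1,$$ $$\varepsilon_0I_0\le 2^{\frac1{p-1}}\|\psi^\ell\|_{L^1(\mathbb R^n)}R(\varepsilon_0)^n .$$ Then there is a constant $\mu_0=\mu_0(n,p,b,\beta,\ell,\psi,I_0,I_1)>0$ such that for any $\varepsilon\in(0,\varepsilon_0]$ the associated strong solution $u$ of $$u_{tt}-\Delta u+b(t)u_t=|u|^p,\qquad u(0)=\varepsilon a_0,\quad u_t(0)=\varepsilon a_1,$$ with lifespan $T_0=T_0(\varepsilon)$,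 satisfies $$\int_{\mathbb R^n}u(t,x)\psi_{R(\varepsilon)}^\ell(x)\,dx\ge\frac{\varepsilon}{4}I_0\Bigl(1-\mu_0\,\varepsilon^{\frac{1}{\frac1{p-1}-\frac n2}}B(t)\Bigr)^{-\frac2{p-1}}\qquad\text{for }t\in[0,T_0),$$ and the lifespan is estimated as $$T_0\le B^{-1}\Bigl(\mu_0^{-1}\varepsilon^{-\frac{1}{\frac1{p-1}-\frac n2}}\Bigr).$$
   Context: Standing assumption: $b:[0,\infty)\to(0,\infty)$ is smooth and there are constants $b_1,b_2,b_3>0$ such that, for all $t\ge0$, $$b_1(1+t)^{-\beta}\le b(t)\le b_2(1+t)^{-\beta},\qquad |b'(t)|\le b_3(1+t)^{-1}b(t),$$ with $\beta\in[-1,1]$. Functions are real-valued and $n\ge1$ is the space dimension. Set $B(t)=\int_0^t b(\tau)^{-1}d\tau$; this is a strictly increasing bijection of $[0,\infty)$ with inverse $B^{-1}$. Fix $\widetilde\psi\in C^\infty([0,\infty);[0,1])$ with $\widetilde\psi(r)=1$ for $r\le1$, $\widetilde\psi$ decreasing on $1<r<2$, and $\widetilde\psi(r)=0$ for $r\ge2$. Put $\psi(x)=\widetilde\psi(|x|)$ and, for any scale $\rho>0$, $\psi_\rho(x)=\psi(x/\rho)$ for $x\in\mathbb R^n$. For $\phi\in C_0^\infty(\mathbb R^n)$, $\phi\ge0$, and $\ell\in\mathbb N$, $\ell>2p'$, $$A(n,p,\ell,\phi)=2^{p'-1}p'^{-\frac1p}p^{\frac{1-p'}{p}}\bigl\||\Phi|^{p'}\phi^{\ell-2p'}\bigr\|_{L^1(\mathbb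 R^n)}^{\frac1p}\|\phi^\ell\|_{L^1(\mathbb R^n)}^{\frac1{p'}},\qquad \Phi=\phi^{2-\ell}\Delta(\phi^\ell)=\ell(\ell-1)\nabla\phi\cdot\nabla\phi+\ell\phi\Delta\phi .$$ Strong solution on $[0,T)$, $T\in(0,\infty]$, with data $(u_0,u_1)\in H^1(\mathbb R^n)\times L^2(\mathbb R^n)$: a function $u\in C^2([0,T);H^{-1}(\mathbb R^n))\cap C^1([0,T);L^2(\mathbb R^n))\cap C([0,T);H^1(\mathbb R^n))$ satisfying $u(0)=u_0$, $u_t(0)=u_1$ and the equation $u_{tt}-\Delta u+b(t)u_t=|u|^p$ in $C([0,T);H^{-1}(\mathbb R^n))$. The lifespan is $T_0=\sup\{T>0: u\text{ is a strong solution on }[0,T)\}$. (For $1<p<\infty$ if $n=1,2$ and $1<p\le n/(n-2)$ if $n\ge3$, a unique local strong solution exists for all data in $H^1\times L^2$.)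
   Formalization: The two lower bounds on the integrals of a_0 and a_1 against the cut-off are assumed at R(ε) for each ε considered, not only at R(ε_0); otherwise a large negative part of a_0 outside |x|<2R(ε_0) violates the claim at t=0 for small ε. *)

theory Defs
  imports "HOL-Analysis.Analysis"
begin

section \<open>The damping coefficient\<close>

text \<open>Smoothness on the closed half-line; derivatives at 0 are one-sided.\<close>

definition smooth_halfline :: "(real \<Rightarrow> real) \<Rightarrow> bool" where
  "smooth_halfline f \<longleftrightarrow> (\<exists>D :: nat \<Rightarrow> real \<Rightarrow> real. D 0 = f \<and>
     (\<forall>k. \<forall>t\<ge>0. (D k has_real_derivative D (Suc k) t) (at t within {0..})))"

definition damping :: "real \<Rightarrow> (real \<Rightarrow> real) \<Rightarrow> bool" where
  "damping \<beta> b \<longleftrightarrow> smooth_halfline b \<and> (\<forall>t\<ge>0. 0 < b t) \<and>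
     (\<exists>b1>0. \<exists>b2>0. \<exists>b3>0. \<forall>t\<ge>0.
        b1 * (1 + t) powr (- \<beta>) \<le> b t \<and> b t \<le> b2 * (1 + t) powr (- \<beta>) \<and>
        \<bar>vector_derivative b (at t within {0..})\<bar> \<le> b3 * inverse (1 + t) * b t)"

definition damping_B :: "(real \<Rightarrow> real) \<Rightarrow> real \<Rightarrow> real" where
  "damping_B b t = integral {0..t} (\<lambda>\<tau>. inverse (b \<tau>))"

definition damping_B_inv :: "(real \<Rightarrow> real) \<Rightarrow> real \<Rightarrow> real" where
  "damping_B_inv b = inv_into {0..} (damping_B b)"

section \<open>Smooth functions and cut-offs\<close>

definition partial :: "'n \<Rightarrow> (real ^ 'n \<Rightarrow> real) \<Rightarrow> real ^ 'n \<Rightarrow> real" where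
  "partial i f x = frechet_derivative f (at x) (axis i 1)"

primrec Ck :: "nat \<Rightarrow> (real ^ 'n \<Rightarrow> real) \<Rightarrow> bool" where
  "Ck 0 f \<longleftrightarrow> continuous_on UNIV f"
| "Ck (Suc k) f \<longleftrightarrow> f differentiable_on UNIV \<and> (\<forall>i. Ck k (partial i f))"

definition test_function :: "(real ^ 'n \<Rightarrow> real) \<Rightarrow> bool" where
  "test_function \<phi> \<longleftrightarrow> (\<forall>k. Ck k \<phi>) \<and> compact (closure {x. \<phi> x \<noteq> 0})"

definition gradient :: "(real ^ 'n \<Rightarrow> real) \<Rightarrow> real ^ 'n \<Rightarrow> real ^ 'n" where
  "gradient f x = (\<chi> i. partial i f x)"

definition laplacian :: "(real ^ 'n \<Rightarrow> real) \<Rightarrow> real ^ 'n \<Rightarrow> real" where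
  "laplacian f x = (\<Sum>i\<in>UNIV. partial i (partial i f) x)"

definition cutoff_profile :: "(real \<Rightarrow> real) \<Rightarrow> bool" where
  "cutoff_profile \<eta> \<longleftrightarrow> smooth_halfline \<eta> \<and> (\<forall>r\<ge>0. 0 \<le> \<eta> r \<and> \<eta> r \<le> 1) \<and>
     (\<forall>r\<in>{0..1}. \<eta> r = 1) \<and> antimono_on {1<..<2} \<eta> \<and> (\<forall>r\<ge>2. \<eta> r = 0)"

definition radial :: "(real \<Rightarrow> real) \<Rightarrow> real ^ 'n \<Rightarrow> real" where
  "radial \<eta> x = \<eta> (norm x)"

definition rescale :: "real \<Rightarrow> (real ^ 'n \<Rightarrow> real) \<Rightarrow> real ^ 'n \<Rightarrow> real" where
  "rescale \<rho> \<psi> x = \<psi> (x /\<^sub>R \<rho>)"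

section \<open>The constants\<close>

definition fujita :: "real \<Rightarrow> real" where
  "fujita n = 1 + 2 / n"

definition conj_exp :: "real \<Rightarrow> real" where
  "conj_exp p = p / (p - 1)"

text \<open>The expanded form of $\phi^{2-\ell} \Delta(\phi^\ell)$, which makes sense at the zeros
  of $\phi$ as well.\<close>

definition Phi :: "nat \<Rightarrow> (real ^ 'n \<Rightarrow> real) \<Rightarrow> real ^ 'n \<Rightarrow> real" where
  "Phi l \<phi> x = real l * (real l - 1) * (gradient \<phi> x \<bullet> gradient \<phi> x)
     + real l * \<phi> x * laplacian \<phi> x"

definition A_const :: "real \<Rightarrow> nat \<Rightarrow> (real ^ 'n \<Rightarrow> real) \<Rightarrow> real" where
  "A_const p l \<phi> = (let q = conj_exp p in
     2 powr (q - 1) * q powr (- 1 / p) * p powr ((1 - q) / p)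
     * (LINT x|lebesgue. \<bar>Phi l \<phi> x\<bar> powr q * \<phi> x powr (real l - 2 * q)) powr (1 / p)
     * (LINT x|lebesgue. \<phi> x ^ l) powr (1 / q))"

definition R_scale :: "real \<Rightarrow> nat \<Rightarrow> (real ^ 'n \<Rightarrow> real) \<Rightarrow> real \<Rightarrow> real \<Rightarrow> real" where
  "R_scale p l \<psi> I0 \<epsilon> = (let n = real CARD('n) in
     A_const p l \<psi> powr ((p - 1) / (n * (fujita n - p)))
     * (\<epsilon> / 4 * I0) powr (- ((p - 1) / (n * (fujita n - p)))))"

section \<open>The spaces $L^2$, $H^1$ and $H^{-1}$\<close>

text \<open>Elements of $L^2$ and $H^1$ are represented by functions, equality being equality almost
  everywhere.\<close>

definition L2 :: "(real ^ 'n \<Rightarrow> real) set" where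
  "L2 = {f \<in> borel_measurable lebesgue. integrable lebesgue (\<lambda>x. (f x)\<^sup>2)}"

definition L2_norm :: "(real ^ 'n \<Rightarrow> real) \<Rightarrow> real" where
  "L2_norm f = sqrt (LINT x|lebesgue. (f x)\<^sup>2)"

definition is_weak_partial ::
  "'n \<Rightarrow> (real ^ 'n \<Rightarrow> real) \<Rightarrow> (real ^ 'n \<Rightarrow> real) \<Rightarrow> bool" where
  "is_weak_partial i f g \<longleftrightarrow> g \<in> L2 \<and>
     (\<forall>\<phi>. test_function \<phi> \<longrightarrow>
        (LINT x|lebesgue. f x * partial i \<phi> x) = - (LINT x|lebesgue. g x * \<phi> x))"

definition H1 :: "(real ^ 'n \<Rightarrow> real) set" where
  "H1 = {f \<in> L2. \<forall>i. \<exists>g. is_weak_partial i f g}"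

text \<open>Determined up to a null set for functions in $H^1$.\<close>

definition weak_partial :: "'n \<Rightarrow> (real ^ 'n \<Rightarrow> real) \<Rightarrow> real ^ 'n \<Rightarrow> real" where
  "weak_partial i f = (SOME g. is_weak_partial i f g)"

definition H1_norm :: "(real ^ 'n \<Rightarrow> real) \<Rightarrow> real" where
  "H1_norm f = sqrt ((LINT x|lebesgue. (f x)\<^sup>2)
     + (\<Sum>i\<in>UNIV. LINT x|lebesgue. (weak_partial i f x)\<^sup>2))"

text \<open>$H^{-1}$ is the dual of $H^1$. Only the values of a functional on $H^1$ matter;
  a bounded linear functional does not distinguish functions that agree almost everywhere.\<close>

definition Hm1 :: "((real ^ 'n \<Rightarrow> real) \<Rightarrow> real) set" where
  "Hm1 = {F. (\<forall>f\<in>H1. \<forall>g\<in>H1. \<forall>c d. F (\<lambda>x. c * f x + d * g x) = c * F f + d * F g) \<and>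
             (\<exists>C. \<forall>f\<in>H1. \<bar>F f\<bar> \<le> C * H1_norm f)}"

definition Hm1_norm :: "((real ^ 'n \<Rightarrow> real) \<Rightarrow> real) \<Rightarrow> real" where
  "Hm1_norm F = (SUP f\<in>{f \<in> H1. H1_norm f \<le> 1}. \<bar>F f\<bar>)"

definition functional :: "(real ^ 'n \<Rightarrow> real) \<Rightarrow> (real ^ 'n \<Rightarrow> real) \<Rightarrow> real" where
  "functional f \<phi> = (LINT x|lebesgue. f x * \<phi> x)"

text \<open>The Laplacian as a map from $H^1$ to $H^{-1}$.\<close>

definition laplacian_H1 :: "(real ^ 'n \<Rightarrow> real) \<Rightarrow> (real ^ 'n \<Rightarrow> real) \<Rightarrow> real" where
  "laplacian_H1 f \<phi> =
     - (\<Sum>i\<in>UNIV. LINT x|lebesgue. weak_partial i f x * weak_partial i \<phi> x)"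

section \<open>Strong solutions\<close>

text \<open>Continuity and differentiability on a time interval with values in a space of real-valued
  functions with carrier \<open>X\<close> and (semi)norm \<open>N\<close>. Both function spaces and the space of
  functionals have this form.\<close>

definition continuous_into ::
  "('a \<Rightarrow> real) set \<Rightarrow> (('a \<Rightarrow> real) \<Rightarrow> real) \<Rightarrow> real set \<Rightarrow> (real \<Rightarrow> 'a \<Rightarrow> real) \<Rightarrow> bool" where
  "continuous_into X N I F \<longleftrightarrow> (\<forall>t\<in>I. F t \<in> X) \<and>
     (\<forall>t\<in>I. ((\<lambda>s. N (\<lambda>x. F s x - F t x)) \<longlongrightarrow> 0) (at t within I))"

definition derivative_into ::
  "(('a \<Rightarrow> real) \<Rightarrow> real) \<Rightarrow> real set \<Rightarrow> (real \<Rightarrow> 'a \<Rightarrow> real) \<Rightarrow> (real \<Rightarrow> 'a \<Rightarrow> real) \<Rightarrow> bool" where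
  "derivative_into N I F F' \<longleftrightarrow>
     (\<forall>t\<in>I. ((\<lambda>s. N (\<lambda>x. (F s x - F t x) / (s - t) - F' t x)) \<longlongrightarrow> 0) (at t within I))"

definition time_interval :: "ereal \<Rightarrow> real set" where
  "time_interval T = {t. 0 \<le> t \<and> ereal t < T}"

text \<open>In the following definition \<open>v\<close> is $u_t$ and \<open>w\<close> is $u_{tt}$. Since the $H^{-1}$ norm is
  dominated by the $L^2$ norm, \<open>v\<close> is also the first derivative of \<open>u\<close> in $H^{-1}$. Part of the equation in
  $C([0,T);H^{-1})$ is that the nonlinearity is a continuous function with values in $H^{-1}$; its
  pairing with elements of $H^1$ is required to converge absolutely.\<close>

definition strong_solution :: "(real \<Rightarrow> real) \<Rightarrow> real \<Rightarrow> (real ^ 'n \<Rightarrow> real) \<Rightarrow> (real ^ 'n \<Rightarrow> real)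
    \<Rightarrow> ereal \<Rightarrow> (real \<Rightarrow> real ^ 'n \<Rightarrow> real) \<Rightarrow> bool" where
  "strong_solution b p u0 u1 T u \<longleftrightarrow> (\<exists>v w. let I = time_interval T in
     continuous_into H1 H1_norm I u \<and>
     derivative_into L2_norm I u v \<and> continuous_into L2 L2_norm I v \<and>
     derivative_into Hm1_norm I (\<lambda>t. functional (v t)) w \<and> continuous_into Hm1 Hm1_norm I w \<and>
     (AE x in lebesgue. u 0 x = u0 x) \<and> (AE x in lebesgue. v 0 x = u1 x) \<and>
     (\<forall>t\<in>I. \<forall>\<phi>\<in>H1. integrable lebesgue (\<lambda>x. \<bar>u t x\<bar> powr p * \<phi> x)) \<and>
     continuous_into Hm1 Hm1_norm I (\<lambda>t. functional (\<lambda>x. \<bar>u t x\<bar> powr p)) \<and>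
     (\<forall>t\<in>I. \<forall>\<phi>\<in>H1. w t \<phi> - laplacian_H1 (u t) \<phi> + b t * functional (v t) \<phi>
        = functional (\<lambda>x. \<bar>u t x\<bar> powr p) \<phi>))"

text \<open>Functions of time are total; values outside the interval of existence are irrelevant.\<close>

definition lifespan :: "(real \<Rightarrow> real) \<Rightarrow> real \<Rightarrow> (real ^ 'n \<Rightarrow> real) \<Rightarrow> (real ^ 'n \<Rightarrow> real)
    \<Rightarrow> (real \<Rightarrow> real ^ 'n \<Rightarrow> real) \<Rightarrow> ereal" where
  "lifespan b p u0 u1 u = Sup {T. 0 < T \<and> strong_solution b p u0 u1 T u}"

end

theory Submission
  imports Defs
begin

text \<open>Pair the equation with the test function \<open>\<phi> = \<psi>_R ^ l\<close>. The average
  \<open>J(t) = \<integral> u(t) \<phi>\<close> satisfies \<open>J'' + b J' = \<integral> |u|^p \<phi> + \<integral> u \<Delta>\<phi>\<close> (\<open>strong_solution_pairing\<close>). By Young's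
  inequality the Laplacian term is absorbed by one half of the nonlinear term at the
  cost of a constant, and by Jensen's inequality the other half controls a power of \<open>J\<close>. This gives
  \<open>J'' + b J' \<ge> k (J^p - \<theta>^p)\<close> as long as \<open>J \<ge> 0\<close> (\<open>localized_inequality\<close>), with \<open>k\<close> and \<open>\<theta>\<close> depending
  on the scale \<open>R\<close>. The scale \<open>R(\<epsilon>)\<close> is the one for which \<open>\<theta> = \<epsilon> I0 / 4\<close>, half of a lower bound for \<open>J(0)\<close>,
  and then the rate \<open>k \<theta>^(p-1)\<close> is a constant times \<open>\<epsilon>^\<alpha>\<close> (\<open>R_scale_props\<close>).

  With \<open>m = 2 / (p - 1)\<close> the function \<open>f = (1 - \<mu> B)^(-m)\<close> satisfies
  \<open>f'' + b f' \<le> k \<theta>^(p-1) f^p\<close> as long as \<open>\<mu> B < 1\<close>, provided that \<open>\<mu>\<close> is a sufficiently small multiple of the rate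
  (\<open>subsolution\<close>). That the exponents \<open>-m-2\<close> on the two sides agree explains the choice of \<open>m\<close>; the
  hypotheses on \<open>b\<close> enter through the bounds of \<open>b' / b\<^sup>2\<close> and \<open>1 / b\<^sup>2\<close> in \<open>damping_estimates\<close>.
  Comparison with \<open>\<theta> (1 + f)\<close> (\<open>comparison_second_order\<close>) yields \<open>J \<ge> \<theta> f\<close>. Since \<open>J\<close> is continuous
  and \<open>f\<close> blows up when \<open>\<mu> B = 1\<close>, the solution cannot exist beyond that time. The rate is bounded
  uniformly in the data by the smallness condition on \<open>\<epsilon>0\<close>, so one constant \<open>\<mu>0\<close> serves for all data.

  Two points of the functional setting need proof. The pairing with the dual of \<open>H1\<close> involves weak
  derivatives of the test function that are merely chosen, so they must be unique
  almost everywhere: this is the fundamental lemma \<open>fundamental_lemma_L2\<close>, which is proved by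
  approximating indicators of boxes by test functions built from the given cut-off profile. And test
  functions belong to \<open>H1\<close> because partial derivatives of compactly supported functions have
  integral zero (\<open>integral_partial_eq_0\<close>).\<close>

section \<open>Calculus of k times differentiable functions\<close>

lemma partial_eq:
  fixes f :: "real ^ 'n \<Rightarrow> real"
  assumes "(f has_derivative f') (at x)"
  shows "partial i f x = f' (axis i 1)"
  using assms frechet_derivative_at[OF assms] by (simp add: partial_def)

lemma Ck_Suc_has_derivative:
  fixes f :: "real ^ 'n \<Rightarrow> real"
  assumes "Ck (Suc k) f"
  shows "(f has_derivative frechet_derivative f (at x)) (at x)"
  using assms by (simp add: differentiable_on_def frechet_derivative_works)

lemma Ck_imp_continuous: "Ck k f \<Longrightarrow> continuous_on UNIV f"
  by (cases k) (auto intro: differentiable_imp_continuous_on)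

lemma Ck_Suc_imp_Ck: "Ck (Suc k) f \<Longrightarrow> Ck k f"
proof (induction k arbitrary: f)
  case 0
  then show ?case by (auto intro: differentiable_imp_continuous_on)
next
  case (Suc k)
  then have "f differentiable_on UNIV" "\<And>i. Ck (Suc k) (partial i f)" by auto
  with Suc.IH show ?case by auto
qed

lemma Ck_SucI:
  fixes f :: "real ^ 'n \<Rightarrow> real"
  assumes "\<And>x. (f has_derivative f' x) (at x)"
    and "\<And>i. Ck k (\<lambda>x. f' x (axis i 1))"
  shows "Ck (Suc k) f"
proof -
  have "partial i f = (\<lambda>x. f' x (axis i 1))" for i
    using partial_eq[OF assms(1)] by auto
  then show ?thesis
    using assms by (auto simp: differentiable_on_def differentiable_def)
qed

lemma Ck_const: "Ck k (\<lambda>x. c)"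
proof (induction k arbitrary: c)
  case (Suc k)
  show ?case by (rule Ck_SucI[OF has_derivative_const]) (rule Suc.IH)
qed simp

lemma Ck_add:
  fixes f g :: "real ^ 'n \<Rightarrow> real"
  assumes "Ck k f" "Ck k g"
  shows "Ck k (\<lambda>x. f x + g x)"
  using assms
proof (induction k arbitrary: f g)
  case 0
  then show ?case by (auto intro: continuous_intros)
next
  case (Suc k)
  have "Ck k (\<lambda>x. partial i f x + partial i g x)" for i
    using Suc.prems by (intro Suc.IH) auto
  then show ?case
    by (intro Ck_SucI[OF has_derivative_add[OF Ck_Suc_has_derivative[OF Suc.prems(1)]
            Ck_Suc_has_derivative[OF Suc.prems(2)]]])
      (simp add: partial_def)
qed

lemma Ck_mult:
  fixes f g :: "real ^ 'n \<Rightarrow> real"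
  assumes "Ck k f" "Ck k g"
  shows "Ck k (\<lambda>x. f x * g x)"
  using assms
proof (induction k arbitrary: f g)
  case 0
  then show ?case by (auto intro: continuous_intros)
next
  case (Suc k)
  have "Ck k (\<lambda>x. f x * partial i g x)" "Ck k (\<lambda>x. partial i f x * g x)" for i
    using Suc.prems by (auto intro!: Suc.IH dest: Ck_Suc_imp_Ck simp del: Ck.simps) (auto)
  then have "Ck k (\<lambda>x. f x * partial i g x + partial i f x * g x)" for i
    by (rule Ck_add)
  then show ?case
    by (intro Ck_SucI[OF has_derivative_mult[OF Ck_Suc_has_derivative[OF Suc.prems(1)]
            Ck_Suc_has_derivative[OF Suc.prems(2)]]])
      (simp add: partial_def)
qed

lemma Ck_power: "Ck k f \<Longrightarrow> Ck k (\<lambda>x. f x ^ m)"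
  by (induction m) (auto intro: Ck_mult Ck_const)

lemma Ck_prod:
  assumes "\<And>i. i \<in> J \<Longrightarrow> Ck k (f i)"
  shows "Ck k (\<lambda>x. \<Prod>i\<in>J. f i x)"
  using assms by (induction J rule: infinite_finite_induct) (auto intro: Ck_mult Ck_const)

lemma has_derivative_component: "((\<lambda>x. x $ i) has_derivative (\<lambda>h. h $ i)) (at x)"
  using bounded_linear.has_derivative[OF bounded_linear_vec_nth has_derivative_ident] .

lemma Ck_component: "Ck k (\<lambda>x. x $ i)"
  by (cases k) (auto intro!: continuous_intros Ck_SucI[OF has_derivative_component] Ck_const
      simp del: Ck.simps(2))

lemma affine_has_derivative:
  fixes f :: "real ^ 'n \<Rightarrow> real"
  assumes "(f has_derivative f') (at (c *\<^sub>R x + a))"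
  shows "((\<lambda>x. f (c *\<^sub>R x + a)) has_derivative (\<lambda>h. f' (c *\<^sub>R h))) (at x)"
  by (rule has_derivative_compose[where f="\<lambda>x. c *\<^sub>R x + a" and g=f, OF _ assms])
    (auto intro!: derivative_eq_intros)

lemma partial_affine:
  fixes f :: "real ^ 'n \<Rightarrow> real"
  assumes "f differentiable_on UNIV"
  shows "partial i (\<lambda>x. f (c *\<^sub>R x + a)) x = c * partial i f (c *\<^sub>R x + a)"
proof -
  have D: "(f has_derivative frechet_derivative f (at (c *\<^sub>R x + a))) (at (c *\<^sub>R x + a))"
    using assms by (simp add: differentiable_on_def frechet_derivative_works)
  then have "linear (frechet_derivative f (at (c *\<^sub>R x + a)))"
    using has_derivative_linear by blast
  then show ?thesis
    unfolding partial_eq[OF affine_has_derivative[OF D]]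
    by (simp add: partial_def linear_cmul)
qed

lemma Ck_affine:
  fixes f :: "real ^ 'n \<Rightarrow> real"
  assumes "Ck k f"
  shows "Ck k (\<lambda>x. f (c *\<^sub>R x + a))"
  using assms
proof (induction k arbitrary: f)
  case 0
  then have "continuous_on UNIV f" by simp
  then show ?case
    by (auto intro!: continuous_on_compose2[of UNIV f] continuous_intros)
next
  case (Suc k)
  have d: "f differentiable_on UNIV" using Suc.prems by simp
  have "Ck k (\<lambda>x. c * partial i f (c *\<^sub>R x + a))" for i
    using Suc.prems by (intro Ck_mult Ck_const Suc.IH) auto
  moreover have "partial i (\<lambda>x. f (c *\<^sub>R x + a)) = (\<lambda>x. c * partial i f (c *\<^sub>R x + a))" for i
    by (rule ext) (rule partial_affine[OF d])
  moreover have "(\<lambda>x. f (c *\<^sub>R x + a)) differentiable_on UNIV"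
    using affine_has_derivative[OF Ck_Suc_has_derivative[OF Suc.prems]]
    unfolding differentiable_on_def differentiable_def by blast
  ultimately show ?case by simp
qed

section \<open>Functions of the length of a projection\<close>

text \<open>The profile of a cut-off is differentiable only from the right at 0, so smoothness is recorded
  for positive arguments; near 0 a profile is constant.\<close>

primrec smooth_pos :: "nat \<Rightarrow> (real \<Rightarrow> real) \<Rightarrow> bool" where
  "smooth_pos 0 f \<longleftrightarrow> continuous_on {0<..} f"
| "smooth_pos (Suc k) f \<longleftrightarrow>
     (\<exists>f'. (\<forall>r>0. (f has_real_derivative f' r) (at r)) \<and> smooth_pos k f')"

lemma smooth_pos_continuous:
  assumes "smooth_pos k f"
  shows "continuous_on {0<..} f"
proof (cases k)
  case 0
  then show ?thesis using assms by simp
next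
  case (Suc m)
  then obtain f' where f': "\<forall>r>0. (f has_real_derivative f' r) (at r)"
    using assms by auto
  show ?thesis
  proof (intro continuous_at_imp_continuous_on ballI)
    fix r :: real assume "r \<in> {0<..}"
    then have "(f has_real_derivative f' r) (at r)" using f' by simp
    then show "isCont f r" by (rule DERIV_isCont)
  qed
qed

lemma smooth_pos_Suc: "smooth_pos (Suc k) f \<Longrightarrow> smooth_pos k f"
proof (induction k arbitrary: f)
  case 0
  then show ?case by (simp only: smooth_pos.simps(1) smooth_pos_continuous)
next
  case (Suc k)
  then obtain f' where f': "\<forall>r>0. (f has_real_derivative f' r) (at r)" "smooth_pos (Suc k) f'"
    unfolding smooth_pos.simps(2)[of "Suc k"] by blast
  show ?case
    unfolding smooth_pos.simps(2)[of k]
    by (intro exI[of _ f'] conjI f'(1) Suc.IH f'(2))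
qed

lemma smooth_pos_cong:
  assumes "smooth_pos k f" "\<And>r. r > 0 \<Longrightarrow> f r = g r"
  shows "smooth_pos k g"
proof (cases k)
  case 0
  then show ?thesis using assms continuous_on_cong[of "{0<..}" "{0<..}" f g] by auto
next
  case (Suc m)
  then obtain f' where f': "\<forall>r>0. (f has_real_derivative f' r) (at r)" "smooth_pos m f'"
    using assms(1) by auto
  have "(g has_real_derivative f' r) (at r)" if "r > 0" for r
    by (rule has_field_derivative_transform_within_open[where f=f and S="{0<..}"])
      (use f' that assms in auto)
  then show ?thesis using f' Suc by auto
qed

lemma smooth_pos_add:
  assumes "smooth_pos k f" "smooth_pos k g"
  shows "smooth_pos k (\<lambda>r. f r + g r)"
  using assms
proof (induction k arbitrary: f g)
  case 0
  then show ?case by (auto intro: continuous_intros)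
next
  case (Suc k)
  then obtain f' g' where "\<forall>r>0. (f has_real_derivative f' r) (at r)" "smooth_pos k f'"
    "\<forall>r>0. (g has_real_derivative g' r) (at r)" "smooth_pos k g'" by auto
  with Suc.IH show ?case
    unfolding smooth_pos.simps by (intro exI[of _ "\<lambda>r. f' r + g' r"]) (simp add: DERIV_add)
qed

lemma smooth_pos_mult:
  assumes "smooth_pos k f" "smooth_pos k g"
  shows "smooth_pos k (\<lambda>r. f r * g r)"
  using assms
proof (induction k arbitrary: f g)
  case 0
  then show ?case by (auto intro: continuous_intros)
next
  case (Suc k)
  then obtain f' g' where *: "\<forall>r>0. (f has_real_derivative f' r) (at r)" "smooth_pos k f'"
    "\<forall>r>0. (g has_real_derivative g' r) (at r)" "smooth_pos k g'" by auto
  show ?case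
    unfolding smooth_pos.simps
  proof (intro exI[of _ "\<lambda>r. f' r * g r + g' r * f r"] conjI allI impI)
    show "((\<lambda>r. f r * g r) has_real_derivative f' r * g r + g' r * f r) (at r)" if "r > 0" for r
      by (rule DERIV_mult) (use *(1,3) that in blast)+
    show "smooth_pos k (\<lambda>r. f' r * g r + g' r * f r)"
      by (intro smooth_pos_add Suc.IH *(2,4) smooth_pos_Suc[OF Suc.prems(1)]
          smooth_pos_Suc[OF Suc.prems(2)])
  qed
qed

lemma smooth_pos_const: "smooth_pos k (\<lambda>r. c)"
proof (induction k arbitrary: c)
  case (Suc k)
  then show ?case
    unfolding smooth_pos.simps
    by (intro exI[of _ "\<lambda>r. 0"] conjI allI impI DERIV_const) simp
qed simp

lemma smooth_pos_inverse: "smooth_pos k inverse"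
proof (induction k)
  case 0
  then show ?case by (auto intro!: continuous_intros)
next
  case (Suc k)
  show ?case
    unfolding smooth_pos.simps
  proof (intro exI[of _ "\<lambda>r. (-1) * (inverse r * inverse r)"] conjI allI impI)
    show "(inverse has_real_derivative (-1) * (inverse r * inverse r)) (at r)" if "r > 0" for r :: real
      using DERIV_inverse[of r UNIV] that by (simp add: power2_eq_square numeral_2_eq_2)
    show "smooth_pos k (\<lambda>r. (-1) * (inverse r * inverse r))"
      by (intro smooth_pos_mult smooth_pos_const Suc)
  qed
qed

text \<open>Two cases of this seminorm occur: \<open>J = UNIV\<close>, the Euclidean norm, for the radial cut-off, and
  \<open>J = {i}\<close>, the modulus of a coordinate, for cut-offs adapted to boxes. Treating them together
  avoids two proofs of smoothness.\<close>

definition plen :: "'n set \<Rightarrow> real ^ 'n \<Rightarrow> real" where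
  "plen J x = sqrt (\<Sum>i\<in>J. (x $ i)\<^sup>2)"

lemma plen_UNIV: "plen UNIV = norm"
  by (auto simp: plen_def norm_vec_def L2_set_def)

lemma plen_singleton: "plen {i} x = \<bar>x $ i\<bar>"
  by (simp add: plen_def)

lemma plen_nonneg: "0 \<le> plen J x"
  by (simp add: plen_def sum_nonneg)

lemma continuous_plen: "continuous_on UNIV (plen J)"
  unfolding plen_def by (intro continuous_intros)

lemma has_derivative_plen:
  assumes "0 < plen J x"
  shows "(plen J has_derivative (\<lambda>h. (\<Sum>i\<in>J. x $ i * h $ i) / plen J x)) (at x)"
proof -
  have pos: "0 < (\<Sum>i\<in>J. (x $ i)\<^sup>2)" using assms by (simp add: plen_def)
  have 1: "((\<lambda>x. \<Sum>i\<in>J. (x $ i)\<^sup>2) has_derivative (\<lambda>h. \<Sum>i\<in>J. 2 * h $ i * x $ i)) (at x)"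
    by (rule has_derivative_sum)
      (auto intro!: derivative_eq_intros has_derivative_component simp: field_simps)
  have "(sqrt has_derivative (*) (inverse (sqrt (\<Sum>i\<in>J. (x $ i)\<^sup>2)) / 2))
    (at (\<Sum>i\<in>J. (x $ i)\<^sup>2))"
    using DERIV_real_sqrt[OF pos] by (simp add: has_field_derivative_def)
  from has_derivative_compose[OF 1 this] show ?thesis
    by (simp add: plen_def[abs_def] sum_distrib_left sum_divide_distrib sum_distrib_right
        divide_simps mult_ac)
qed

text \<open>A function of the length is as smooth as the profile away from the zeros of the length, where
  the length itself is not differentiable; there the profile is constant. The partial derivatives
  are again products of a coordinate and a function of the length whose profile \<open>f'(r)/r\<close> belongs
  to the same class, which makes the induction work.\<close>

lemma Ck_plen:
  fixes J :: "'n::finite set"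
  assumes "smooth_pos k f" and "\<And>r. 0 \<le> r \<Longrightarrow> r < 1 \<Longrightarrow> f r = c"
  shows "Ck k (\<lambda>x. f (plen J x))"
  using assms
proof (induction k arbitrary: f c)
  case 0
  let ?U = "{x. plen J x < 1}" and ?V = "{x. plen J x > 0}"
  have op: "open ?U" "open ?V"
    using continuous_plen[of J] by (auto intro: open_Collect_less continuous_intros)
  have "?U \<union> ?V = UNIV" by force
  moreover have "continuous_on ?U (\<lambda>x. f (plen J x))"
    using 0 plen_nonneg by (subst continuous_on_cong[OF refl, of _ _ "\<lambda>x. c"]) auto
  moreover have "continuous_on ?V (\<lambda>x. f (plen J x))"
  proof (rule continuous_on_compose2[of "{0<..}" f])
    show "continuous_on {0<..} f" using 0 by simp
    show "continuous_on ?V (plen J)" by (rule continuous_on_subset[OF continuous_plen subset_UNIV])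
  qed auto
  ultimately show ?case
    using continuous_on_open_Un[OF op] by (simp only: Ck.simps)
next
  case (Suc k)
  obtain f' where f': "\<And>r. r > 0 \<Longrightarrow> (f has_real_derivative f' r) (at r)" "smooth_pos k f'"
    using Suc.prems by auto
  have zero: "f' r = 0" if "0 < r" "r < 1" for r
  proof -
    have "(f has_real_derivative 0) (at r)"
      by (rule has_field_derivative_transform_within_open[of "\<lambda>x. c" _ _ "{0<..<1}"])
        (use that Suc.prems in auto)
    then show ?thesis using f' that DERIV_unique by blast
  qed
  define g where "g r = (if r = 0 then 0 else f' r * inverse r)" for r
  have g: "Ck k (\<lambda>x. g (plen J x))"
  proof (rule Suc.IH)
    show "smooth_pos k g"
      by (rule smooth_pos_cong[OF smooth_pos_mult[OF f'(2) smooth_pos_inverse]])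
        (auto simp: g_def)
    show "g r = 0" if "0 \<le> r" "r < 1" for r using that zero[of r] by (auto simp: g_def)
  qed
  have D: "((\<lambda>x. f (plen J x)) has_derivative
      (\<lambda>h. g (plen J x) * (\<Sum>i\<in>J. x $ i * h $ i))) (at x)" for x :: "real ^ 'n"
  proof (cases "plen J x > 0")
    case True
    have "(f has_derivative (*) (f' (plen J x))) (at (plen J x))"
      using f'(1)[OF True] by (simp add: has_field_derivative_def)
    from has_derivative_compose[OF has_derivative_plen[OF True] this] show ?thesis
      using True by (simp add: g_def divide_simps mult_ac)
  next
    case False
    then have 0: "plen J x = 0" using plen_nonneg[of J x] by linarith
    have "open {x. plen J x < 1}"
      using continuous_plen[of J] by (auto intro: open_Collect_less continuous_intros)
    then have "((\<lambda>x. f (plen J x)) has_derivative (\<lambda>h. 0)) (at x)"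
    proof (rule has_derivative_transform_within_open[OF has_derivative_const])
      show "x \<in> {x. plen J x < 1}" using 0 by simp
      show "c = f (plen J y)" if "y \<in> {x. plen J x < 1}" for y
        using that Suc.prems(2)[of "plen J y"] plen_nonneg[of J y] by simp
    qed
    then show ?thesis using 0 by (simp add: g_def)
  qed
  have "(\<Sum>i\<in>J. x $ i * axis j 1 $ i) = (if j \<in> J then x $ j else 0)" for j and x :: "real ^ 'n"
    by (simp add: axis_def if_distrib cong: if_cong)
  moreover have "Ck k (\<lambda>x :: real ^ 'n. if j \<in> J then x $ j else 0)" for j
    by (cases "j \<in> J") (simp_all add: Ck_component Ck_const del: Ck.simps)
  ultimately show ?case
    by (intro Ck_SucI[OF D] Ck_mult g) simp
qed

lemma smooth_halfline_smooth_pos: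
  assumes "smooth_halfline f"
  shows "smooth_pos k f"
proof -
  obtain D where D: "D 0 = f"
    "\<And>k t. t \<ge> 0 \<Longrightarrow> (D k has_real_derivative D (Suc k) t) (at t within {0..})"
    using assms unfolding smooth_halfline_def by blast
  have DD: "(D j has_real_derivative D (Suc j) t) (at t)" if "t > 0" for j t
  proof -
    have "(D j has_real_derivative D (Suc j) t) (at t within {0<..})"
      using D(2)[of t j] that by (auto intro: DERIV_subset)
    then show ?thesis using that at_within_open[of t "{0<..}"] by simp
  qed
  have "smooth_pos k (D j)" for j
  proof (induction k arbitrary: j)
    case 0
    show ?case using DERIV_isCont[OF DD] by (auto intro!: continuous_at_imp_continuous_on)
  next
    case (Suc k)
    show ?case
      unfolding smooth_pos.simps
      by (intro exI[of _ "D (Suc j)"] conjI allI impI DD Suc)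
  qed
  then show ?thesis using D(1) by metis
qed

section \<open>Integration of continuous functions with bounded support\<close>

lemma continuous_bounded_support_bounded:
  fixes f :: "real ^ 'n \<Rightarrow> real"
  assumes "continuous_on UNIV f" "bounded {x. f x \<noteq> 0}"
  obtains M where "M \<ge> 0" "\<And>x. \<bar>f x\<bar> \<le> M"
proof -
  let ?K = "closure {x. f x \<noteq> 0}"
  have "compact (f ` ?K)"
    using assms by (intro compact_continuous_image)
      (auto intro: continuous_on_subset simp: compact_eq_bounded_closed)
  then have "bounded (f ` ?K)" by (rule compact_imp_bounded)
  then obtain M where M: "\<And>y. y \<in> f ` ?K \<Longrightarrow> norm y \<le> M"
    unfolding bounded_iff by blast
  have "\<bar>f x\<bar> \<le> max M 0" for x
  proof (cases "f x = 0")
    case False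
    then have "x \<in> ?K" using closure_subset[of "{x. f x \<noteq> 0}"] by blast
    then have "norm (f x) \<le> M" by (intro M imageI)
    then show ?thesis by simp
  qed simp
  then show ?thesis using that[of "max M 0"] by auto
qed

lemma continuous_bounded_support_integrable:
  fixes f :: "real ^ 'n \<Rightarrow> real"
  assumes "continuous_on UNIV f" "bounded {x. f x \<noteq> 0}"
  shows "integrable lborel f" "integrable lebesgue f"
proof -
  let ?K = "closure {x. f x \<noteq> 0}"
  have "integrable lborel (\<lambda>x. indicator ?K x *\<^sub>R f x)"
    using assms by (intro borel_integrable_compact)
      (auto intro: continuous_on_subset simp: compact_eq_bounded_closed)
  moreover have "(\<lambda>x. indicator ?K x *\<^sub>R f x) = f"
    using closure_subset[of "{x. f x \<noteq> 0}"] by (auto simp: indicator_def fun_eq_iff)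
  ultimately show "integrable lborel f" by simp
  then show "integrable lebesgue f"
    using integrable_completion[of f lborel] borel_measurable_integrable by blast
qed

lemma continuous_bounded_support_L2:
  fixes f :: "real ^ 'n \<Rightarrow> real"
  assumes "continuous_on UNIV f" "bounded {x. f x \<noteq> 0}"
  shows "f \<in> L2"
proof -
  have "integrable lebesgue (\<lambda>x. (f x)\<^sup>2)"
    using assms by (intro continuous_bounded_support_integrable continuous_intros) auto
  moreover have "f \<in> borel_measurable lebesgue"
    using continuous_bounded_support_integrable(2)[OF assms] borel_measurable_integrable by blast
  ultimately show ?thesis by (simp add: L2_def)
qed

lemma integral_affine:
  fixes f :: "real ^ 'n \<Rightarrow> real"
  assumes [measurable]: "f \<in> borel_measurable borel" and c: "c \<noteq> 0"
  shows "integral\<^sup>L lborel f = \<bar>c\<bar> ^ CARD('n) * (LINT x|lborel. f (c *\<^sub>R x + a))"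
proof -
  have "integral\<^sup>L lborel f
      = integral\<^sup>L (density (distr lborel borel (\<lambda>x. a + c *\<^sub>R x)) (\<lambda>_. \<bar>c\<bar> ^ DIM(real ^ 'n))) f"
    using lborel_affine[OF c, of a] by simp
  also have "\<dots> = \<bar>c\<bar> ^ CARD('n) * (LINT x|lborel. f (c *\<^sub>R x + a))"
    by (subst integral_density) (auto simp: integral_distr add.commute)
  finally show ?thesis .
qed

section \<open>Square integrable functions\<close>

lemma L2_measurable: "f \<in> L2 \<Longrightarrow> f \<in> borel_measurable lebesgue"
  by (simp add: L2_def)

lemma L2_integrable_mult:
  assumes "f \<in> L2" "g \<in> L2"
  shows "integrable lebesgue (\<lambda>x. f x * g x)"
proof (rule Bochner_Integration.integrable_bound)
  show "integrable lebesgue (\<lambda>x. (f x)\<^sup>2 + (g x)\<^sup>2)"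
    using assms by (simp add: L2_def)
  show "(\<lambda>x. f x * g x) \<in> borel_measurable lebesgue"
    using assms by (intro borel_measurable_times) (auto simp: L2_def)
  have "\<bar>a * b\<bar> \<le> a\<^sup>2 + b\<^sup>2" for a b :: real
  proof -
    have "2 * (\<bar>a\<bar> * \<bar>b\<bar>) \<le> a\<^sup>2 + b\<^sup>2" "0 \<le> \<bar>a\<bar> * \<bar>b\<bar>"
      using sum_squares_bound[of "\<bar>a\<bar>" "\<bar>b\<bar>"] by simp_all
    then show ?thesis unfolding abs_mult by linarith
  qed
  then show "AE x in lebesgue. norm (f x * g x) \<le> norm ((f x)\<^sup>2 + (g x)\<^sup>2)"
    by simp
qed

lemma L2_lincomb:
  assumes "f \<in> L2" "g \<in> L2"
  shows "(\<lambda>x. c * f x + d * g x) \<in> L2"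
proof -
  have eq: "(\<lambda>x. (c * f x + d * g x)\<^sup>2)
      = (\<lambda>x. c\<^sup>2 * (f x)\<^sup>2 + d\<^sup>2 * (g x)\<^sup>2 + 2 * c * d * (f x * g x))"
    by (simp add: fun_eq_iff power2_eq_square algebra_simps)
  have "integrable lebesgue (\<lambda>x. (f x)\<^sup>2)" "integrable lebesgue (\<lambda>x. (g x)\<^sup>2)"
    using assms by (auto simp: L2_def)
  then have "integrable lebesgue (\<lambda>x. (c * f x + d * g x)\<^sup>2)"
    unfolding eq using L2_integrable_mult[OF assms] by auto
  moreover have "(\<lambda>x. c * f x + d * g x) \<in> borel_measurable lebesgue"
    using assms by (intro borel_measurable_add borel_measurable_times) (auto simp: L2_def)
  ultimately show ?thesis by (simp add: L2_def)
qed

lemma L2_diff: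
  assumes "f \<in> L2" "g \<in> L2"
  shows "(\<lambda>x. f x - g x) \<in> L2"
  using L2_lincomb[OF assms, of 1 "-1"] by simp

lemma L2_norm_nonneg: "0 \<le> L2_norm f"
  by (simp add: L2_norm_def)

lemma L2_Cauchy_Schwarz:
  assumes "f \<in> L2" "g \<in> L2"
  shows "\<bar>LINT x|lebesgue. f x * g x\<bar> \<le> L2_norm f * L2_norm g"
proof -
  define F where "F = (LINT x|lebesgue. (f x)\<^sup>2)"
  define G where "G = (LINT x|lebesgue. (g x)\<^sup>2)"
  define P where "P = (LINT x|lebesgue. f x * g x)"
  have int: "integrable lebesgue (\<lambda>x. (f x)\<^sup>2)" "integrable lebesgue (\<lambda>x. (g x)\<^sup>2)"
    using assms by (auto simp: L2_def)
  have quad: "0 \<le> F - 2 * s * P + s\<^sup>2 * G" for s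
  proof -
    have "0 \<le> (LINT x|lebesgue. (f x - s * g x)\<^sup>2)" by simp
    also have "(\<lambda>x. (f x - s * g x)\<^sup>2) = (\<lambda>x. (f x)\<^sup>2 - (2 * s) * (f x * g x) + s\<^sup>2 * (g x)\<^sup>2)"
      by (simp add: fun_eq_iff power2_eq_square algebra_simps)
    also have "(LINT x|lebesgue. (f x)\<^sup>2 - (2 * s) * (f x * g x) + s\<^sup>2 * (g x)\<^sup>2)
        = F - 2 * s * P + s\<^sup>2 * G"
      unfolding F_def G_def P_def using int L2_integrable_mult[OF assms] by simp
    finally show ?thesis .
  qed
  have FG: "0 \<le> F" "0 \<le> G" by (simp_all add: F_def G_def)
  have "P\<^sup>2 \<le> F * G"
  proof (cases "G = 0")
    case True
    have "P = 0"
    proof (rule ccontr)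
      assume "P \<noteq> 0"
      then show False using quad[of "(F + 1) / (2 * P)"] True FG by simp
    qed
    then show ?thesis using FG by simp
  next
    case False
    then have "G > 0" using FG by simp
    then show ?thesis using quad[of "P / G"] by (simp add: power2_eq_square field_simps)
  qed
  then have "sqrt (P\<^sup>2) \<le> sqrt (F * G)" by (rule real_sqrt_le_mono)
  then show ?thesis
    by (simp add: P_def F_def G_def L2_norm_def real_sqrt_mult)
qed

section \<open>Test functions\<close>

lemma test_functionI:
  fixes \<phi> :: "real ^ 'n \<Rightarrow> real"
  assumes "\<And>k. Ck k \<phi>" "bounded {x. \<phi> x \<noteq> 0}"
  shows "test_function \<phi>"
  using assms by (simp add: test_function_def compact_closure)

lemma test_function_Ck: "test_function \<phi> \<Longrightarrow> Ck k \<phi>"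
  by (simp add: test_function_def)

lemma test_function_bounded_support: "test_function \<phi> \<Longrightarrow> bounded {x. \<phi> x \<noteq> 0}"
  by (simp add: test_function_def compact_closure)

lemma test_function_continuous: "test_function \<phi> \<Longrightarrow> continuous_on UNIV \<phi>"
  using test_function_Ck Ck_imp_continuous by blast

lemma test_function_integrable: "test_function \<phi> \<Longrightarrow> integrable lebesgue \<phi>"
  by (intro continuous_bounded_support_integrable(2) test_function_continuous
      test_function_bounded_support)

lemma test_function_L2: "test_function \<phi> \<Longrightarrow> \<phi> \<in> L2"
  by (intro continuous_bounded_support_L2 test_function_continuous test_function_bounded_support)

lemma test_function_mult:
  assumes "test_function \<phi>" "\<And>k. Ck k f"
  shows "test_function (\<lambda>x. \<phi> x * f x)" "test_function (\<lambda>x. f x * \<phi> x)"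
proof -
  have "bounded {x. \<phi> x * f x \<noteq> 0}"
    by (rule bounded_subset[OF test_function_bounded_support[OF assms(1)]]) auto
  then show "test_function (\<lambda>x. \<phi> x * f x)"
    using assms by (intro test_functionI Ck_mult) (auto simp: test_function_Ck)
  then show "test_function (\<lambda>x. f x * \<phi> x)" by (simp add: mult.commute)
qed

lemma partial_support:
  fixes f :: "real ^ 'n \<Rightarrow> real"
  shows "{x. partial i f x \<noteq> 0} \<subseteq> closure {x. f x \<noteq> 0}"
proof
  fix x assume x: "x \<in> {x. partial i f x \<noteq> 0}"
  show "x \<in> closure {x. f x \<noteq> 0}"
  proof (rule ccontr)
    assume "x \<notin> closure {x. f x \<noteq> 0}"
    then have "x \<in> - closure {x. f x \<noteq> 0}" by simp
    moreover have "open (- closure {x. f x \<noteq> 0})" by (simp add: open_Compl)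
    moreover have "0 = f y" if "y \<in> - closure {x. f x \<noteq> 0}" for y
      using that closure_subset[of "{x. f x \<noteq> 0}"] by auto
    ultimately have "(f has_derivative (\<lambda>h. 0)) (at x)"
      using has_derivative_transform_within_open[OF has_derivative_const[of "0::real" "at x"]] by blast
    then show False using x partial_eq[of f "\<lambda>h. 0" x i] by simp
  qed
qed

lemma test_function_partial:
  assumes "test_function \<phi>"
  shows "test_function (partial i \<phi>)"
proof (rule test_functionI)
  show "Ck k (partial i \<phi>)" for k using test_function_Ck[OF assms, of "Suc k"] by simp
  show "bounded {x. partial i \<phi> x \<noteq> 0}"
    using assms bounded_subset[OF _ partial_support]
    by (auto simp: test_function_def compact_closure)
qed

text \<open>By translation invariance the difference quotients in a coordinate direction have integral
  zero, and they converge boundedly and on a bounded set to the partial derivative.\<close>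

lemma integral_partial_eq_0:
  fixes f :: "real ^ 'n \<Rightarrow> real"
  assumes "Ck 1 f" "bounded {x. f x \<noteq> 0}"
  shows "(LINT x|lebesgue. partial i f x) = 0"
proof -
  let ?e = "axis i 1 :: real ^ 'n"
  define h where "h j = inverse (real (Suc j))" for j
  have h: "0 < h j" "h j \<le> 1" for j by (auto simp: h_def field_simps)
  define D where "D j x = (f (x + h j *\<^sub>R ?e) - f x) / h j" for j x
  have C1: "Ck (Suc 0) f" using assms(1) by simp
  have cont: "continuous_on UNIV f" "continuous_on UNIV (partial i f)"
    using Ck_imp_continuous[OF assms(1)] C1 by simp_all
  have bp: "bounded {x. partial i f x \<noteq> 0}"
    using bounded_subset[OF bounded_closure[OF assms(2)] partial_support] .
  obtain M where M: "M \<ge> 0" "\<And>x. \<bar>partial i f x\<bar> \<le> M"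
    using continuous_bounded_support_bounded[OF cont(2) bp] by blast
  obtain r where r: "\<And>x. f x \<noteq> 0 \<Longrightarrow> norm x \<le> r"
    using assms(2) unfolding bounded_iff by blast
  have [measurable]: "f \<in> borel_measurable borel" "partial i f \<in> borel_measurable borel"
    using cont by (auto intro: borel_measurable_continuous_onI)
  have [measurable]: "D j \<in> borel_measurable borel" for j
    unfolding D_def by measurable
  have line: "((\<lambda>t. f (x + t *\<^sub>R ?e)) has_real_derivative partial i f (x + t *\<^sub>R ?e)) (at t)" for x t
  proof -
    let ?f' = "frechet_derivative f (at (x + t *\<^sub>R ?e))"
    have D: "(f has_derivative ?f') (at (x + t *\<^sub>R ?e))" by (rule Ck_Suc_has_derivative[OF C1])
    have "((\<lambda>t. x + t *\<^sub>R ?e) has_derivative (\<lambda>s. s *\<^sub>R ?e)) (at t)"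
      by (auto intro!: derivative_eq_intros)
    from has_derivative_compose[OF this D]
    have "((\<lambda>t. f (x + t *\<^sub>R ?e)) has_derivative (\<lambda>s. ?f' (s *\<^sub>R ?e))) (at t)" .
    moreover have "?f' (s *\<^sub>R ?e) = partial i f (x + t *\<^sub>R ?e) * s" for s
      using linear_cmul[OF has_derivative_linear[OF D]] by (simp add: partial_def)
    ultimately show ?thesis by (simp add: has_field_derivative_def)
  qed
  have Dint: "integral\<^sup>L lborel (D j) = 0" for j
  proof -
    have int: "integrable lborel f" by (rule continuous_bounded_support_integrable[OF cont(1) assms(2)])
    have eq: "(LINT x|lborel. f (x + h j *\<^sub>R ?e)) = integral\<^sup>L lborel f"
      using integral_affine[of f 1 "h j *\<^sub>R ?e"] by simp
    have "integrable lborel (\<lambda>x. f (x + h j *\<^sub>R ?e))"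
    proof (rule continuous_bounded_support_integrable)
      show "continuous_on UNIV (\<lambda>x. f (x + h j *\<^sub>R ?e))"
        by (intro continuous_on_compose2[OF cont(1)] continuous_intros) auto
      have "norm x \<le> r + norm (h j *\<^sub>R ?e)" if "f (x + h j *\<^sub>R ?e) \<noteq> 0" for x
        using r[OF that] norm_triangle_ineq4[of "x + h j *\<^sub>R ?e" "h j *\<^sub>R ?e"] by simp
      then show "bounded {x. f (x + h j *\<^sub>R ?e) \<noteq> 0}" unfolding bounded_iff by blast
    qed
    with int eq show ?thesis unfolding D_def by simp
  qed
  have "(\<lambda>j. integral\<^sup>L lborel (D j)) \<longlonglongrightarrow> integral\<^sup>L lborel (partial i f)"
  proof (rule integral_dominated_convergence[where w="\<lambda>x. M * indicator (cball 0 (r + 1)) x"])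
    show "integrable lborel (\<lambda>x. M * indicator (cball 0 (r + 1)) x :: real)"
      by (intro integrable_mult_right integrable_real_indicator) (simp_all add: emeasure_lborel_cball_finite[unfolded infinity_ennreal_def])
    show "AE x in lborel. norm (D j x) \<le> M * indicator (cball 0 (r + 1)) x" for j
    proof (intro AE_I2)
      fix x
      obtain z where z: "f (x + h j *\<^sub>R ?e) - f (x + 0 *\<^sub>R ?e)
          = (h j - 0) * partial i f (x + z *\<^sub>R ?e)"
        using MVT2[OF h(1)[of j], of "\<lambda>t. f (x + t *\<^sub>R ?e)" "\<lambda>t. partial i f (x + t *\<^sub>R ?e)"] line
        by blast
      then have bd: "\<bar>D j x\<bar> \<le> M" using M h(1)[of j] by (simp add: D_def)
      show "norm (D j x) \<le> M * indicator (cball 0 (r + 1)) x"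
      proof (cases "norm x \<le> r + 1")
        case True
        then show ?thesis using bd by simp
      next
        case False
        have "norm (h j *\<^sub>R ?e) \<le> 1" using h[of j] by (simp add: norm_axis_1)
        then have "norm (x + h j *\<^sub>R ?e) > r" "norm x > r"
          using False norm_triangle_ineq4[of "x + h j *\<^sub>R ?e" "h j *\<^sub>R ?e"] by auto
        then have "f (x + h j *\<^sub>R ?e) = 0" "f x = 0" using r by force+
        then show ?thesis using M by (simp add: D_def)
      qed
    qed
    show "AE x in lborel. (\<lambda>j. D j x) \<longlonglongrightarrow> partial i f x"
    proof (intro AE_I2)
      fix x
      have "((\<lambda>t. (f (x + t *\<^sub>R ?e) - f (x + 0 *\<^sub>R ?e)) / (t - 0)) \<longlongrightarrow> partial i f (x + 0 *\<^sub>R ?e)) (at 0)"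
        using line[of x 0] unfolding has_field_derivative_iff by simp
      moreover have "filterlim h (at 0) sequentially"
        unfolding filterlim_at
        using h(1) LIMSEQ_inverse_real_of_nat
        by (simp add: h_def[abs_def] eventually_sequentially del: of_nat_Suc)
      ultimately show "(\<lambda>j. D j x) \<longlonglongrightarrow> partial i f x"
        using filterlim_compose[of _ _ "at 0" h sequentially] by (fastforce simp: D_def)
    qed
  qed simp_all
  then have "integral\<^sup>L lborel (partial i f) = 0" using Dint LIMSEQ_unique by (simp add: LIMSEQ_const_iff)
  then show ?thesis by (subst integral_completion) auto
qed

lemma partial_mult:
  fixes f g :: "real ^ 'n \<Rightarrow> real"
  assumes "Ck (Suc 0) f" "Ck (Suc 0) g"
  shows "partial i (\<lambda>x. f x * g x) x = f x * partial i g x + partial i f x * g x"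
  unfolding partial_eq[OF has_derivative_mult[OF Ck_Suc_has_derivative[OF assms(1)]
        Ck_Suc_has_derivative[OF assms(2)]]]
  by (simp add: partial_def)

lemma test_function_weak_partial:
  assumes "test_function \<phi>"
  shows "is_weak_partial i \<phi> (partial i \<phi>)"
  unfolding is_weak_partial_def
proof (intro conjI allI impI)
  show "partial i \<phi> \<in> L2" using test_function_L2[OF test_function_partial[OF assms]] .
  fix \<theta> :: "real ^ 'a \<Rightarrow> real" assume \<theta>: "test_function \<theta>"
  have int: "integrable lebesgue (\<lambda>x. \<phi> x * partial i \<theta> x)" "integrable lebesgue (\<lambda>x. partial i \<phi> x * \<theta> x)"
    using assms \<theta> test_function_partial[OF assms, of i] test_function_partial[OF \<theta>, of i]
    by (simp_all add: L2_integrable_mult test_function_L2)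
  have "test_function (\<lambda>x. \<phi> x * \<theta> x)"
    using assms \<theta> by (intro test_function_mult) (auto simp: test_function_Ck)
  then have "(LINT x|lebesgue. partial i (\<lambda>x. \<phi> x * \<theta> x) x) = 0"
    by (intro integral_partial_eq_0 test_function_Ck test_function_bounded_support)
  moreover have "(\<lambda>x. partial i (\<lambda>x. \<phi> x * \<theta> x) x) = (\<lambda>x. \<phi> x * partial i \<theta> x + partial i \<phi> x * \<theta> x)"
    by (intro ext partial_mult test_function_Ck assms \<theta>)
  ultimately show "(LINT x|lebesgue. \<phi> x * partial i \<theta> x) = - (LINT x|lebesgue. partial i \<phi> x * \<theta> x)"
    using int by simp
qed

section \<open>Uniqueness of weak derivatives\<close>

lemma cutoff_profile_continuous:
  assumes "cutoff_profile \<eta>"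
  shows "continuous_on {0..} \<eta>"
proof -
  obtain D where D: "D 0 = \<eta>"
    "\<And>k t. t \<ge> 0 \<Longrightarrow> (D k has_real_derivative D (Suc k) t) (at t within {0..})"
    using assms unfolding cutoff_profile_def smooth_halfline_def by blast
  show ?thesis
    using DERIV_continuous_on[of "{0..}" \<eta> "D 1"] D(2)[of _ 0] D(1) by simp
qed

text \<open>A profile equals 1 exactly on an initial interval, because it decreases beyond 1, so its powers decrease to the
  indicator of that interval. This produces indicators from smooth functions.\<close>

lemma cutoff_profile_eq_1_iff:
  assumes "cutoff_profile \<eta>"
  obtains \<rho> where "1 \<le> \<rho>" "\<And>r. 0 \<le> r \<Longrightarrow> \<eta> r = 1 \<longleftrightarrow> r \<le> \<rho>"
proof -
  have \<eta>: "\<And>r. 0 \<le> r \<Longrightarrow> \<eta> r \<le> 1" "\<And>r. 0 \<le> r \<Longrightarrow> r \<le> 1 \<Longrightarrow> \<eta> r = 1"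
    "\<And>r s. 1 < r \<Longrightarrow> r \<le> s \<Longrightarrow> s < 2 \<Longrightarrow> \<eta> s \<le> \<eta> r" "\<And>r. r \<ge> 2 \<Longrightarrow> \<eta> r = 0"
    using assms by (auto simp: cutoff_profile_def monotone_on_def)
  let ?K = "{0..} \<inter> \<eta> -` {1}"
  have "closed ?K"
    by (intro continuous_closed_preimage cutoff_profile_continuous assms) auto
  moreover have bdd: "bdd_above ?K"
  proof (rule bdd_aboveI[of _ 2])
    show "r \<le> 2" if "r \<in> ?K" for r using that \<eta>(4)[of r] by (cases "r \<le> 2") auto
  qed
  moreover have one: "1 \<in> ?K" using \<eta>(2)[of 1] by simp
  ultimately have "Sup ?K \<in> ?K" by (intro closed_contains_Sup) (blast, blast, blast)
  define \<rho> where "\<rho> = Sup ?K"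
  have \<rho>: "\<eta> \<rho> = 1" using \<open>Sup ?K \<in> ?K\<close> by (simp add: \<rho>_def)
  have "1 \<le> \<rho>" unfolding \<rho>_def using one bdd by (rule cSup_upper)
  moreover have "\<rho> < 2" using \<rho> \<eta>(4)[of \<rho>] by (cases "\<rho> < 2") auto
  have "\<eta> r = 1 \<longleftrightarrow> r \<le> \<rho>" if "0 \<le> r" for r
  proof
    assume "\<eta> r = 1"
    then show "r \<le> \<rho>" unfolding \<rho>_def using that bdd by (intro cSup_upper) auto
  next
    assume "r \<le> \<rho>"
    show "\<eta> r = 1"
    proof (cases "r \<le> 1")
      case False
      then have "\<eta> \<rho> \<le> \<eta> r" using \<eta>(3)[of r \<rho>] \<open>r \<le> \<rho>\<close> \<open>\<rho> < 2\<close> by simp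
      then show ?thesis using \<rho> \<eta>(1)[of r] that by simp
    qed (use \<eta> that in simp)
  qed
  ultimately show ?thesis using that by blast
qed

definition box_bump :: "(real \<Rightarrow> real) \<Rightarrow> real ^ 'n \<Rightarrow> real ^ 'n \<Rightarrow> real ^ 'n \<Rightarrow> real" where
  "box_bump \<eta> c r x = (\<Prod>i\<in>UNIV. \<eta> (\<bar>x $ i - c $ i\<bar> / r $ i))"

lemma test_function_box_bump:
  fixes c r :: "real ^ 'n"
  assumes \<eta>: "cutoff_profile \<eta>" and r: "\<And>i. 0 < r $ i"
  shows "test_function (box_bump \<eta> c r)"
proof (rule test_functionI)
  fix k
  have "Ck k (\<lambda>x :: real ^ 'n. \<eta> (plen {i} x))" for i
    by (rule Ck_plen[where c=1])
      (use \<eta> in \<open>auto simp: cutoff_profile_def intro: smooth_halfline_smooth_pos\<close>)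
  then have "Ck k (\<lambda>x. \<eta> (plen {i} ((1 / r $ i) *\<^sub>R x + (- (1 / r $ i)) *\<^sub>R c)))" for i
    by (rule Ck_affine)
  moreover have "plen {i} ((1 / r $ i) *\<^sub>R x + (- (1 / r $ i)) *\<^sub>R c) = \<bar>x $ i - c $ i\<bar> / r $ i" for i x
  proof -
    have "plen {i} ((1 / r $ i) *\<^sub>R x + (- (1 / r $ i)) *\<^sub>R c) = \<bar>(x $ i - c $ i) / r $ i\<bar>"
      by (simp add: plen_singleton diff_divide_distrib)
    then show ?thesis using r[of i] by simp
  qed
  ultimately show "Ck k (box_bump \<eta> c r)"
    unfolding box_bump_def[abs_def] by (intro Ck_prod) simp
next
  have "{x. box_bump \<eta> c r x \<noteq> 0} \<subseteq> cbox (c - 2 *\<^sub>R r) (c + 2 *\<^sub>R r)"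
  proof
    fix x assume x: "x \<in> {x. box_bump \<eta> c r x \<noteq> 0}"
    have "\<bar>x $ i - c $ i\<bar> / r $ i < 2" for i
    proof (rule ccontr)
      assume "\<not> ?thesis"
      then have "\<eta> (\<bar>x $ i - c $ i\<bar> / r $ i) = 0" using \<eta> by (simp add: cutoff_profile_def)
      then have "box_bump \<eta> c r x = 0" unfolding box_bump_def by (intro prod_zero) auto
      then show False using x by simp
    qed
    then have "\<bar>x $ i - c $ i\<bar> < 2 * r $ i" for i using r[of i] by (simp add: divide_less_eq)
    then show "x \<in> cbox (c - 2 *\<^sub>R r) (c + 2 *\<^sub>R r)"
      unfolding mem_box_cart by (simp add: abs_less_iff) (smt (verit))
  qed
  then show "bounded {x. box_bump \<eta> c r x \<noteq> 0}" using bounded_subset bounded_cbox by blast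
qed

lemma box_bump_range:
  fixes c r :: "real ^ 'n"
  assumes \<eta>: "cutoff_profile \<eta>" and r: "\<And>i. 0 < r $ i"
  shows "0 \<le> box_bump \<eta> c r x"
    "box_bump \<eta> c r x \<le> \<eta> (\<bar>x $ i - c $ i\<bar> / r $ i)"
    "\<eta> (\<bar>x $ i - c $ i\<bar> / r $ i) \<le> 1"
proof -
  have *: "0 \<le> \<eta> (\<bar>x $ j - c $ j\<bar> / r $ j)" "\<eta> (\<bar>x $ j - c $ j\<bar> / r $ j) \<le> 1" for j
    using \<eta> r[of j] by (auto simp: cutoff_profile_def)
  show "0 \<le> box_bump \<eta> c r x" unfolding box_bump_def by (intro prod_nonneg) (use * in auto)
  have "box_bump \<eta> c r x = \<eta> (\<bar>x $ i - c $ i\<bar> / r $ i)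
      * (\<Prod>j\<in>UNIV - {i}. \<eta> (\<bar>x $ j - c $ j\<bar> / r $ j))"
    unfolding box_bump_def by (simp add: prod.remove[of UNIV i])
  also have "\<dots> \<le> \<eta> (\<bar>x $ i - c $ i\<bar> / r $ i) * 1"
    by (intro mult_left_mono prod_le_1) (use * in auto)
  finally show "box_bump \<eta> c r x \<le> \<eta> (\<bar>x $ i - c $ i\<bar> / r $ i)" by simp
  show "\<eta> (\<bar>x $ i - c $ i\<bar> / r $ i) \<le> 1" by (rule *)
qed

text \<open>The powers of a product of cut-offs in the single coordinates are test functions that decrease
  to the indicator of a box, and suitable centres and widths produce every nondegenerate box.\<close>

lemma integral_box_eq_0:
  fixes h :: "real ^ 'n \<Rightarrow> real"
  assumes \<eta>: "cutoff_profile \<eta>" and h: "h \<in> L2"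
    and orth: "\<And>\<phi>. test_function \<phi> \<Longrightarrow> (LINT x|lebesgue. h x * \<phi> x) = 0"
  shows "(LINT x|lebesgue. h x * indicator (cbox a b) x) = 0"
proof (cases "box a b = {}")
  case True
  then have "cbox a b \<in> null_sets lebesgue"
    by (simp add: negligible_interval flip: negligible_iff_null_sets)
  then have "AE x in lebesgue. h x * indicator (cbox a b) x = 0"
    using AE_not_in by (force elim: eventually_mono)
  then show ?thesis by (rule integral_eq_zero_AE)
next
  case False
  then have ab: "a $ i < b $ i" for i by (simp add: interval_ne_empty_cart)
  obtain \<rho> where \<rho>: "1 \<le> \<rho>" "\<And>r. 0 \<le> r \<Longrightarrow> \<eta> r = 1 \<longleftrightarrow> r \<le> \<rho>"
    using cutoff_profile_eq_1_iff[OF \<eta>] by blast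
  \<comment> \<open>the bump with these centres and widths equals 1 exactly on the box\<close>
  define c where "c = (1 / 2) *\<^sub>R (a + b)"
  define r where "r = (1 / (2 * \<rho>)) *\<^sub>R (b - a)"
  have r: "0 < r $ i" for i using ab[of i] \<rho> by (simp add: r_def)
  have mem: "\<eta> (\<bar>x $ i - c $ i\<bar> / r $ i) = 1 \<longleftrightarrow> a $ i \<le> x $ i \<and> x $ i \<le> b $ i" for x i
  proof -
    have "\<eta> (\<bar>x $ i - c $ i\<bar> / r $ i) = 1 \<longleftrightarrow> \<bar>x $ i - c $ i\<bar> \<le> \<rho> * r $ i"
      using \<rho>(2)[of "\<bar>x $ i - c $ i\<bar> / r $ i"] r[of i] by (simp add: divide_le_eq)
    also have "\<rho> * r $ i = (b $ i - a $ i) / 2" using \<rho> by (simp add: r_def)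
    also have "\<bar>x $ i - c $ i\<bar> \<le> (b $ i - a $ i) / 2 \<longleftrightarrow> a $ i \<le> x $ i \<and> x $ i \<le> b $ i"
      unfolding abs_le_iff by (auto simp: c_def field_simps)
    finally show ?thesis .
  qed
  let ?B = "box_bump \<eta> c r"
  have tf: "test_function (\<lambda>x. ?B x ^ Suc j)" for j
  proof -
    have "test_function ?B" by (rule test_function_box_bump[OF \<eta> r])
    then have "test_function (\<lambda>x. ?B x * ?B x ^ j)"
      by (intro test_function_mult Ck_power) (auto simp: test_function_Ck)
    then show ?thesis by simp
  qed
  note B = box_bump_range[OF \<eta> r, where c=c]
  have B1: "?B x \<le> 1" for x using B(2)[where x=x and i="undefined :: 'n"] B(3)[where x=x and i="undefined :: 'n"]
    by linarith
  have hm: "h \<in> borel_measurable lebesgue" using L2_measurable[OF h] .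
  have "(\<lambda>j. LINT x|lebesgue. h x * ?B x ^ Suc j) \<longlonglongrightarrow> (LINT x|lebesgue. h x * indicator (cbox a b) x)"
  proof (rule integral_dominated_convergence[where w="\<lambda>x. \<bar>h x * ?B x ^ Suc 0\<bar>"])
    show "(\<lambda>x. h x * indicator (cbox a b) x) \<in> borel_measurable lebesgue"
      by (intro borel_measurable_times hm borel_measurable_indicator) auto
    show "(\<lambda>x. h x * ?B x ^ Suc j) \<in> borel_measurable lebesgue" for j
      using L2_integrable_mult[OF h test_function_L2[OF tf[of j]]] borel_measurable_integrable by blast
    show "integrable lebesgue (\<lambda>x. \<bar>h x * ?B x ^ Suc 0\<bar>)"
      using L2_integrable_mult[OF h test_function_L2[OF tf[of 0]]] by (rule integrable_abs)
    show "AE x in lebesgue. norm (h x * ?B x ^ Suc j) \<le> \<bar>h x * ?B x ^ Suc 0\<bar>" for j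
    proof (intro AE_I2)
      fix x
      have "?B x ^ Suc j \<le> ?B x" using B(1)[where x=x] B1[of x] by (simp add: mult_left_le power_le_one)
      then have "\<bar>h x\<bar> * ?B x ^ Suc j \<le> \<bar>h x\<bar> * ?B x" by (rule mult_left_mono) simp
      then show "norm (h x * ?B x ^ Suc j) \<le> \<bar>h x * ?B x ^ Suc 0\<bar>"
        using B(1)[where x=x] by (simp add: abs_mult)
    qed
    show "AE x in lebesgue. (\<lambda>j. h x * ?B x ^ Suc j) \<longlonglongrightarrow> h x * indicator (cbox a b) x"
    proof (intro AE_I2)
      fix x
      have "(\<lambda>j. ?B x ^ Suc j) \<longlonglongrightarrow> indicator (cbox a b) x"
      proof (cases "x \<in> cbox a b")
        case True
        then have "?B x = 1" using mem[of x] by (simp add: mem_box_cart box_bump_def)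
        then show ?thesis using True by simp
      next
        case False
        then obtain i where "\<not> (a $ i \<le> x $ i \<and> x $ i \<le> b $ i)" by (auto simp: mem_box_cart)
        then have "?B x < 1" using mem[of x i] B(2,3)[where x=x and i=i] by linarith
        then have "(\<lambda>j. ?B x ^ Suc j) \<longlonglongrightarrow> 0"
          using B(1)[where x=x] by (intro LIMSEQ_Suc LIMSEQ_power_zero) simp
        then show ?thesis using False by simp
      qed
      then show "(\<lambda>j. h x * ?B x ^ Suc j) \<longlonglongrightarrow> h x * indicator (cbox a b) x"
        by (rule tendsto_mult_left)
    qed
  qed
  then show ?thesis using orth[OF tf] by (simp add: LIMSEQ_const_iff)
qed

text \<open>The boxes are stable under intersection and generate the Borel sets, and the sets over which
  an integrable function with total integral zero has integral zero form a Dynkin system.\<close>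

lemma AE_eq_0_if_box_integrals_eq_0:
  fixes g :: "real ^ 'n \<Rightarrow> real"
  assumes g: "integrable lborel g"
    and box: "\<And>a b. (LINT x:cbox a b|lborel. g x) = 0"
    and all: "integral\<^sup>L lborel g = 0"
  shows "AE x in lborel. g x = 0"
proof (rule sigma_finite_measure.density_zero[OF sigma_finite_lborel g])
  fix A :: "(real ^ 'n) set" assume "A \<in> sets lborel"
  have int: "set_integrable lborel B g" if "B \<in> sets lborel" for B
    using integrable_mult_indicator[OF that g] by (simp only: set_integrable_def)
  let ?G = "range (\<lambda>(a, b). cbox a b) :: (real ^ 'n) set set"
  have borel: "sets borel = sigma_sets UNIV ?G"
    unfolding borel_eq_atLeastAtMost cbox_interval by (rule sets_measure_of) simp
  have "Int_stable ?G"
    unfolding Int_stable_def by (auto simp: Int_interval split: prod.splits)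
  moreover have "?G \<subseteq> Pow UNIV" by simp
  moreover have "A \<in> sigma_sets UNIV ?G" using \<open>A \<in> sets lborel\<close> borel by simp
  ultimately show "(LINT x:A|lborel. g x) = 0"
  proof (induction rule: sigma_sets_induct_disjoint)
    case (basic A)
    then show ?case using box by auto
  next
    case empty
    then show ?case by (simp add: set_lebesgue_integral_def)
  next
    case (compl A)
    then have A: "A \<in> sets lborel" using borel by simp
    have "integral\<^sup>L lborel g = (LINT x:A \<union> (UNIV - A)|lborel. g x)"
      by (simp add: set_lebesgue_integral_def)
    also have "\<dots> = (LINT x:A|lborel. g x) + (LINT x:UNIV - A|lborel. g x)"
      using A by (intro set_integral_Un int) auto
    finally show ?case using compl all by simp
  next
    case (union A)
    then have A: "A i \<in> sets lborel" for i using borel by auto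
    have "(LINT x:(\<Union>i. A i)|lborel. g x) = (\<Sum>i. (LINT x:(A i)|lborel. g x))"
      using A union(1) by (intro lebesgue_integral_countable_add int)
        (auto simp: disjoint_family_on_def)
    then show ?case using union by simp
  qed
qed

text \<open>The fundamental lemma of the calculus of variations. Restricting to a large box makes the
  function integrable; all its integrals over boxes vanish because the indicators of boxes are limits
  of test functions.\<close>

lemma fundamental_lemma_L2:
  fixes h :: "real ^ 'n \<Rightarrow> real"
  assumes \<eta>: "cutoff_profile \<eta>" and h: "h \<in> L2"
    and orth: "\<And>\<phi>. test_function \<phi> \<Longrightarrow> (LINT x|lebesgue. h x * \<phi> x) = 0"
  shows "AE x in lebesgue. h x = 0"
proof -
  obtain h' where h': "h' \<in> borel_measurable lborel" and ae: "AE x in lborel. h x = h' x"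
    using completion_ex_borel_measurable_real[OF L2_measurable[OF h]] by blast
  have [measurable]: "h' \<in> borel_measurable borel" using h' by simp
  have ae': "AE x in lebesgue. h x = h' x" using ae by (rule AE_completion)
  have eq: "(LINT x|lborel. h' x * indicator (cbox a b) x) = 0" for a b
  proof -
    have "(LINT x|lborel. h' x * indicator (cbox a b) x) = (LINT x|lebesgue. h' x * indicator (cbox a b) x)"
      by (subst integral_completion) auto
    also have "\<dots> = (LINT x|lebesgue. h x * indicator (cbox a b) x)"
    proof (rule integral_cong_AE)
      show "(\<lambda>x. h' x * indicator (cbox a b) x) \<in> borel_measurable lebesgue"
        by (rule measurable_completion) simp
      show "(\<lambda>x. h x * indicator (cbox a b) x) \<in> borel_measurable lebesgue"
        by (intro borel_measurable_times L2_measurable[OF h] borel_measurable_indicator) auto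
      show "AE x in lebesgue. h' x * indicator (cbox a b) x = h x * indicator (cbox a b) x"
        using ae' by eventually_elim simp
    qed
    also have "\<dots> = 0" by (rule integral_box_eq_0[OF \<eta> h orth])
    finally show ?thesis .
  qed
  have "AE x in lborel. h' x * indicator (cbox a b) x = 0" for a b
  proof (rule AE_eq_0_if_box_integrals_eq_0)
    have "(\<lambda>x. indicator (cbox a b) x :: real) \<in> L2"
    proof -
      have "(\<lambda>x. (indicator (cbox a b) x :: real)\<^sup>2) = indicator (cbox a b)"
        by (auto simp: indicator_def fun_eq_iff)
      moreover have "integrable lebesgue (indicator (cbox a b) :: _ \<Rightarrow> real)"
        by (intro integrable_real_indicator) (auto simp: emeasure_lborel_cbox_eq)
      ultimately show ?thesis by (simp add: L2_def)
    qed
    then have "integrable lebesgue (\<lambda>x. h x * indicator (cbox a b) x)"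
      using L2_integrable_mult[OF h] by blast
    then have "integrable lebesgue (\<lambda>x. h' x * indicator (cbox a b) x)"
    proof (rule integrable_cong_AE_imp)
      show "(\<lambda>x. h' x * indicator (cbox a b) x) \<in> borel_measurable lebesgue"
        by (rule measurable_completion) simp
      show "AE x in lebesgue. h x * indicator (cbox a b) x = h' x * indicator (cbox a b) x"
        using ae' by eventually_elim simp
    qed
    then show "integrable lborel (\<lambda>x. h' x * indicator (cbox a b) x)"
      by (subst (asm) integrable_completion) auto
    show "integral\<^sup>L lborel (\<lambda>x. h' x * indicator (cbox a b) x) = 0" by (rule eq)
    fix c d
    obtain c' d' where "cbox c d \<inter> cbox a b = cbox c' d'"
      unfolding Int_interval by blast
    then have "indicator (cbox c d) x *\<^sub>R (h' x * indicator (cbox a b) x)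
        = h' x * indicator (cbox c' d') x" for x
      by (auto simp: indicator_def)
    then show "(LINT x:cbox c d|lborel. h' x * indicator (cbox a b) x) = 0"
      using eq[of c' d'] by (simp only: set_lebesgue_integral_def)
  qed
  then have "AE x in lborel. \<forall>N::nat. h' x * indicator (cbox (\<chi> i. - real N) (\<chi> i. real N)) x = 0"
    unfolding AE_all_countable by blast
  then have "AE x in lborel. h' x = 0"
  proof eventually_elim
    case (elim x)
    obtain N where N: "norm x \<le> real N" using real_arch_simple by blast
    have "x \<in> cbox (\<chi> i. - real N) (\<chi> i. real N)"
      unfolding mem_box_cart
    proof (intro allI)
      fix i
      have "\<bar>x $ i\<bar> \<le> real N" using component_le_norm_cart[of x i] N by linarith
      then show "(\<chi> i. - real N) $ i \<le> x $ i \<and> x $ i \<le> (\<chi> i. real N) $ i" by (simp add: abs_le_iff)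
    qed
    then show ?case using elim[rule_format, of N] by simp
  qed
  then have "AE x in lebesgue. h' x = 0" by (rule AE_completion)
  with ae' show ?thesis by eventually_elim simp
qed

lemma weak_partial_unique:
  fixes f :: "real ^ 'n \<Rightarrow> real"
  assumes \<eta>: "cutoff_profile \<eta>" and g: "is_weak_partial i f g" "is_weak_partial i f g'"
  shows "AE x in lebesgue. g x = g' x"
proof -
  have L2: "g \<in> L2" "g' \<in> L2" using g by (auto simp: is_weak_partial_def)
  have "AE x in lebesgue. g x - g' x = 0"
  proof (rule fundamental_lemma_L2[OF \<eta> L2_diff[OF L2]])
    fix \<phi> :: "real ^ 'n \<Rightarrow> real" assume \<phi>: "test_function \<phi>"
    have "(LINT x|lebesgue. g x * \<phi> x) = (LINT x|lebesgue. g' x * \<phi> x)"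
      using g \<phi> unfolding is_weak_partial_def by (metis neg_equal_iff_equal)
    then show "(LINT x|lebesgue. (g x - g' x) * \<phi> x) = 0"
      using L2_integrable_mult[OF L2(1) test_function_L2[OF \<phi>]]
        L2_integrable_mult[OF L2(2) test_function_L2[OF \<phi>]]
      by (simp add: left_diff_distrib)
  qed
  then show ?thesis by eventually_elim simp
qed

section \<open>Pairings of the solution with a test function\<close>

lemma H1_L2: "f \<in> H1 \<Longrightarrow> f \<in> L2"
  by (simp add: H1_def)

lemma H1_weak_partial:
  assumes "f \<in> H1"
  shows "is_weak_partial i f (weak_partial i f)"
  using assms unfolding H1_def weak_partial_def by (metis (mono_tags, lifting) mem_Collect_eq someI_ex)

lemma test_function_H1:
  assumes "test_function \<phi>"
  shows "\<phi> \<in> H1"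
  using test_function_L2[OF assms] test_function_weak_partial[OF assms] unfolding H1_def by blast

lemma weak_partial_test_function:
  assumes "cutoff_profile \<eta>" "test_function \<phi>"
  shows "AE x in lebesgue. weak_partial i \<phi> x = partial i \<phi> x"
  by (rule weak_partial_unique[OF assms(1) H1_weak_partial[OF test_function_H1[OF assms(2)]]
        test_function_weak_partial[OF assms(2)]])

text \<open>Uniqueness replaces the chosen weak derivatives of the test function by the classical ones,
  which are test functions themselves; the definition of the weak derivatives of \<open>u\<close> then moves the
  second derivative to the test function.\<close>

lemma laplacian_H1_test_function:
  fixes u :: "real ^ 'n \<Rightarrow> real"
  assumes \<eta>: "cutoff_profile \<eta>" and u: "u \<in> H1" and \<phi>: "test_function \<phi>"
  shows "laplacian_H1 u \<phi> = (LINT x|lebesgue. u x * laplacian \<phi> x)"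
proof -
  have wp: "is_weak_partial i u (weak_partial i u)" for i by (rule H1_weak_partial[OF u])
  have L2: "weak_partial i u \<in> L2" "weak_partial i \<phi> \<in> L2" for i
    using wp[of i] H1_weak_partial[OF test_function_H1[OF \<phi>], of i]
    by (auto simp: is_weak_partial_def)
  have "(LINT x|lebesgue. weak_partial i u x * weak_partial i \<phi> x)
      = - (LINT x|lebesgue. u x * partial i (partial i \<phi>) x)" for i
  proof -
    have t: "test_function (partial i \<phi>)" by (rule test_function_partial[OF \<phi>])
    have "(LINT x|lebesgue. weak_partial i u x * weak_partial i \<phi> x)
        = (LINT x|lebesgue. weak_partial i u x * partial i \<phi> x)"
    proof (rule integral_cong_AE)
      show "AE x in lebesgue. weak_partial i u x * weak_partial i \<phi> x = weak_partial i u x * partial i \<phi> x"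
        using weak_partial_test_function[OF \<eta> \<phi>, of i] by eventually_elim simp
    qed (intro borel_measurable_times L2_measurable L2 test_function_L2[OF t])+
    also have "\<dots> = - (LINT x|lebesgue. u x * partial i (partial i \<phi>) x)"
      using wp[of i] t by (simp add: is_weak_partial_def)
    finally show ?thesis .
  qed
  moreover have "integrable lebesgue (\<lambda>x. u x * partial i (partial i \<phi>) x)" for i
    by (intro L2_integrable_mult H1_L2[OF u] test_function_L2 test_function_partial \<phi>)
  ultimately show ?thesis
    by (simp add: laplacian_H1_def laplacian_def sum_distrib_left sum_negf)
qed

lemma L2_norm_le_H1_norm: "L2_norm f \<le> H1_norm f"
  unfolding L2_norm_def H1_norm_def by (intro real_sqrt_le_mono) (simp add: sum_nonneg)

lemma Hm1_lincomb:
  assumes "F \<in> Hm1" "G \<in> Hm1"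
  shows "(\<lambda>\<phi>. a * F \<phi> + b * G \<phi>) \<in> Hm1"
proof -
  obtain C D where C: "\<And>f. f \<in> H1 \<Longrightarrow> \<bar>F f\<bar> \<le> C * H1_norm f"
    and D: "\<And>f. f \<in> H1 \<Longrightarrow> \<bar>G f\<bar> \<le> D * H1_norm f"
    using assms unfolding Hm1_def by blast
  have "\<bar>a * F f + b * G f\<bar> \<le> (\<bar>a\<bar> * C + \<bar>b\<bar> * D) * H1_norm f" if "f \<in> H1" for f
  proof -
    have "\<bar>a * F f + b * G f\<bar> \<le> \<bar>a\<bar> * \<bar>F f\<bar> + \<bar>b\<bar> * \<bar>G f\<bar>"
      using abs_triangle_ineq[of "a * F f" "b * G f"] by (simp add: abs_mult)
    also have "\<dots> \<le> \<bar>a\<bar> * (C * H1_norm f) + \<bar>b\<bar> * (D * H1_norm f)"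
      by (intro add_mono mult_left_mono C D that) auto
    finally show ?thesis by (simp add: algebra_simps)
  qed
  then have "\<exists>C. \<forall>f\<in>H1. \<bar>a * F f + b * G f\<bar> \<le> C * H1_norm f" by blast
  moreover have "\<forall>f\<in>H1. \<forall>g\<in>H1. \<forall>c d. F (\<lambda>x. c * f x + d * g x) = c * F f + d * F g"
    "\<forall>f\<in>H1. \<forall>g\<in>H1. \<forall>c d. G (\<lambda>x. c * f x + d * g x) = c * G f + d * G g"
    using assms unfolding Hm1_def by blast+
  ultimately show ?thesis unfolding Hm1_def by (simp add: algebra_simps)
qed

lemma functional_L2_Hm1:
  assumes v: "v \<in> L2"
  shows "functional v \<in> Hm1"
proof -
  have "functional v (\<lambda>x. c * f x + d * g x) = c * functional v f + d * functional v g"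
    if "f \<in> H1" "g \<in> H1" for f g c d
  proof -
    have "(\<lambda>x. v x * (c * f x + d * g x)) = (\<lambda>x. c * (v x * f x) + d * (v x * g x))"
      by (simp add: algebra_simps)
    then show ?thesis
      using L2_integrable_mult[OF v H1_L2[OF that(1)]] L2_integrable_mult[OF v H1_L2[OF that(2)]]
      by (simp add: functional_def)
  qed
  moreover have "\<bar>functional v f\<bar> \<le> L2_norm v * H1_norm f" if "f \<in> H1" for f
  proof -
    have "\<bar>functional v f\<bar> \<le> L2_norm v * L2_norm f"
      unfolding functional_def by (rule L2_Cauchy_Schwarz[OF v H1_L2[OF that]])
    also have "\<dots> \<le> L2_norm v * H1_norm f"
      by (intro mult_left_mono L2_norm_le_H1_norm L2_norm_nonneg)
    finally show ?thesis .
  qed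
  ultimately show ?thesis unfolding Hm1_def by blast
qed

text \<open>The weak derivatives of a multiple of a test function are determined almost everywhere, so
  small multiples lie in the unit ball of \<open>H1\<close>, over which the dual norm is a supremum.\<close>

lemma Hm1_apply_bound:
  fixes \<phi> :: "real ^ 'n \<Rightarrow> real"
  assumes \<eta>: "cutoff_profile \<eta>" and \<phi>: "test_function \<phi>"
  obtains C where "\<And>F. F \<in> Hm1 \<Longrightarrow> \<bar>F \<phi>\<bar> \<le> C * Hm1_norm F"
proof -
  define S where "S = (LINT x|lebesgue. (\<phi> x)\<^sup>2) + (\<Sum>i\<in>UNIV. LINT x|lebesgue. (partial i \<phi> x)\<^sup>2)"
  have S: "0 \<le> S" by (simp add: S_def sum_nonneg)
  \<comment> \<open>small enough that \<open>c \<phi>\<close>, whose squared norm is \<open>c\<^sup>2 S\<close>, lies in the unit ball\<close>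
  define c where "c = 1 / (1 + S)"
  have c: "0 < c" "c \<le> 1" "c * S \<le> 1" using S by (auto simp: c_def field_simps)
  define \<psi> where "\<psi> x = c * \<phi> x" for x
  have \<psi>: "test_function \<psi>"
    unfolding \<psi>_def by (rule test_function_mult(2)[OF \<phi> Ck_const])
  have p: "partial i \<psi> x = c * partial i \<phi> x" for i x
  proof -
    have "partial i (\<lambda>x. c * \<phi> x) x = c * partial i \<phi> x + partial i (\<lambda>x. c) x * \<phi> x"
      by (intro partial_mult Ck_const test_function_Ck \<phi>)
    moreover have "partial i (\<lambda>x :: real ^ 'n. c) x = 0"
      by (simp add: partial_eq[OF has_derivative_const])
    ultimately show ?thesis by (simp add: \<psi>_def[abs_def])
  qed
  have wp: "(LINT x|lebesgue. (weak_partial i \<psi> x)\<^sup>2) = c\<^sup>2 * (LINT x|lebesgue. (partial i \<phi> x)\<^sup>2)" for i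
  proof -
    have "(LINT x|lebesgue. (weak_partial i \<psi> x)\<^sup>2) = (LINT x|lebesgue. (partial i \<psi> x)\<^sup>2)"
    proof (rule integral_cong_AE)
      have "weak_partial i \<psi> \<in> L2" "partial i \<psi> \<in> L2"
        using H1_weak_partial[OF test_function_H1[OF \<psi>], of i] test_function_L2[OF test_function_partial[OF \<psi>]]
        by (auto simp: is_weak_partial_def)
      then show "(\<lambda>x. (weak_partial i \<psi> x)\<^sup>2) \<in> borel_measurable lebesgue"
        "(\<lambda>x. (partial i \<psi> x)\<^sup>2) \<in> borel_measurable lebesgue"
        by (auto simp: L2_def)
      show "AE x in lebesgue. (weak_partial i \<psi> x)\<^sup>2 = (partial i \<psi> x)\<^sup>2"
        using weak_partial_test_function[OF \<eta> \<psi>, of i] by eventually_elim simp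
    qed
    then show ?thesis by (simp add: p power_mult_distrib)
  qed
  have "H1_norm \<psi> = sqrt (c\<^sup>2 * S)"
    unfolding H1_norm_def wp by (simp add: \<psi>_def S_def power_mult_distrib distrib_left sum_distrib_left)
  moreover have "c\<^sup>2 * S \<le> 1"
    using mult_mono[of c 1 "c * S" 1] c S by (simp add: power2_eq_square mult.assoc)
  ultimately have n: "H1_norm \<psi> \<le> 1" by simp
  have "\<bar>F \<phi>\<bar> \<le> inverse c * Hm1_norm F" if F: "F \<in> Hm1" for F
  proof -
    obtain C where C: "\<And>f. f \<in> H1 \<Longrightarrow> \<bar>F f\<bar> \<le> C * H1_norm f"
      and lin: "\<And>f g c d. f \<in> H1 \<Longrightarrow> g \<in> H1 \<Longrightarrow> F (\<lambda>x. c * f x + d * g x) = c * F f + d * F g"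
      using F unfolding Hm1_def by blast
    have "bdd_above ((\<lambda>f. \<bar>F f\<bar>) ` {f \<in> H1. H1_norm f \<le> 1})"
    proof (rule bdd_aboveI2[of _ _ "\<bar>C\<bar>"])
      fix f :: "real ^ 'n \<Rightarrow> real" assume f: "f \<in> {f \<in> H1. H1_norm f \<le> 1}"
      have "0 \<le> H1_norm f" for f :: "real ^ 'n \<Rightarrow> real" using L2_norm_nonneg L2_norm_le_H1_norm order_trans by blast
      from this[of f] have "C * H1_norm f \<le> \<bar>C\<bar> * 1" using f by (intro mult_mono) auto
      then show "\<bar>F f\<bar> \<le> \<bar>C\<bar>" using C[of f] f by simp
    qed
    then have "\<bar>F \<psi>\<bar> \<le> Hm1_norm F"
      unfolding Hm1_norm_def using n test_function_H1[OF \<psi>] by (intro cSUP_upper) auto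
    moreover have "F \<psi> = c * F \<phi>"
      using lin[of \<phi> \<phi> c 0] test_function_H1[OF \<phi>] by (simp add: \<psi>_def[abs_def])
    ultimately have "c * \<bar>F \<phi>\<bar> \<le> Hm1_norm F" using c by (simp add: abs_mult)
    then show ?thesis using c by (simp add: field_simps)
  qed
  then show ?thesis using that by blast
qed

text \<open>Differentiability in a normed space of functions passes to every functional that is dominated by
  the norm; \<open>L\<close> is the scalar function obtained by applying such a functional to \<open>F\<close>.\<close>

lemma derivative_into_pairing:
  assumes D: "derivative_into N I F F'" and t: "t \<in> I"
    and bd: "\<And>s. s \<in> I \<Longrightarrow> s \<noteq> t \<Longrightarrow>
      \<bar>(L s - L t) / (s - t) - L'\<bar> \<le> C * N (\<lambda>x. (F s x - F t x) / (s - t) - F' t x)"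
  shows "(L has_real_derivative L') (at t within I)"
  unfolding has_field_derivative_iff
proof -
  have "((\<lambda>s. (L s - L t) / (s - t) - L') \<longlongrightarrow> 0) (at t within I)"
  proof (rule Lim_null_comparison)
    show "\<forall>\<^sub>F s in at t within I.
        norm ((L s - L t) / (s - t) - L') \<le> C * N (\<lambda>x. (F s x - F t x) / (s - t) - F' t x)"
      unfolding eventually_at_filter using bd by (auto intro!: always_eventually)
    show "((\<lambda>s. C * N (\<lambda>x. (F s x - F t x) / (s - t) - F' t x)) \<longlongrightarrow> 0) (at t within I)"
      using D t unfolding derivative_into_def by (auto intro: tendsto_mult_right_zero)
  qed
  then show "((\<lambda>s. (L s - L t) / (s - t)) \<longlongrightarrow> L') (at t within I)"
    by (simp add: LIM_zero_iff)
qed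

text \<open>Pairing the equation with a test function turns it into a scalar second order equation. The
  first derivative in time comes from the convergence in \<open>L2\<close> and the Cauchy-Schwarz inequality, the
  second from the convergence in the dual of \<open>H1\<close>.\<close>

lemma strong_solution_pairing:
  fixes \<phi> u0 u1 :: "real ^ 'n \<Rightarrow> real" and u :: "real \<Rightarrow> real ^ 'n \<Rightarrow> real"
  assumes sol: "strong_solution b p u0 u1 T u" and T: "T > 0"
    and data: "u0 \<in> borel_measurable lebesgue" "u1 \<in> borel_measurable lebesgue"
    and \<eta>: "cutoff_profile \<eta>" and \<phi>: "test_function \<phi>"
  obtains J' J'' where
    "\<And>t. t \<in> time_interval T \<Longrightarrow> u t \<in> L2"
    "\<And>t. t \<in> time_interval T \<Longrightarrow> integrable lebesgue (\<lambda>x. \<bar>u t x\<bar> powr p * \<phi> x)"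
    "\<And>t. t \<in> time_interval T \<Longrightarrow>
      ((\<lambda>t. LINT x|lebesgue. u t x * \<phi> x) has_real_derivative J' t) (at t within time_interval T)"
    "\<And>t. t \<in> time_interval T \<Longrightarrow> (J' has_real_derivative J'' t) (at t within time_interval T)"
    "\<And>t. t \<in> time_interval T \<Longrightarrow> J'' t + b t * J' t
      = (LINT x|lebesgue. \<bar>u t x\<bar> powr p * \<phi> x) + (LINT x|lebesgue. u t x * laplacian \<phi> x)"
    "(LINT x|lebesgue. u 0 x * \<phi> x) = (LINT x|lebesgue. u0 x * \<phi> x)"
    "J' 0 = (LINT x|lebesgue. u1 x * \<phi> x)"
proof -
  let ?I = "time_interval T"
  obtain v w where sol': "continuous_into H1 H1_norm ?I u \<and>
     derivative_into L2_norm ?I u v \<and> continuous_into L2 L2_norm ?I v \<and>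
     derivative_into Hm1_norm ?I (\<lambda>t. functional (v t)) w \<and> continuous_into Hm1 Hm1_norm ?I w \<and>
     (AE x in lebesgue. u 0 x = u0 x) \<and> (AE x in lebesgue. v 0 x = u1 x) \<and>
     (\<forall>t\<in>?I. \<forall>\<phi>\<in>H1. integrable lebesgue (\<lambda>x. \<bar>u t x\<bar> powr p * \<phi> x)) \<and>
     continuous_into Hm1 Hm1_norm ?I (\<lambda>t. functional (\<lambda>x. \<bar>u t x\<bar> powr p)) \<and>
     (\<forall>t\<in>?I. \<forall>\<phi>\<in>H1. w t \<phi> - laplacian_H1 (u t) \<phi> + b t * functional (v t) \<phi>
        = functional (\<lambda>x. \<bar>u t x\<bar> powr p) \<phi>)"
    using sol unfolding strong_solution_def Let_def by (elim exE)
  have u: "\<And>t. t \<in> ?I \<Longrightarrow> u t \<in> H1" and v: "\<And>t. t \<in> ?I \<Longrightarrow> v t \<in> L2"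
    and w: "\<And>t. t \<in> ?I \<Longrightarrow> w t \<in> Hm1"
    and uv: "derivative_into L2_norm ?I u v"
    and vw: "derivative_into Hm1_norm ?I (\<lambda>t. functional (v t)) w"
    and u0: "AE x in lebesgue. u 0 x = u0 x" and u1: "AE x in lebesgue. v 0 x = u1 x"
    using sol' by (simp_all add: continuous_into_def)
  have int: "\<And>t \<phi>. t \<in> ?I \<Longrightarrow> \<phi> \<in> H1 \<Longrightarrow> integrable lebesgue (\<lambda>x. \<bar>u t x\<bar> powr p * \<phi> x)"
    and eq: "\<And>t \<phi>. t \<in> ?I \<Longrightarrow> \<phi> \<in> H1 \<Longrightarrow>
      w t \<phi> - laplacian_H1 (u t) \<phi> + b t * functional (v t) \<phi> = functional (\<lambda>x. \<bar>u t x\<bar> powr p) \<phi>"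
    using sol' by blast+
  have \<phi>2: "\<phi> \<in> L2" and \<phi>1: "\<phi> \<in> H1" using \<phi> by (rule test_function_L2, rule test_function_H1)
  have I0: "0 \<in> ?I" using T by (simp add: time_interval_def zero_ereal_def)
  show ?thesis
  proof (rule that[of "\<lambda>t. functional (v t) \<phi>" "\<lambda>t. w t \<phi>"])
    fix t assume t: "t \<in> ?I"
    show "u t \<in> L2" using H1_L2[OF u[OF t]] .
    show "integrable lebesgue (\<lambda>x. \<bar>u t x\<bar> powr p * \<phi> x)" using int[OF t \<phi>1] .
    show "((\<lambda>t. LINT x|lebesgue. u t x * \<phi> x) has_real_derivative functional (v t) \<phi>) (at t within ?I)"
    proof (rule derivative_into_pairing[OF uv t, where C="L2_norm \<phi>"])
      fix s assume s: "s \<in> ?I" "s \<noteq> t"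
      let ?q = "\<lambda>x. (u s x - u t x) / (s - t) - v t x"
      have us: "u s \<in> L2" "u t \<in> L2" "v t \<in> L2" using H1_L2 u v s t by auto
      have eq_q: "?q = (\<lambda>x. 1 * ((1 / (s - t)) * u s x + (- (1 / (s - t))) * u t x) + (-1) * v t x)"
        by (simp add: fun_eq_iff diff_divide_distrib)
      have q: "?q \<in> L2" unfolding eq_q by (rule L2_lincomb[OF L2_lincomb[OF us(1,2)] us(3)])
      have "(LINT x|lebesgue. ?q x * \<phi> x)
          = (LINT x|lebesgue. (u s x * \<phi> x - u t x * \<phi> x) / (s - t) - v t x * \<phi> x)"
        by (simp add: algebra_simps diff_divide_distrib)
      also have "\<dots> = ((LINT x|lebesgue. u s x * \<phi> x) - (LINT x|lebesgue. u t x * \<phi> x)) / (s - t)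
          - functional (v t) \<phi>"
        using L2_integrable_mult[OF us(1) \<phi>2] L2_integrable_mult[OF us(2) \<phi>2] L2_integrable_mult[OF us(3) \<phi>2]
        by (simp add: functional_def)
      finally show "\<bar>((LINT x|lebesgue. u s x * \<phi> x) - (LINT x|lebesgue. u t x * \<phi> x)) / (s - t)
          - functional (v t) \<phi>\<bar> \<le> L2_norm \<phi> * L2_norm ?q"
        using L2_Cauchy_Schwarz[OF q \<phi>2] by (simp add: mult.commute)
    qed
    obtain C where C: "\<And>F. F \<in> Hm1 \<Longrightarrow> \<bar>F \<phi>\<bar> \<le> C * Hm1_norm F"
      using Hm1_apply_bound[OF \<eta> \<phi>] by blast
    show "((\<lambda>t. functional (v t) \<phi>) has_real_derivative w t \<phi>) (at t within ?I)"
    proof (rule derivative_into_pairing[OF vw t, where C=C])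
      fix s assume s: "s \<in> ?I" "s \<noteq> t"
      have F: "functional (v s) \<in> Hm1" "functional (v t) \<in> Hm1" "w t \<in> Hm1"
        using functional_L2_Hm1 v w s t by auto
      let ?G = "\<lambda>\<phi>. (functional (v s) \<phi> - functional (v t) \<phi>) / (s - t) - w t \<phi>"
      have eq_G: "?G = (\<lambda>\<phi>. 1 * ((1 / (s - t)) * functional (v s) \<phi> + (- (1 / (s - t))) * functional (v t) \<phi>)
          + (-1) * w t \<phi>)"
        by (simp add: fun_eq_iff diff_divide_distrib)
      have "?G \<in> Hm1" unfolding eq_G by (rule Hm1_lincomb[OF Hm1_lincomb[OF F(1,2)] F(3)])
      then show "\<bar>?G \<phi>\<bar> \<le> C * Hm1_norm ?G" by (rule C)
    qed
    show "w t \<phi> + b t * functional (v t) \<phi>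
        = (LINT x|lebesgue. \<bar>u t x\<bar> powr p * \<phi> x) + (LINT x|lebesgue. u t x * laplacian \<phi> x)"
      using eq[OF t \<phi>1] laplacian_H1_test_function[OF \<eta> u[OF t] \<phi>] by (simp add: functional_def)
  next
    have m: "\<phi> \<in> borel_measurable lebesgue" "u 0 \<in> borel_measurable lebesgue" "v 0 \<in> borel_measurable lebesgue"
      using L2_measurable[OF \<phi>2] H1_L2[OF u[OF I0]] v[OF I0] L2_measurable by auto
    have "AE x in lebesgue. u 0 x * \<phi> x = u0 x * \<phi> x" using u0 by eventually_elim simp
    then show "(LINT x|lebesgue. u 0 x * \<phi> x) = (LINT x|lebesgue. u0 x * \<phi> x)"
      by (intro integral_cong_AE borel_measurable_times m data)
    have "AE x in lebesgue. v 0 x * \<phi> x = u1 x * \<phi> x" using u1 by eventually_elim simp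
    then show "functional (v 0) \<phi> = (LINT x|lebesgue. u1 x * \<phi> x)"
      unfolding functional_def by (intro integral_cong_AE borel_measurable_times m data)
  qed
qed

section \<open>Powers and dilations of the cut-off\<close>

lemma partial_power:
  fixes f :: "real ^ 'n \<Rightarrow> real"
  assumes "Ck (Suc 0) f"
  shows "partial i (\<lambda>x. f x ^ m) x = real m * f x ^ (m - 1) * partial i f x"
  unfolding partial_eq[OF has_derivative_power[OF Ck_Suc_has_derivative[OF assms]]]
  by (simp add: partial_def)

text \<open>This is the identity behind \<open>Phi\<close>: the Laplacian of a power of the cut-off retains the factor
  \<open>f ^ (l - 2)\<close>, so it can be dominated by a smaller power of the cut-off itself.\<close>

lemma laplacian_power:
  fixes f :: "real ^ 'n \<Rightarrow> real"
  assumes f: "Ck (Suc (Suc 0)) f" and l: "l \<ge> 2"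
  shows "laplacian (\<lambda>x. f x ^ l) x = Phi l f x * f x ^ (l - 2)"
proof -
  have f1: "Ck (Suc 0) f" using Ck_Suc_imp_Ck[OF f] .
  have p1: "Ck (Suc 0) (partial i f)" for i using f by simp
  have A: "partial i (\<lambda>x. f x ^ l) = (\<lambda>x. (real l * f x ^ (l - 1)) * partial i f x)" for i
    using partial_power[OF f1] by auto
  have B: "partial i (\<lambda>x. (real l * f x ^ (l - 1)) * partial i f x) x
      = (real l * f x ^ (l - 1)) * partial i (partial i f) x
      + (real l * (real (l - 1) * f x ^ (l - 2) * partial i f x)) * partial i f x" for i
  proof -
    have "partial i (\<lambda>x. real l * f x ^ (l - 1)) x
        = real l * partial i (\<lambda>x. f x ^ (l - 1)) x + partial i (\<lambda>x. real l) x * f x ^ (l - 1)"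
      by (intro partial_mult Ck_const Ck_power f1)
    moreover have "partial i (\<lambda>x :: real ^ 'n. real l) x = 0"
      by (simp add: partial_eq[OF has_derivative_const])
    ultimately have "partial i (\<lambda>x. real l * f x ^ (l - 1)) x
        = real l * (real (l - 1) * f x ^ (l - 2) * partial i f x)"
      by (simp add: partial_power[OF f1] numeral_2_eq_2)
    then show ?thesis
      using partial_mult[OF Ck_mult[OF Ck_const Ck_power[OF f1]] p1] by simp
  qed
  have "partial i (partial i (\<lambda>x. f x ^ l)) x
      = f x ^ (l - 2) * (real l * f x * partial i (partial i f) x
        + real l * (real l - 1) * (partial i f x * partial i f x))" for i
  proof -
    have "l = Suc (Suc (l - 2))" using l by simp
    then obtain m where "l = Suc (Suc m)" ..
    then have l': "f x ^ (l - 1) = f x * f x ^ (l - 2)" "real (l - 1) = real l - 1" by simp_all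
    show ?thesis unfolding A B l' by (simp only: algebra_simps)
  qed
  then have "laplacian (\<lambda>x. f x ^ l) x = (\<Sum>i\<in>UNIV. f x ^ (l - 2) * (real l * f x * partial i (partial i f) x
        + real l * (real l - 1) * (partial i f x * partial i f x)))"
    by (simp only: laplacian_def)
  also have "\<dots> = f x ^ (l - 2) * (real l * f x * laplacian f x
      + real l * (real l - 1) * (gradient f x \<bullet> gradient f x))"
    by (simp add: laplacian_def gradient_def inner_vec_def sum.distrib flip: sum_distrib_left)
  finally show ?thesis by (simp add: Phi_def)
qed

lemma rescale_eq: "rescale R f = (\<lambda>x. f ((1 / R) *\<^sub>R x + 0))"
  by (simp add: fun_eq_iff rescale_def divide_inverse)

lemma partial_rescale:
  assumes "Ck (Suc k) f"
  shows "partial i (rescale R f) = (\<lambda>x. (1 / R) * rescale R (partial i f) x)"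
proof
  have d: "f differentiable_on UNIV" using assms by simp
  show "partial i (rescale R f) x = (1 / R) * rescale R (partial i f) x" for x
    unfolding rescale_eq by (rule partial_affine[OF d])
qed

lemma Ck_rescale: "Ck k f \<Longrightarrow> Ck k (rescale R f)"
  unfolding rescale_eq by (rule Ck_affine)

lemma Phi_rescale:
  fixes f :: "real ^ 'n \<Rightarrow> real"
  assumes f: "Ck (Suc (Suc 0)) f"
  shows "Phi l (rescale R f) x = (1 / R)\<^sup>2 * Phi l f (x /\<^sub>R R)"
proof -
  have p1: "Ck (Suc 0) (partial i f)" for i using f by simp
  have 1: "partial i (rescale R f) = (\<lambda>x. (1 / R) * rescale R (partial i f) x)" for i
    by (rule partial_rescale[OF f])
  have "partial i (\<lambda>x. (1 / R) * rescale R (partial i f) x) x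
      = (1 / R) * partial i (rescale R (partial i f)) x + partial i (\<lambda>x. 1 / R) x * rescale R (partial i f) x" for i
    by (intro partial_mult Ck_const Ck_rescale p1)
  moreover have "partial i (\<lambda>x :: real ^ 'n. 1 / R) x = 0" for i
    by (simp add: partial_eq[OF has_derivative_const])
  ultimately have 2: "partial i (partial i (rescale R f)) x = (1 / R)\<^sup>2 * partial i (partial i f) (x /\<^sub>R R)" for i
    by (simp add: 1 partial_rescale[OF p1] rescale_def power2_eq_square)
  have "laplacian (rescale R f) x = (1 / R)\<^sup>2 * laplacian f (x /\<^sub>R R)"
    by (simp add: laplacian_def 2 sum_distrib_left)
  moreover have "gradient (rescale R f) x = (1 / R) *\<^sub>R gradient f (x /\<^sub>R R)"
    by (simp add: gradient_def 1 rescale_def vec_eq_iff)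
  then have "gradient (rescale R f) x \<bullet> gradient (rescale R f) x
      = (1 / R)\<^sup>2 * (gradient f (x /\<^sub>R R) \<bullet> gradient f (x /\<^sub>R R))"
    by (simp add: power2_eq_square)
  ultimately show ?thesis
    unfolding Phi_def by (simp only: rescale_def distrib_left mult.assoc mult.commute mult.left_commute)
qed

lemma test_function_radial:
  assumes "cutoff_profile \<eta>"
  shows "test_function (radial \<eta> :: real ^ 'n \<Rightarrow> real)"
proof (rule test_functionI)
  have "Ck k (\<lambda>x :: real ^ 'n. \<eta> (plen UNIV x))" for k
    by (rule Ck_plen[where c=1])
      (use assms in \<open>auto simp: cutoff_profile_def intro: smooth_halfline_smooth_pos\<close>)
  then show "Ck k (radial \<eta> :: real ^ 'n \<Rightarrow> real)" for k
    by (simp add: plen_UNIV radial_def[abs_def])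
  have "norm x \<le> 2" if "radial \<eta> x \<noteq> 0" for x :: "real ^ 'n"
    using that assms by (auto simp: radial_def cutoff_profile_def intro: ccontr)
  then show "bounded {x :: real ^ 'n. radial \<eta> x \<noteq> 0}" unfolding bounded_iff by blast
qed

lemma test_function_rescale:
  fixes \<phi> :: "real ^ 'n \<Rightarrow> real"
  assumes \<phi>: "test_function \<phi>" and R: "R > 0"
  shows "test_function (rescale R \<phi>)"
proof (rule test_functionI)
  show "Ck k (rescale R \<phi>)" for k by (rule Ck_rescale[OF test_function_Ck[OF \<phi>]])
  obtain r where r: "\<And>x. \<phi> x \<noteq> 0 \<Longrightarrow> norm x \<le> r"
    using test_function_bounded_support[OF \<phi>] unfolding bounded_iff by blast
  have "norm x \<le> R * r" if "rescale R \<phi> x \<noteq> 0" for x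
    using r[of "x /\<^sub>R R"] that R by (simp add: rescale_def field_simps)
  then show "bounded {x. rescale R \<phi> x \<noteq> 0}" unfolding bounded_iff by blast
qed

lemma test_function_power:
  assumes "test_function \<phi>" "m > 0"
  shows "test_function (\<lambda>x. \<phi> x ^ m)"
proof -
  obtain j where "m = Suc j" using assms(2) gr0_implies_Suc by blast
  then show ?thesis
    using test_function_mult(1)[OF assms(1) Ck_power[OF test_function_Ck[OF assms(1)]]] by simp
qed

lemma integral_rescale:
  fixes f :: "real ^ 'n \<Rightarrow> real"
  assumes f: "continuous_on UNIV f" and R: "R > 0"
  shows "(LINT x|lebesgue. f (x /\<^sub>R R)) = R ^ CARD('n) * (LINT x|lebesgue. f x)"
proof -
  have [measurable]: "f \<in> borel_measurable borel" using f by (rule borel_measurable_continuous_onI)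
  have "integral\<^sup>L lborel f = \<bar>inverse R\<bar> ^ CARD('n) * (LINT x|lborel. f (inverse R *\<^sub>R x + 0))"
    using R by (intro integral_affine) auto
  then have "(LINT x|lborel. f (x /\<^sub>R R)) = R ^ CARD('n) * integral\<^sup>L lborel f"
    using R by (simp add: power_inverse field_simps)
  then show ?thesis by (subst (1 2) integral_completion) auto
qed

section \<open>The differential inequality for the localized average\<close>

lemma conj_exp_props:
  assumes "1 < p"
  shows "1 < conj_exp p" "1 / p + 1 / conj_exp p = 1" "conj_exp p / p = conj_exp p - 1"
    "p * (conj_exp p - 1) = conj_exp p"
  using assms by (auto simp: conj_exp_def field_simps)

text \<open>Jensen's inequality for the measure with density \<open>\<phi>\<close>, not normalized. It follows by integrating
  the inequality between a convex function and its tangent at the mean value of \<open>u\<close>.\<close>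

lemma Jensen_weighted:
  fixes u \<phi> :: "'a \<Rightarrow> real"
  assumes p: "1 < p" and \<phi>: "integrable M \<phi>" "\<And>x. 0 \<le> \<phi> x"
    and u: "integrable M (\<lambda>x. u x * \<phi> x)" and up: "integrable M (\<lambda>x. \<bar>u x\<bar> powr p * \<phi> x)"
    and pos: "integral\<^sup>L M \<phi> > 0" "(\<integral>x. u x * \<phi> x \<partial>M) \<ge> 0"
  shows "integral\<^sup>L M \<phi> powr (1 - p) * (\<integral>x. u x * \<phi> x \<partial>M) powr p \<le> (\<integral>x. \<bar>u x\<bar> powr p * \<phi> x \<partial>M)"
proof (cases "(\<integral>x. u x * \<phi> x \<partial>M) = 0")
  case True
  have "0 \<le> (\<integral>x. \<bar>u x\<bar> powr p * \<phi> x \<partial>M)" using \<phi> by (intro integral_nonneg_AE) auto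
  then show ?thesis using True p by simp
next
  case False
  define \<Lambda> J where "\<Lambda> = integral\<^sup>L M \<phi>" and "J = (\<integral>x. u x * \<phi> x \<partial>M)"
  have \<Lambda>: "\<Lambda> > 0" and J: "J > 0" using pos False by (auto simp: \<Lambda>_def J_def)
  define s where "s = J / \<Lambda>"
  have s: "s > 0" using \<Lambda> J by (simp add: s_def)
  \<comment> \<open>the tangent to the convex function \<open>a powr p\<close> at \<open>s\<close>\<close>
  have tangent: "p * s powr (p - 1) * a - (p - 1) * s powr p \<le> a powr p" if "a \<ge> 0" for a
  proof -
    have "a * s powr (p - 1) \<le> a powr p / p + (s powr (p - 1)) powr conj_exp p / conj_exp p"
      using p that conj_exp_props[OF p] by (intro Youngs_inequality) auto
    also have "(s powr (p - 1)) powr conj_exp p = s powr p"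
      using p by (simp add: powr_powr conj_exp_def)
    finally have "p * (a * s powr (p - 1)) \<le> p * (a powr p / p + s powr p / conj_exp p)"
      using p by (intro mult_left_mono) auto
    also have "\<dots> = a powr p + (p - 1) * s powr p" using p by (simp add: conj_exp_def field_simps)
    finally show ?thesis by (simp add: algebra_simps)
  qed
  have pt: "(p * s powr (p - 1)) * (u x * \<phi> x) - ((p - 1) * s powr p) * \<phi> x \<le> \<bar>u x\<bar> powr p * \<phi> x" for x
  proof -
    have "p * s powr (p - 1) * u x \<le> p * s powr (p - 1) * \<bar>u x\<bar>"
      using p by (intro mult_left_mono) auto
    then have "p * s powr (p - 1) * u x - (p - 1) * s powr p \<le> \<bar>u x\<bar> powr p"
      using tangent[of "\<bar>u x\<bar>"] by simp
    from mult_right_mono[OF this \<phi>(2)[of x]] show ?thesis by (simp add: algebra_simps)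
  qed
  have "(p * s powr (p - 1)) * J - ((p - 1) * s powr p) * \<Lambda>
      = (\<integral>x. (p * s powr (p - 1)) * (u x * \<phi> x) - ((p - 1) * s powr p) * \<phi> x \<partial>M)"
    using u \<phi> by (simp add: J_def \<Lambda>_def)
  also have "\<dots> \<le> (\<integral>x. \<bar>u x\<bar> powr p * \<phi> x \<partial>M)"
    using u \<phi> up pt by (intro integral_mono) auto
  also have "(p * s powr (p - 1)) * J - ((p - 1) * s powr p) * \<Lambda> = \<Lambda> powr (1 - p) * J powr p"
  proof -
    have J': "J = s * \<Lambda>" using \<Lambda> by (simp add: s_def)
    have sp: "s powr p = s powr (p - 1) * s" using s by (simp add: powr_diff)
    have "\<Lambda> powr (1 - p) * J powr p = s powr p * \<Lambda>"
      using \<Lambda> s by (simp add: J' powr_mult powr_diff)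
    moreover have "(p * s powr (p - 1)) * J = p * (s powr p * \<Lambda>)" by (simp add: J' sp)
    ultimately show ?thesis by (simp add: algebra_simps)
  qed
  finally show ?thesis by (simp add: J_def \<Lambda>_def)
qed

text \<open>The constant that Young's inequality produces when the coefficient of \<open>a powr p\<close> is
  prescribed to be one half.\<close>

definition young_const :: "real \<Rightarrow> real" where
  "young_const p = 2 powr (conj_exp p - 1) * p powr (1 - conj_exp p) / conj_exp p"

text \<open>Young's inequality with the power \<open>\<rho> ^ (l - 2)\<close> split so that \<open>\<rho> ^ l\<close> accompanies \<open>a powr p\<close>.
  The other factor then retains the exponent \<open>l - 2 p'\<close>, whose positivity is the condition on \<open>l\<close>.\<close>

lemma Young_weighted:
  fixes a c \<rho> :: real
  assumes p: "1 < p" and l: "real l > 2 * conj_exp p" and nn: "0 \<le> a" "0 \<le> c" "0 \<le> \<rho>"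
  shows "a * c * \<rho> ^ (l - 2) \<le> (1/2) * (a powr p * \<rho> ^ l)
    + young_const p * (c powr conj_exp p * \<rho> powr (real l - 2 * conj_exp p))"
proof (cases "\<rho> = 0")
  case True
  have "l > 2" using l conj_exp_props(1)[OF p] by linarith
  then have "l = Suc (Suc (Suc (l - 3)))" by simp
  then obtain m where "l = Suc (Suc (Suc m))" ..
  then show ?thesis using True l by simp
next
  case False
  define q where "q = conj_exp p"
  have q: "1 < q" "1 / p + 1 / q = 1" "q / p = q - 1" using conj_exp_props[OF p] by (auto simp: q_def)
  have \<rho>: "\<rho> > 0" using False nn by simp
  have l2: "l > 2" using l q by (simp add: q_def)
  \<comment> \<open>the factor \<open>(p / 2) powr (1 / p)\<close> turns the coefficient \<open>1 / p\<close> of \<open>a powr p\<close> into one half\<close>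
  define A where "A = a * \<rho> powr (real l / p) * (p / 2) powr (1 / p)"
  define B where "B = c * \<rho> powr (real l / q - 2) * (2 / p) powr (1 / p)"
  have "A * B = a * c * (\<rho> powr (real l / p) * \<rho> powr (real l / q - 2)) * ((p / 2) powr (1 / p) * (2 / p) powr (1 / p))"
    by (simp add: A_def B_def)
  also have "\<rho> powr (real l / p) * \<rho> powr (real l / q - 2) = \<rho> powr (real l - 2)"
  proof -
    have "real l / p + (real l / q - 2) = real l * (1 / p + 1 / q) - 2" by (simp add: algebra_simps)
    also have "\<dots> = real l - 2" unfolding q(2) by simp
    finally show ?thesis by (simp only: flip: powr_add)
  qed
  also have "\<rho> powr (real l - 2) = \<rho> ^ (l - 2)"
    using \<rho> l2 by (simp add: powr_realpow[symmetric])
  also have "(p / 2) powr (1 / p) * (2 / p) powr (1 / p) = 1"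
    using p by (simp flip: powr_mult)
  finally have AB: "A * B = a * c * \<rho> ^ (l - 2)" by simp
  have "A * B \<le> A powr p / p + B powr q / q"
    using p q nn by (intro Youngs_inequality) (auto simp: A_def B_def)
  also have "A powr p = a powr p * \<rho> ^ l * (p / 2)"
    using p nn \<rho> by (simp add: A_def powr_mult powr_powr powr_realpow)
  also have "B powr q = c powr q * \<rho> powr (real l - 2 * q) * (2 / p) powr (q - 1)"
  proof -
    have "(real l / q - 2) * q = real l - 2 * q" using q by (simp add: field_simps)
    moreover have "1 / p * q = q - 1" using q by simp
    ultimately show ?thesis using nn p by (simp add: B_def powr_mult powr_powr del: times_divide_eq_left)
  qed
  also have "(2 / p) powr (q - 1) = 2 powr (q - 1) * p powr (1 - q)"
    using p by (simp add: powr_divide powr_diff)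
  finally show ?thesis using p q(1) by (simp add: AB young_const_def q_def[symmetric] mult_ac)
qed

lemma radial_nonneg:
  assumes "cutoff_profile \<eta>"
  shows "0 \<le> radial \<eta> x"
  using assms by (auto simp: cutoff_profile_def radial_def)

lemma Phi_weight_continuous:
  fixes \<psi> :: "real ^ 'n \<Rightarrow> real"
  assumes \<psi>: "test_function \<psi>" "\<And>x. 0 \<le> \<psi> x" and p: "1 < p" and l: "real l > 2 * conj_exp p"
  shows "continuous_on UNIV (\<lambda>x. \<bar>Phi l \<psi> x\<bar> powr conj_exp p * \<psi> x powr (real l - 2 * conj_exp p))"
    "bounded {x. \<bar>Phi l \<psi> x\<bar> powr conj_exp p * \<psi> x powr (real l - 2 * conj_exp p) \<noteq> 0}"
proof -
  have t: "test_function (partial i \<psi>)" "test_function (partial i (partial i \<psi>))" for i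
    using test_function_partial \<psi> by blast+
  have "continuous_on UNIV (Phi l \<psi>)"
    unfolding Phi_def[abs_def] gradient_def laplacian_def
    by (intro continuous_intros test_function_continuous t \<psi>)
  then show "continuous_on UNIV (\<lambda>x. \<bar>Phi l \<psi> x\<bar> powr conj_exp p * \<psi> x powr (real l - 2 * conj_exp p))"
    using conj_exp_props(1)[OF p] l \<psi>(2) test_function_continuous[OF \<psi>(1)]
    by (intro continuous_on_mult continuous_on_powr' continuous_on_const continuous_on_rabs) auto
  show "bounded {x. \<bar>Phi l \<psi> x\<bar> powr conj_exp p * \<psi> x powr (real l - 2 * conj_exp p) \<noteq> 0}"
    by (rule bounded_subset[OF test_function_bounded_support[OF \<psi>(1)]]) auto
qed

text \<open>Half of the nonlinear term absorbs the Laplacian up to a constant, by Young's inequality. The other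
  half dominates a power of the localized average of \<open>u\<close>, by Jensen's inequality. What remains
  is a scalar inequality that involves the average alone.\<close>

lemma localized_inequality:
  fixes \<psi> u :: "real ^ 'n \<Rightarrow> real"
  assumes \<psi>: "test_function \<psi>" "\<And>x. 0 \<le> \<psi> x" and p: "1 < p" and l: "real l > 2 * conj_exp p"
    and R: "R > 0" and u: "u \<in> L2"
    and up: "integrable lebesgue (\<lambda>x. \<bar>u x\<bar> powr p * rescale R \<psi> x ^ l)"
    and J: "(LINT x|lebesgue. u x * rescale R \<psi> x ^ l) \<ge> 0"
    and \<Lambda>: "(LINT x|lebesgue. \<psi> x ^ l) > 0"
  shows "(1/2) * (R ^ CARD('n) * (LINT x|lebesgue. \<psi> x ^ l)) powr (1 - p)
      * (LINT x|lebesgue. u x * rescale R \<psi> x ^ l) powr p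
    - young_const p * R powr (real CARD('n) - 2 * conj_exp p)
      * (LINT x|lebesgue. \<bar>Phi l \<psi> x\<bar> powr conj_exp p * \<psi> x powr (real l - 2 * conj_exp p))
    \<le> (LINT x|lebesgue. \<bar>u x\<bar> powr p * rescale R \<psi> x ^ l)
      + (LINT x|lebesgue. u x * laplacian (\<lambda>x. rescale R \<psi> x ^ l) x)"
proof -
  define q where "q = conj_exp p"
  have q: "1 < q" using conj_exp_props[OF p] by (simp add: q_def)
  have l2: "l > 2" using l q by (simp add: q_def)
  define W where "W x = \<bar>Phi l \<psi> x\<bar> powr q * \<psi> x powr (real l - 2 * q)" for x
  note W = Phi_weight_continuous[OF \<psi> p l, folded q_def, folded W_def]
  let ?\<phi> = "\<lambda>x. rescale R \<psi> x ^ l"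
  have tR: "test_function (rescale R \<psi>)" by (rule test_function_rescale[OF \<psi>(1) R])
  have t\<phi>: "test_function ?\<phi>" using tR l2 by (intro test_function_power) auto
  have nn: "0 \<le> rescale R \<psi> x" for x using \<psi> by (simp add: rescale_def)
  define X where "X = (LINT x|lebesgue. \<bar>u x\<bar> powr p * ?\<phi> x)"
  have lap: "laplacian ?\<phi> x = (1 / R)\<^sup>2 * Phi l \<psi> (x /\<^sub>R R) * rescale R \<psi> x ^ (l - 2)" for x
    using laplacian_power[of "rescale R \<psi>" l x] test_function_Ck[OF tR] l2
      Phi_rescale[OF test_function_Ck[OF \<psi>(1)], of l R x] by simp
  have pt: "- ((1/2) * (\<bar>u x\<bar> powr p * ?\<phi> x) + young_const p * (R powr (- 2 * q) * W (x /\<^sub>R R)))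
      \<le> u x * laplacian ?\<phi> x" for x
  proof -
    let ?c = "(1 / R)\<^sup>2 * \<bar>Phi l \<psi> (x /\<^sub>R R)\<bar>"
    have "\<bar>u x * laplacian ?\<phi> x\<bar> = \<bar>u x\<bar> * ?c * rescale R \<psi> x ^ (l - 2)"
      using nn[of x] by (simp add: lap abs_mult)
    also have "\<dots> \<le> (1/2) * (\<bar>u x\<bar> powr p * ?\<phi> x)
        + young_const p * (?c powr q * rescale R \<psi> x powr (real l - 2 * q))"
      unfolding q_def by (rule Young_weighted[OF p l]) (auto simp: nn)
    also have "?c powr q * rescale R \<psi> x powr (real l - 2 * q) = R powr (- 2 * q) * W (x /\<^sub>R R)"
    proof -
      have "(1 / R)\<^sup>2 = R powr (- 2)" using R by (simp add: powr_minus powr_numeral field_simps)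
      then have "((1 / R)\<^sup>2) powr q = R powr (- 2 * q)" by (simp add: powr_powr)
      then show ?thesis by (simp add: powr_mult W_def rescale_def)
    qed
    finally show ?thesis by linarith
  qed
  have Wint: "integrable lebesgue (\<lambda>x. W (x /\<^sub>R R))"
  proof (rule continuous_bounded_support_integrable(2))
    show "continuous_on UNIV (\<lambda>x. W (x /\<^sub>R R))"
      by (intro continuous_on_compose2[OF W(1)] continuous_intros) auto
    show "bounded {x. W (x /\<^sub>R R) \<noteq> 0}"
      by (rule bounded_subset[OF test_function_bounded_support[OF tR]]) (auto simp: W_def rescale_def)
  qed
  have Wval: "(LINT x|lebesgue. W (x /\<^sub>R R)) = R ^ CARD('n) * integral\<^sup>L lebesgue W"
    using integral_rescale[OF W(1) R] .
  have ulap: "integrable lebesgue (\<lambda>x. u x * laplacian ?\<phi> x)"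
  proof -
    have "integrable lebesgue (\<lambda>x. u x * partial i (partial i ?\<phi>) x)" for i
      by (intro L2_integrable_mult u test_function_L2 test_function_partial t\<phi>)
    then show ?thesis unfolding laplacian_def sum_distrib_left by (rule Bochner_Integration.integrable_sum)
  qed
  have "- ((1/2) * X + young_const p * (R powr (- 2 * q) * (R ^ CARD('n) * integral\<^sup>L lebesgue W)))
      = (LINT x|lebesgue. - ((1/2) * (\<bar>u x\<bar> powr p * ?\<phi> x) + young_const p * (R powr (- 2 * q) * W (x /\<^sub>R R))))"
    using up Wint by (simp add: X_def Wval)
  also have "\<dots> \<le> (LINT x|lebesgue. u x * laplacian ?\<phi> x)"
  proof (rule integral_mono[OF _ ulap pt])
    show "integrable lebesgue (\<lambda>x. - ((1/2) * (\<bar>u x\<bar> powr p * ?\<phi> x) + young_const p * (R powr (- 2 * q) * W (x /\<^sub>R R))))"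
      using up Wint by (intro Bochner_Integration.integrable_minus Bochner_Integration.integrable_add
          integrable_mult_right)
  qed
  finally have 1: "- ((1/2) * X + young_const p * (R powr (- 2 * q) * (R ^ CARD('n) * integral\<^sup>L lebesgue W)))
      \<le> (LINT x|lebesgue. u x * laplacian ?\<phi> x)" .
  have "R powr (- 2 * q) * R ^ CARD('n) = R powr (real CARD('n) - 2 * q)"
    using R by (simp add: powr_realpow[symmetric] flip: powr_add)
  then have "young_const p * (R powr (- 2 * q) * (R ^ CARD('n) * integral\<^sup>L lebesgue W))
      = young_const p * R powr (real CARD('n) - 2 * q) * integral\<^sup>L lebesgue W"
    by (simp only: mult.assoc flip: \<open>R powr (- 2 * q) * R ^ CARD('n) = _\<close>)
  with 1 have 2: "- ((1/2) * X + young_const p * R powr (real CARD('n) - 2 * q) * integral\<^sup>L lebesgue W)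
      \<le> (LINT x|lebesgue. u x * laplacian ?\<phi> x)"
    by (simp only:)
  have \<Lambda>R: "integral\<^sup>L lebesgue ?\<phi> = R ^ CARD('n) * (LINT x|lebesgue. \<psi> x ^ l)"
    using integral_rescale[of "\<lambda>x. \<psi> x ^ l", OF _ R] test_function_continuous[OF \<psi>(1)]
    by (simp add: rescale_def continuous_on_power)
  have "(R ^ CARD('n) * (LINT x|lebesgue. \<psi> x ^ l)) powr (1 - p)
      * (LINT x|lebesgue. u x * ?\<phi> x) powr p \<le> X"
    unfolding X_def \<Lambda>R[symmetric]
    using p up J \<Lambda> R nn L2_integrable_mult[OF u test_function_L2[OF t\<phi>]] test_function_integrable[OF t\<phi>]
    by (intro Jensen_weighted) (auto simp: \<Lambda>R)
  with 2 show ?thesis unfolding q_def[symmetric] W_def[symmetric] X_def[symmetric] by (simp add: W_def[abs_def])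
qed

section \<open>Comparison for the damped second order inequality\<close>

text \<open>The integrating factor \<open>E = exp (\<integral> b)\<close> makes \<open>E (y - F)'\<close> nondecreasing as long as \<open>y - F\<close> is
  nonnegative. At the infimum of the times at which \<open>y - F\<close> is negative it would still be nonnegative
  and have a positive derivative, so it could not become negative right after. The differential inequality
  is required only where \<open>F \<le> y\<close>, which is where the nonlinearity can be compared.\<close>

lemma comparison_second_order:
  fixes y y1 y2 F F1 F2 b :: "real \<Rightarrow> real"
  assumes b: "continuous_on {0..s} b"
    and y: "\<And>t. t \<in> {0..s} \<Longrightarrow> (y has_real_derivative y1 t) (at t within {0..s})"
      "\<And>t. t \<in> {0..s} \<Longrightarrow> (y1 has_real_derivative y2 t) (at t within {0..s})"
    and F: "\<And>t. t \<in> {0..s} \<Longrightarrow> (F has_real_derivative F1 t) (at t within {0..s})"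
      "\<And>t. t \<in> {0..s} \<Longrightarrow> (F1 has_real_derivative F2 t) (at t within {0..s})"
    and ineq: "\<And>t. t \<in> {0..s} \<Longrightarrow> F t \<le> y t \<Longrightarrow> F2 t + b t * F1 t \<le> y2 t + b t * y1 t"
    and init: "F 0 \<le> y 0" "F1 0 < y1 0"
    and t: "t \<in> {0..s}"
  shows "F t \<le> y t"
proof (rule ccontr)
  assume "\<not> F t \<le> y t"
  define d where "d t = y t - F t" for t
  define d1 where "d1 t = y1 t - F1 t" for t
  define E where "E t = exp (integral {0..t} b)" for t
  have d: "(d has_real_derivative d1 t) (at t within {0..s})"
    and d1: "(d1 has_real_derivative y2 t - F2 t) (at t within {0..s})" if "t \<in> {0..s}" for t
    unfolding d_def d1_def using that y F by (auto intro!: DERIV_diff)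
  have E: "(E has_real_derivative E t * b t) (at t within {0..s})" if "t \<in> {0..s}" for t
    unfolding E_def
    by (rule DERIV_chain2[OF DERIV_exp integral_has_real_derivative[OF b that]])
  define g where "g t = E t * d1 t" for t
  have g: "(g has_real_derivative E t * ((y2 t + b t * y1 t) - (F2 t + b t * F1 t))) (at t within {0..s})"
    if "t \<in> {0..s}" for t
    unfolding g_def using DERIV_mult[OF E[OF that] d1[OF that]]
    by (rule DERIV_cong) (simp add: d1_def algebra_simps)
  let ?Z = "{t \<in> {0..s}. d t < 0}"
  define \<tau> where "\<tau> = Inf ?Z"
  have Z: "?Z \<noteq> {}" using t \<open>\<not> F t \<le> y t\<close> by (auto simp: d_def)
  have bdd: "bdd_below ?Z" by (rule bdd_belowI[of _ 0]) auto
  have \<tau>0: "0 \<le> \<tau>" unfolding \<tau>_def using Z by (intro cInf_greatest) auto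
  obtain z where z: "z \<in> ?Z" using Z by blast
  have \<tau>s: "\<tau> \<le> s" using cInf_lower[OF z bdd] z by (simp add: \<tau>_def)
  have before: "0 \<le> d t" if "t \<in> {0..<\<tau>}" for t
  proof (rule ccontr)
    assume "\<not> 0 \<le> d t"
    then have "t \<in> ?Z" using that \<tau>s by simp
    then have "\<tau> \<le> t" unfolding \<tau>_def using bdd by (rule cInf_lower)
    then show False using that by simp
  qed
  have upto: "0 \<le> d t" if "t \<in> {0..\<tau>}" for t
  proof (cases "\<tau> = 0")
    case True
    then show ?thesis using that init by (simp add: d_def)
  next
    case False
    then have cl: "closure {0..<\<tau>} = {0..\<tau>}" using \<tau>0 by simp
    have "continuous_on {0..s} d" using d by (rule DERIV_continuous_on)
    then have "continuous_on {0..\<tau>} d" using \<tau>s by (auto elim: continuous_on_subset)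
    then show ?thesis using continuous_ge_on_closure[of "{0..<\<tau>}" d t 0] cl that before by simp
  qed
  have "g 0 \<le> g \<tau>"
  proof (rule DERIV_nonneg_imp_increasing_open[OF \<tau>0])
    show "continuous_on {0..\<tau>} g"
      using DERIV_continuous_on[OF g] \<tau>s by (auto elim: continuous_on_subset)
    fix x assume x: "0 < x" "x < \<tau>"
    have "at x within {0..s} = at x" using x \<tau>s by (intro at_within_interior) simp
    then have "(g has_real_derivative E x * ((y2 x + b x * y1 x) - (F2 x + b x * F1 x))) (at x)"
      using g[of x] x \<tau>s by simp
    moreover have "0 \<le> E x * ((y2 x + b x * y1 x) - (F2 x + b x * F1 x))"
      using ineq[of x] upto[of x] x \<tau>s by (intro mult_nonneg_nonneg) (auto simp: E_def d_def)
    ultimately show "\<exists>y. (g has_real_derivative y) (at x) \<and> 0 \<le> y" by blast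
  qed
  moreover have "0 < g 0" using init by (simp add: g_def E_def d1_def)
  ultimately have "0 < E \<tau> * d1 \<tau>" by (simp add: g_def)
  then have "0 < d1 \<tau>" by (simp add: E_def zero_less_mult_iff)
  from has_real_derivative_pos_inc_right[OF d this]
  obtain \<delta> where \<delta>: "\<delta> > 0" "\<And>h. h > 0 \<Longrightarrow> \<tau> + h \<in> {0..s} \<Longrightarrow> h < \<delta> \<Longrightarrow> d \<tau> < d (\<tau> + h)"
    using \<tau>0 \<tau>s by auto
  have "Inf ?Z < \<tau> + \<delta>" using \<delta> by (simp add: \<tau>_def)
  then obtain z where z: "z \<in> ?Z" "z < \<tau> + \<delta>" using cInf_lessD[OF Z] by blast
  have "\<tau> \<le> z" unfolding \<tau>_def using z(1) bdd by (rule cInf_lower)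
  moreover have "0 \<le> d \<tau>" using upto \<tau>0 by simp
  ultimately have "d \<tau> < d z" using \<delta>(2)[of "z - \<tau>"] z by (cases "z = \<tau>") auto
  with \<open>0 \<le> d \<tau>\<close> show False using z by simp
qed

section \<open>The damping coefficient and its primitive\<close>

lemma nonneg_derivative_mono:
  fixes h :: "real \<Rightarrow> real"
  assumes h: "\<And>t. 0 \<le> t \<Longrightarrow> (h has_real_derivative h' t) (at t within {0..})"
    and nn: "\<And>t. 0 \<le> t \<Longrightarrow> 0 \<le> h' t" and "0 \<le> t"
  shows "h 0 \<le> h t"
proof (rule DERIV_nonneg_imp_increasing_open[OF \<open>0 \<le> t\<close>])
  show "continuous_on {0..t} h"
    using DERIV_continuous_on[of "{0..}" h h'] h by (auto elim: continuous_on_subset)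
  show "\<exists>y. (h has_real_derivative y) (at x) \<and> 0 \<le> y" if "0 < x" "x < t" for x
    using h[of x] nn[of x] at_within_interior[of x "{0..}"] that by auto
qed

text \<open>The coefficients that a function of \<open>B\<close> produces in the damped equation are \<open>b' / b\<^sup>2\<close>
  and \<open>1 / b\<^sup>2\<close>. The first is bounded because \<open>(1 + t) b\<close> is bounded below. The second grows at most
  like \<open>(1 + t) powr (2 \<beta>)\<close>, while \<open>1 + B\<close> grows at least like \<open>(1 + t) powr (1 + \<beta>)\<close>; this uses
  \<open>\<beta> \<le> 1\<close>. The condition \<open>\<beta> \<ge> -1\<close> makes \<open>B\<close> grow at least logarithmically.\<close>

lemma damping_estimates:
  assumes damp: "damping \<beta> b" and \<beta>: "-1 \<le> \<beta>" "\<beta> \<le> 1"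
  obtains b' C where "C > 0" "\<And>t. 0 \<le> t \<Longrightarrow> 0 < b t"
    "\<And>t. 0 \<le> t \<Longrightarrow> (b has_real_derivative b' t) (at t within {0..})"
    "\<And>t. 0 \<le> t \<Longrightarrow> (damping_B b has_real_derivative inverse (b t)) (at t within {0..})"
    "\<And>t. 0 \<le> t \<Longrightarrow> \<bar>b' t\<bar> / (b t)\<^sup>2 \<le> C"
    "\<And>t. 0 \<le> t \<Longrightarrow> 1 / (b t)\<^sup>2 \<le> C * (1 + damping_B b t)"
    "\<And>M. \<exists>t\<ge>0. M \<le> damping_B b t"
proof -
  let ?B = "damping_B b"
  obtain D where D: "D 0 = b"
    "\<And>k t. t \<ge> 0 \<Longrightarrow> (D k has_real_derivative D (Suc k) t) (at t within {0..})"
    using damp unfolding damping_def smooth_halfline_def by blast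
  obtain b1 b2 b3 where b123: "b1 > 0" "b2 > 0" "b3 > 0"
    and bnd: "\<And>t. t \<ge> 0 \<Longrightarrow> b1 * (1 + t) powr (- \<beta>) \<le> b t"
      "\<And>t. t \<ge> 0 \<Longrightarrow> b t \<le> b2 * (1 + t) powr (- \<beta>)"
      "\<And>t. t \<ge> 0 \<Longrightarrow> \<bar>vector_derivative b (at t within {0..})\<bar> \<le> b3 * inverse (1 + t) * b t"
    and pos: "\<And>t. 0 \<le> t \<Longrightarrow> 0 < b t"
    using damp unfolding damping_def by blast
  define b' where "b' = D 1"
  have b': "(b has_real_derivative b' t) (at t within {0..})" if "0 \<le> t" for t
    using D(2)[OF that, of 0] D(1) by (simp add: b'_def)
  have b'bnd: "\<bar>b' t\<bar> \<le> b3 * inverse (1 + t) * b t" if "0 \<le> t" for t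
  proof -
    have "at_right t \<le> at t within {0..}" using that by (intro at_le) auto
    then have "at t within {0..} \<noteq> bot"
      using trivial_limit_at_right_real[of t] by (auto simp: bot_unique)
    then have "vector_derivative b (at t within {0..}) = b' t"
      using b'[OF that] by (intro vector_derivative_within) (simp_all add: has_real_derivative_iff_has_vector_derivative)
    then show ?thesis using bnd(3)[OF that] by simp
  qed
  have contb: "continuous_on {0..} b" using b' by (rule DERIV_continuous_on) auto
  have contib: "continuous_on {0..} (\<lambda>t. inverse (b t))"
    using contb pos by (intro continuous_on_inverse) force+
  have B': "(?B has_real_derivative inverse (b t)) (at t within {0..})" if "0 \<le> t" for t
  proof -
    have "(?B has_real_derivative inverse (b t)) (at t within {0..t + 1})"
      unfolding damping_B_def
      by (rule integral_has_real_derivative[OF continuous_on_subset[OF contib]]) (use that in auto)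
    moreover have "at t within {0..t + 1} = at t within {0..}"
      by (rule at_within_nhd[of t "{..<t + 1}"]) (use that in auto)
    ultimately show ?thesis by simp
  qed
  have B0: "?B 0 = 0" by (simp add: damping_B_def)
  have ib: "(1 + t) powr \<beta> \<le> b2 * inverse (b t)" if "0 \<le> t" for t
  proof -
    have "b t * (1 + t) powr \<beta> \<le> b2 * (1 + t) powr (- \<beta>) * (1 + t) powr \<beta>"
      using bnd(2)[OF that] by (intro mult_right_mono) auto
    also have "\<dots> = b2" using that by (simp add: mult.assoc flip: powr_add)
    finally show ?thesis using pos[OF that] by (simp add: field_simps)
  qed
  have ib1: "b1 * inverse (b t) \<le> (1 + t) powr \<beta>" if "0 \<le> t" for t
  proof -
    have "b1 = b1 * (1 + t) powr (- \<beta>) * (1 + t) powr \<beta>"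
      using that by (simp add: mult.assoc flip: powr_add)
    also have "\<dots> \<le> b t * (1 + t) powr \<beta>"
      using bnd(1)[OF that] by (intro mult_right_mono) auto
    finally show ?thesis using pos[OF that] by (simp add: field_simps)
  qed
  have pw: "((\<lambda>t. (1 + t) powr (1 + \<beta>)) has_real_derivative (1 + \<beta>) * (1 + t) powr \<beta>) (at t within {0..})"
    if "0 \<le> t" for t
    using that by (auto intro!: derivative_eq_intros)
  have grow: "(1 + t) powr (1 + \<beta>) \<le> 1 + 2 * b2 * ?B t" if "0 \<le> t" for t
  proof -
    have "1 + 2 * b2 * ?B 0 - (1 + 0) powr (1 + \<beta>) \<le> 1 + 2 * b2 * ?B t - (1 + t) powr (1 + \<beta>)"
    proof (rule nonneg_derivative_mono[OF _ _ that])
      fix t :: real assume t: "0 \<le> t"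
      show "((\<lambda>t. 1 + 2 * b2 * ?B t - (1 + t) powr (1 + \<beta>)) has_real_derivative
          0 + 2 * b2 * inverse (b t) - (1 + \<beta>) * (1 + t) powr \<beta>) (at t within {0..})"
        by (intro DERIV_diff DERIV_add DERIV_const DERIV_cmult B' pw t)
      have "(1 + \<beta>) * (1 + t) powr \<beta> \<le> 2 * (1 + t) powr \<beta>"
        using \<beta> by (intro mult_right_mono) auto
      then show "0 \<le> 0 + 2 * b2 * inverse (b t) - (1 + \<beta>) * (1 + t) powr \<beta>"
        using ib[OF t] by linarith
    qed
    then show ?thesis by (simp add: B0)
  qed
  have Blog: "ln (1 + t) \<le> b2 * ?B t" if "0 \<le> t" for t
  proof -
    have "b2 * ?B 0 - ln (1 + 0) \<le> b2 * ?B t - ln (1 + t)"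
    proof (rule nonneg_derivative_mono[OF _ _ that])
      fix t :: real assume t: "0 \<le> t"
      have "((\<lambda>t. ln (1 + t)) has_real_derivative inverse (1 + t)) (at t within {0..})"
        using t by (auto intro!: derivative_eq_intros simp: divide_inverse)
      then show "((\<lambda>t. b2 * ?B t - ln (1 + t)) has_real_derivative
          b2 * inverse (b t) - inverse (1 + t)) (at t within {0..})"
        by (intro DERIV_diff DERIV_cmult B' t)
      have "inverse (1 + t) = (1 + t) powr (-1)" using t by (simp add: powr_minus)
      also have "\<dots> \<le> (1 + t) powr \<beta>" using t \<beta> by (intro powr_mono) auto
      finally show "0 \<le> b2 * inverse (b t) - inverse (1 + t)" using ib[OF t] by linarith
    qed
    then show ?thesis by (simp add: B0)
  qed
  define C where "C = max (b3 / b1) ((1 + 2 * b2) / b1\<^sup>2)"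
  have Bnn: "0 \<le> ?B t" if "0 \<le> t" for t
    using nonneg_derivative_mono[OF B' _ that] pos B0 by (simp add: less_imp_le)
  show ?thesis
  proof (rule that[of C b'])
    show "C > 0" using b123 by (simp add: C_def less_max_iff_disj)
  next
    fix t :: real assume t: "0 \<le> t"
    note p = pos[OF t]
    have "\<bar>b' t\<bar> / (b t)\<^sup>2 \<le> (b3 * inverse (1 + t) * b t) / (b t)\<^sup>2"
      using b'bnd[OF t] by (intro divide_right_mono) auto
    also have "\<dots> = b3 * (inverse (1 + t) * inverse (b t))"
      using p by (simp add: power2_eq_square inverse_eq_divide)
    also have "\<dots> \<le> b3 * (1 / b1)"
    proof (intro mult_left_mono)
      have "b1 * inverse (b t) \<le> (1 + t) powr 1"
        using ib1[OF t] powr_mono[of \<beta> 1 "1 + t"] \<beta> t by linarith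
      then have "b1 * inverse (b t) \<le> 1 + t" using t by simp
      then show "inverse (1 + t) * inverse (b t) \<le> 1 / b1" using t b123 p by (simp add: field_simps)
    qed (use b123 in simp)
    finally show "\<bar>b' t\<bar> / (b t)\<^sup>2 \<le> C" by (simp add: C_def)
    have "b1\<^sup>2 * (1 / (b t)\<^sup>2) = (b1 * inverse (b t))\<^sup>2" by (simp add: power_mult_distrib divide_inverse power_inverse)
    also have "\<dots> \<le> ((1 + t) powr \<beta>)\<^sup>2" using ib1[OF t] b123 p by (intro power_mono) auto
    also have "\<dots> = (1 + t) powr (2 * \<beta>)" using t by (simp add: power2_eq_square flip: powr_add)
    also have "\<dots> \<le> (1 + t) powr (1 + \<beta>)" using t \<beta> by (intro powr_mono) auto
    also have "\<dots> \<le> 1 + 2 * b2 * ?B t" by (rule grow[OF t])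
    also have "\<dots> \<le> (1 + 2 * b2) * (1 + ?B t)" using b123 Bnn[OF t] by (simp add: algebra_simps)
    finally have "1 / (b t)\<^sup>2 \<le> (1 + 2 * b2) / b1\<^sup>2 * (1 + ?B t)" using b123 by (simp add: field_simps)
    also have "\<dots> \<le> C * (1 + ?B t)" using Bnn[OF t] by (intro mult_right_mono) (auto simp: C_def)
    finally show "1 / (b t)\<^sup>2 \<le> C * (1 + ?B t)" .
  next
    fix M :: real
    define t where "t = exp (b2 * \<bar>M\<bar>) - 1"
    have t: "0 \<le> t" using b123 by (simp add: t_def)
    have "b2 * M \<le> b2 * \<bar>M\<bar>" using b123 by simp
    also have "\<dots> = ln (1 + t)" by (simp add: t_def)
    also have "\<dots> \<le> b2 * ?B t" by (rule Blog[OF t])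
    finally have "M \<le> ?B t" using b123 by simp
    then show "\<exists>t\<ge>0. M \<le> ?B t" using t by blast
  qed (fact pos b' B')+
qed

section \<open>The explicit subsolution\<close>

lemma powr_superadditive:
  fixes a b :: real
  assumes "1 \<le> p" "0 \<le> a" "0 \<le> b"
  shows "a powr p + b powr p \<le> (a + b) powr p"
proof -
  have "x powr p \<le> x * (a + b) powr (p - 1)" if "0 \<le> x" "x \<le> a + b" for x
  proof (cases "x = 0")
    case False
    then have "x powr p = x * x powr (p - 1)" using that by (simp add: powr_diff)
    also have "\<dots> \<le> x * (a + b) powr (p - 1)"
      using that assms by (intro mult_left_mono powr_mono2) auto
    finally show ?thesis .
  qed simp
  from this[of a] this[of b]
  have "a powr p + b powr p \<le> (a + b) * (a + b) powr (p - 1)"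
    using assms by (simp add: distrib_right)
  also have "\<dots> = (a + b) powr p"
    using assms by (cases "a + b = 0") (auto simp: powr_diff)
  finally show ?thesis .
qed

lemma DERIV_powr_within:
  fixes g :: "real \<Rightarrow> real"
  assumes "(g has_real_derivative g') (at t within S)" "0 < g t"
  shows "((\<lambda>t. g t powr r) has_real_derivative r * g t powr (r - 1) * g') (at t within S)"
  using DERIV_chain2[OF has_real_derivative_powr[OF assms(2)] assms(1)] .

text \<open>Along \<open>(1 - \<mu> B) powr (-m)\<close> with \<open>m = 2 / (p - 1)\<close> one has \<open>f powr p = (1 - \<mu> B) powr (-m-2)\<close>,
  and all three contributions to \<open>f'' + b f'\<close> are at most a multiple of \<open>\<mu>\<close> times this power as long
  as \<open>\<mu> B < 1\<close>. The factor \<open>1 / b\<^sup>2\<close> is unbounded when \<open>b\<close> tends to 0, but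
  \<open>\<mu> / b\<^sup>2\<close> is at most \<open>C (\<mu> + \<mu> B) \<le> 2 C\<close> there.\<close>

lemma subsolution:
  assumes p: "1 < p" and \<mu>: "0 < \<mu>" "\<mu> \<le> 1" and C: "0 < C"
    and b: "\<And>t. 0 \<le> t \<Longrightarrow> 0 < b t"
    and b': "\<And>t. 0 \<le> t \<Longrightarrow> (b has_real_derivative b' t) (at t within {0..})"
    and B: "\<And>t. 0 \<le> t \<Longrightarrow> (B has_real_derivative inverse (b t)) (at t within {0..})" "\<And>t. 0 \<le> t \<Longrightarrow> 0 \<le> B t"
    and est: "\<And>t. 0 \<le> t \<Longrightarrow> \<bar>b' t\<bar> / (b t)\<^sup>2 \<le> C" "\<And>t. 0 \<le> t \<Longrightarrow> 1 / (b t)\<^sup>2 \<le> C * (1 + B t)"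
    and m: "m = 2 / (p - 1)" and \<kappa>: "\<mu> * (2 * C * m * (m + 1) + m * C + m) \<le> \<kappa>"
    and f: "f = (\<lambda>t. (1 - \<mu> * B t) powr (- m))"
    and f1: "f1 = (\<lambda>t. m * \<mu> * (1 - \<mu> * B t) powr (- m - 1) * inverse (b t))"
  obtains f2 where
    "\<And>t. 0 \<le> t \<Longrightarrow> \<mu> * B t < 1 \<Longrightarrow> (f has_real_derivative f1 t) (at t within {0..})"
    "\<And>t. 0 \<le> t \<Longrightarrow> \<mu> * B t < 1 \<Longrightarrow> (f1 has_real_derivative f2 t) (at t within {0..})"
    "\<And>t. 0 \<le> t \<Longrightarrow> \<mu> * B t < 1 \<Longrightarrow> f2 t + b t * f1 t \<le> \<kappa> * f t powr p"
proof -
  have m0: "m > 0" using p by (simp add: m)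
  have mp: "- m * p = - m - 2" using p by (simp add: m field_simps)
  define g where "g t = 1 - \<mu> * B t" for t
  define f2 where "f2 t = m * \<mu> * ((m + 1) * \<mu> * g t powr (- m - 2) * inverse (b t)) * inverse (b t)
      - m * \<mu> * g t powr (- m - 1) * (b' t / (b t)\<^sup>2)" for t
  have g: "(g has_real_derivative - \<mu> * inverse (b t)) (at t within {0..})" if "0 \<le> t" for t
  proof -
    have "(g has_real_derivative 0 - \<mu> * inverse (b t)) (at t within {0..})"
      unfolding g_def by (intro DERIV_diff DERIV_const DERIV_cmult B that)
    then show ?thesis by simp
  qed
  show ?thesis
  proof (rule that[of f2])
    fix t :: real assume t: "0 \<le> t" "\<mu> * B t < 1"
    have gt: "0 < g t" "g t \<le> 1" using t B(2)[OF t(1)] \<mu> by (auto simp: g_def)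
    note bt = b[OF t(1)]
    have "(f has_real_derivative - m * g t powr (- m - 1) * (- \<mu> * inverse (b t))) (at t within {0..})"
      using DERIV_powr_within[OF g[OF t(1)] gt(1), of "- m"] by (simp add: f g_def)
    then show "(f has_real_derivative f1 t) (at t within {0..})"
      by (rule DERIV_cong) (simp add: f1 g_def)
    have ib: "((\<lambda>t. inverse (b t)) has_real_derivative - (b' t / (b t)\<^sup>2)) (at t within {0..})"
      using DERIV_inverse'[OF b'[OF t(1)]] bt by (simp add: power2_eq_square divide_inverse mult_ac)
    have "((\<lambda>t. m * \<mu> * g t powr (- m - 1) * inverse (b t)) has_real_derivative
        (m * \<mu> * ((- m - 1) * g t powr (- m - 1 - 1) * (- \<mu> * inverse (b t)))) * inverse (b t)
        + (- (b' t / (b t)\<^sup>2)) * (m * \<mu> * g t powr (- m - 1))) (at t within {0..})"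
      by (intro DERIV_mult DERIV_cmult DERIV_powr_within g t ib gt)
    then have "(f1 has_real_derivative
        (m * \<mu> * ((- m - 1) * g t powr (- m - 1 - 1) * (- \<mu> * inverse (b t)))) * inverse (b t)
        + (- (b' t / (b t)\<^sup>2)) * (m * \<mu> * g t powr (- m - 1))) (at t within {0..})"
      by (simp add: f1 g_def)
    then show "(f1 has_real_derivative f2 t) (at t within {0..})"
      by (rule DERIV_cong) (simp add: f2_def algebra_simps)
    define P where "P = g t powr (- m - 2)"
    have P: "P > 0" using gt by (simp add: P_def)
    have Q: "g t powr (- m - 1) \<le> P" "0 \<le> g t powr (- m - 1)"
      unfolding P_def using gt by (auto intro: powr_mono')
    have "\<mu> * (1 / (b t)\<^sup>2) \<le> \<mu> * (C * (1 + B t))" using est(2)[OF t(1)] \<mu> by (intro mult_left_mono) auto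
    also have "\<dots> = C * (\<mu> + \<mu> * B t)" by (simp add: algebra_simps)
    also have "\<dots> \<le> C * 2" using C \<mu> t by (intro mult_left_mono) auto
    finally have e1: "\<mu> * (1 / (b t)\<^sup>2) \<le> 2 * C" by simp
    have "m * \<mu> * ((m + 1) * \<mu> * P * inverse (b t)) * inverse (b t) = (\<mu> * (1 / (b t)\<^sup>2)) * (m * (m + 1) * \<mu> * P)"
      by (simp add: power2_eq_square divide_inverse mult_ac)
    also have "\<dots> \<le> 2 * C * (m * (m + 1) * \<mu> * P)"
      using e1 m0 \<mu> P by (intro mult_right_mono) auto
    finally have t1: "m * \<mu> * ((m + 1) * \<mu> * P * inverse (b t)) * inverse (b t) \<le> \<mu> * (2 * C * m * (m + 1)) * P"
      by (simp add: mult_ac)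
    have "- (m * \<mu> * g t powr (- m - 1) * (b' t / (b t)\<^sup>2)) \<le> m * \<mu> * g t powr (- m - 1) * (\<bar>b' t\<bar> / (b t)\<^sup>2)"
    proof -
      have "m * \<mu> * g t powr (- m - 1) * (- b' t / (b t)\<^sup>2) \<le> m * \<mu> * g t powr (- m - 1) * (\<bar>b' t\<bar> / (b t)\<^sup>2)"
        using m0 \<mu> Q by (intro mult_left_mono divide_right_mono) auto
      then show ?thesis by simp
    qed
    also have "\<dots> \<le> m * \<mu> * P * C"
      using m0 \<mu> Q est(1)[OF t(1)] P by (intro mult_mono mult_left_mono) auto
    finally have t2: "- (m * \<mu> * g t powr (- m - 1) * (b' t / (b t)\<^sup>2)) \<le> \<mu> * (m * C) * P"
      by (simp add: mult_ac)
    have "b t * f1 t = m * \<mu> * g t powr (- m - 1)" using bt by (simp add: f1 g_def)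
    also have "\<dots> \<le> m * \<mu> * P" using m0 \<mu> Q by (intro mult_left_mono) auto
    finally have t3: "b t * f1 t \<le> \<mu> * m * P" by (simp add: mult_ac)
    have "f2 t + b t * f1 t \<le> \<mu> * (2 * C * m * (m + 1)) * P + \<mu> * (m * C) * P + \<mu> * m * P"
      using t1 t2 t3 by (simp add: f2_def P_def)
    also have "\<dots> = \<mu> * (2 * C * m * (m + 1) + m * C + m) * P" by (simp add: algebra_simps)
    also have "\<dots> \<le> \<kappa> * P" using \<kappa> P by (intro mult_right_mono) auto
    also have "P = f t powr p"
    proof -
      have "f t powr p = g t powr (- m * p)" by (simp add: f powr_powr g_def)
      then show ?thesis unfolding mp P_def ..
    qed
    finally show "f2 t + b t * f1 t \<le> \<kappa> * f t powr p" .
  qed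
qed

text \<open>Comparing with \<open>\<theta> (1 + f)\<close> rather than \<open>\<theta> f\<close> absorbs the
  negative constant, since \<open>y powr p - \<theta> powr p\<close> dominates \<open>(y - \<theta>) powr p\<close>.\<close>

lemma damped_lower_bound:
  fixes y y1 y2 b b' B :: "real \<Rightarrow> real"
  assumes p: "1 < p" and \<mu>: "0 < \<mu>" "\<mu> \<le> 1" and C: "0 < C" and \<theta>: "0 < \<theta>" and k: "0 < k"
    and b: "\<And>t. 0 \<le> t \<Longrightarrow> 0 < b t"
    and b': "\<And>t. 0 \<le> t \<Longrightarrow> (b has_real_derivative b' t) (at t within {0..})"
    and B: "\<And>t. 0 \<le> t \<Longrightarrow> (B has_real_derivative inverse (b t)) (at t within {0..})"
      "\<And>r t. 0 \<le> r \<Longrightarrow> r \<le> t \<Longrightarrow> B r \<le> B t" "B 0 = 0"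
    and est: "\<And>t. 0 \<le> t \<Longrightarrow> \<bar>b' t\<bar> / (b t)\<^sup>2 \<le> C" "\<And>t. 0 \<le> t \<Longrightarrow> 1 / (b t)\<^sup>2 \<le> C * (1 + B t)"
    and m: "m = 2 / (p - 1)"
    and \<kappa>: "\<mu> * (2 * C * m * (m + 1) + m * C + m) \<le> k * \<theta> powr (p - 1)"
    and s: "0 \<le> s" "\<mu> * B s < 1"
    and y: "\<And>t. t \<in> {0..s} \<Longrightarrow> (y has_real_derivative y1 t) (at t within {0..s})"
      "\<And>t. t \<in> {0..s} \<Longrightarrow> (y1 has_real_derivative y2 t) (at t within {0..s})"
    and ineq: "\<And>t. t \<in> {0..s} \<Longrightarrow> 0 \<le> y t \<Longrightarrow> k * (y t powr p - \<theta> powr p) \<le> y2 t + b t * y1 t"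
    and init: "2 * \<theta> \<le> y 0" "\<theta> * (m * \<mu> / b 0) < y1 0"
  shows "\<theta> * (1 - \<mu> * B s) powr (- m) \<le> y s"
proof -
  define \<kappa>' where "\<kappa>' = k * \<theta> powr (p - 1)"
  define f where "f = (\<lambda>t. (1 - \<mu> * B t) powr (- m))"
  define f1 where "f1 = (\<lambda>t. m * \<mu> * (1 - \<mu> * B t) powr (- m - 1) * inverse (b t))"
  have Bnn: "0 \<le> B t" if "0 \<le> t" for t using B(2)[of 0 t] B(3) that by simp
  obtain f2 where f: "\<And>t. 0 \<le> t \<Longrightarrow> \<mu> * B t < 1 \<Longrightarrow> (f has_real_derivative f1 t) (at t within {0..})"
    "\<And>t. 0 \<le> t \<Longrightarrow> \<mu> * B t < 1 \<Longrightarrow> (f1 has_real_derivative f2 t) (at t within {0..})"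
    "\<And>t. 0 \<le> t \<Longrightarrow> \<mu> * B t < 1 \<Longrightarrow> f2 t + b t * f1 t \<le> \<kappa>' * f t powr p"
    using subsolution[OF p \<mu> C b b' B(1) Bnn est m \<kappa> f_def f1_def] unfolding \<kappa>'_def by blast
  have lt: "\<mu> * B t < 1" if "t \<in> {0..s}" for t
  proof -
    have "\<mu> * B t \<le> \<mu> * B s" using that \<mu> B(2)[of t s] by (intro mult_left_mono) auto
    then show ?thesis using s by simp
  qed
  have "\<theta> * (1 + f s) \<le> y s"
  proof (rule comparison_second_order[where s=s and b=b and y=y and ?y1.0=y1 and ?y2.0=y2
        and F="\<lambda>t. \<theta> * (1 + f t)" and ?F1.0="\<lambda>t. \<theta> * f1 t" and ?F2.0="\<lambda>t. \<theta> * f2 t"])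
    show "continuous_on {0..s} b"
      using DERIV_continuous_on[of "{0..}" b b'] b' by (auto elim: continuous_on_subset)
    fix t assume t: "t \<in> {0..s}"
    have sub: "{0..s} \<subseteq> {0..}" by auto
    have "((\<lambda>t. \<theta> * (1 + f t)) has_real_derivative \<theta> * (0 + f1 t)) (at t within {0..s})"
      using t lt by (intro DERIV_cmult DERIV_add DERIV_const DERIV_subset[OF f(1) sub]) auto
    then show "((\<lambda>t. \<theta> * (1 + f t)) has_real_derivative \<theta> * f1 t) (at t within {0..s})" by simp
    show "((\<lambda>t. \<theta> * f1 t) has_real_derivative \<theta> * f2 t) (at t within {0..s})"
      using t lt by (intro DERIV_cmult DERIV_subset[OF f(2) sub]) auto
    assume le: "\<theta> * (1 + f t) \<le> y t"
    have f0: "0 \<le> f t" by (simp add: f_def)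
    have "\<theta> * f2 t + b t * (\<theta> * f1 t) = \<theta> * (f2 t + b t * f1 t)" by (simp add: algebra_simps)
    also have "\<dots> \<le> \<theta> * (\<kappa>' * f t powr p)" using f(3)[of t] t lt \<theta> by (intro mult_left_mono) auto
    also have "\<dots> = k * (\<theta> * f t) powr p"
      using \<theta> f0 by (simp add: \<kappa>'_def powr_mult powr_diff)
    also have "\<dots> \<le> k * ((\<theta> + \<theta> * f t) powr p - \<theta> powr p)"
      using powr_superadditive[of p \<theta> "\<theta> * f t"] p \<theta> f0 k by (intro mult_left_mono) auto
    also have "\<dots> \<le> k * (y t powr p - \<theta> powr p)"
      using le k \<theta> f0 p by (intro mult_left_mono diff_right_mono powr_mono2) (auto simp: algebra_simps)
    also have "\<dots> \<le> y2 t + b t * y1 t"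
    proof (rule ineq[OF t])
      have "0 \<le> \<theta> * (1 + f t)" using \<theta> f0 by simp
      then show "0 \<le> y t" using le by linarith
    qed
    finally show "\<theta> * f2 t + b t * (\<theta> * f1 t) \<le> y2 t + b t * y1 t" .
  next
    show "\<theta> * (1 + f 0) \<le> y 0" using init by (simp add: f_def B)
    show "\<theta> * f1 0 < y1 0" using init by (simp add: f1_def B divide_inverse)
  qed (use y s in auto)
  moreover have "\<theta> * f s \<le> \<theta> * (1 + f s)" using \<theta> by simp
  ultimately show ?thesis by (simp add: f_def)
qed

text \<open>If \<open>\<mu> B\<close> reached 1, the lower bound would be unbounded on a compact interval on which \<open>y\<close> is
  continuous.\<close>

lemma damped_blowup:
  fixes y B :: "real \<Rightarrow> real"
  assumes \<mu>: "0 < \<mu>" and m: "0 < m" and \<theta>: "0 < \<theta>"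
    and B: "continuous_on {0..s} B" "B 0 = 0" and s: "0 \<le> s"
    and y: "continuous_on {0..s} y"
    and low: "\<And>t. t \<in> {0..s} \<Longrightarrow> \<mu> * B t < 1 \<Longrightarrow> \<theta> * (1 - \<mu> * B t) powr (- m) \<le> y t"
  shows "\<mu> * B s < 1"
proof (rule ccontr)
  assume "\<not> \<mu> * B s < 1"
  have "bounded (y ` {0..s})" by (intro compact_imp_bounded compact_continuous_image y) simp
  then obtain M where M: "\<And>t. t \<in> {0..s} \<Longrightarrow> \<bar>y t\<bar> \<le> M" 
    unfolding bounded_iff by (auto simp del: atLeastAtMost_iff)
  have M0: "0 \<le> M" using M[of 0] s by auto
  \<comment> \<open>when \<open>\<mu> B = 1 - \<delta>\<close>, the lower bound is \<open>M + \<theta>\<close>\<close>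
  define \<delta> where "\<delta> = (M / \<theta> + 1) powr (- 1 / m)"
  have \<delta>: "0 < \<delta>" "\<delta> \<le> 1"
  proof -
    have pos: "1 \<le> M / \<theta> + 1" using M0 \<theta> by simp
    then show "0 < \<delta>" by (simp add: \<delta>_def)
    have "\<delta> \<le> (M / \<theta> + 1) powr 0" unfolding \<delta>_def using pos m by (intro powr_mono) auto
    then show "\<delta> \<le> 1" using pos by simp
  qed
  have "\<delta> powr (- m) = M / \<theta> + 1"
    using m M0 \<theta> by (simp add: \<delta>_def powr_powr add_nonneg_pos)
  have "B 0 \<le> (1 - \<delta>) / \<mu>" using \<delta> \<mu> B by simp
  moreover have "(1 - \<delta>) / \<mu> \<le> B s"
    using \<open>\<not> \<mu> * B s < 1\<close> \<delta> \<mu> by (simp add: field_simps)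
  ultimately obtain t where t: "0 \<le> t" "t \<le> s" "B t = (1 - \<delta>) / \<mu>"
    using IVT'[of B 0 _ s] s B by blast
  have \<mu>B: "\<mu> * B t = 1 - \<delta>" using t \<mu> by simp
  have "\<theta> * \<delta> powr (- m) \<le> y t" using low[of t, unfolded \<mu>B] t(1,2) \<delta> by simp
  then have "M + \<theta> \<le> y t" using \<open>\<delta> powr (- m) = _\<close> \<theta> by (simp add: distrib_left)
  then show False using M[of t] t \<theta> by auto
qed

section \<open>Scaling of the constants\<close>

lemma A_const_powr:
  fixes \<psi> :: "real ^ 'n \<Rightarrow> real"
  assumes p: "1 < p" and \<psi>: "\<And>x. 0 \<le> \<psi> x"
  shows "A_const p l \<psi> powr p = 2 * young_const p
    * (LINT x|lebesgue. \<bar>Phi l \<psi> x\<bar> powr conj_exp p * \<psi> x powr (real l - 2 * conj_exp p))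
    * (LINT x|lebesgue. \<psi> x ^ l) powr (p - 1)"
proof -
  define q where "q = conj_exp p"
  have q: "1 < q" "p * (q - 1) = q" "p / q = p - 1"
    using conj_exp_props[OF p] p by (auto simp: q_def conj_exp_def)
  define M where "M = (LINT x|lebesgue. \<bar>Phi l \<psi> x\<bar> powr q * \<psi> x powr (real l - 2 * q))"
  define L where "L = (LINT x|lebesgue. \<psi> x ^ l)"
  have nn: "0 \<le> M" "0 \<le> L"
    unfolding M_def L_def using \<psi> by (intro integral_nonneg_AE AE_I2; simp)+
  have A: "A_const p l \<psi> = 2 powr (q - 1) * q powr (- 1 / p) * p powr ((1 - q) / p) * M powr (1 / p) * L powr (1 / q)"
    by (simp add: A_const_def Let_def q_def M_def L_def)
  have "A_const p l \<psi> powr p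
      = 2 powr ((q - 1) * p) * q powr ((- 1 / p) * p) * p powr ((1 - q) / p * p) * M powr (1 / p * p) * L powr (1 / q * p)"
    unfolding A by (simp only: powr_mult powr_powr)
  also have "(q - 1) * p = q" using q by (simp add: mult.commute)
  also have "(- 1 / p) * p = - 1" using p by simp
  also have "(1 - q) / p * p = 1 - q" using p by simp
  also have "1 / p * p = 1" using p by simp
  also have "1 / q * p = p - 1" using q by simp
  also have "2 powr q * q powr - 1 * p powr (1 - q) * M powr 1 * L powr (p - 1)
      = 2 * (2 powr (q - 1) * p powr (1 - q) / q) * M * L powr (p - 1)"
  proof -
    have "2 powr q = 2 * 2 powr (q - 1)" by (simp add: powr_diff)
    moreover have "q powr - 1 = 1 / q" using q(1) by (simp add: powr_neg_one)
    moreover have "M powr 1 = M" using nn by simp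
    ultimately show ?thesis by simp
  qed
  finally show ?thesis by (simp add: young_const_def q_def M_def L_def)
qed

lemma fujita_gap:
  fixes n p :: real
  assumes "n > 0" "1 < p" "p < fujita n"
  shows "n * (fujita n - p) / (p - 1) = 2 / (p - 1) - n" "2 / (p - 1) - n > 0"
proof -
  show 1: "n * (fujita n - p) / (p - 1) = 2 / (p - 1) - n"
    using assms by (simp add: fujita_def field_simps)
  have "0 < n * (fujita n - p) / (p - 1)" using assms by simp
  then show "2 / (p - 1) - n > 0" using 1 by simp
qed

text \<open>The two facts that dictate the scale \<open>R\<close>. It is chosen such that the constant
  left by the Laplacian equals \<open>k \<theta> powr p\<close> with \<open>\<theta> = \<epsilon> I0 / 4\<close>, so that the threshold below which the
  scalar inequality gives nothing is half the lower bound of the initial average. The resulting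
  rate \<open>k \<theta> powr (p - 1)\<close> is a multiple of \<open>\<epsilon> powr \<alpha>\<close>, which is where the exponent of the
  lifespan comes from.\<close>

lemma R_scale_props:
  fixes \<psi> :: "real ^ 'n \<Rightarrow> real"
  defines "n \<equiv> real CARD('n)"
  assumes p: "1 < p" "p < fujita n" and \<psi>: "\<And>x. 0 \<le> \<psi> x"
    and A: "A_const p l \<psi> > 0" and L: "(LINT x|lebesgue. \<psi> x ^ l) > 0"
    and pos: "\<epsilon> > 0" "I0 > 0"
    and \<alpha>: "\<alpha> = 1 / (1 / (p - 1) - n / 2)"
    and R: "R = R_scale p l \<psi> I0 \<epsilon>"
    and k: "k = (1/2) * (R ^ CARD('n) * (LINT x|lebesgue. \<psi> x ^ l)) powr (1 - p)"
  shows "R > 0"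
    and "k * (\<epsilon> / 4 * I0) powr p = young_const p * R powr (n - 2 * conj_exp p)
      * (LINT x|lebesgue. \<bar>Phi l \<psi> x\<bar> powr conj_exp p * \<psi> x powr (real l - 2 * conj_exp p))"
    and "k * (\<epsilon> / 4 * I0) powr (p - 1) = (1/2) * A_const p l \<psi> powr (\<alpha> / 2 * (n * (1 - p)))
      * (LINT x|lebesgue. \<psi> x ^ l) powr (1 - p) * (I0 / 4) powr \<alpha> * \<epsilon> powr \<alpha>"
proof -
  define A where "A = A_const p l \<psi>"
  define L where "L = (LINT x|lebesgue. \<psi> x ^ l)"
  define M where "M = (LINT x|lebesgue. \<bar>Phi l \<psi> x\<bar> powr conj_exp p * \<psi> x powr (real l - 2 * conj_exp p))"
  define \<gamma> where "\<gamma> = 2 / (p - 1) - n"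
  define \<theta> where "\<theta> = \<epsilon> / 4 * I0"
  have n0: "n > 0" by (simp add: n_def)
  have A0: "A > 0" and L0: "L > 0" using A L by (simp_all add: A_def L_def)
  have \<theta>0: "\<theta> > 0" using pos by (simp add: \<theta>_def)
  have \<gamma>: "\<gamma> > 0" "n * (fujita n - p) / (p - 1) = \<gamma>" using fujita_gap[OF n0 p] by (auto simp: \<gamma>_def)
  have "\<alpha> = 2 / \<gamma>" using \<gamma>(1) p by (simp add: \<alpha> \<gamma>_def field_simps)
  have e: "(p - 1) / (n * (fujita n - p)) = \<alpha> / 2"
  proof -
    have "(p - 1) / (n * (fujita n - p)) = 1 / (n * (fujita n - p) / (p - 1))" by simp
    then show ?thesis unfolding \<gamma>(2) \<open>\<alpha> = 2 / \<gamma>\<close> by simp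
  qed
  have R': "R = A powr (\<alpha> / 2) * \<theta> powr (- (\<alpha> / 2))"
    by (simp add: R R_scale_def Let_def n_def[symmetric] A_def \<theta>_def e)
  then show R0: "R > 0" using A0 \<theta>0 by simp
  have "A * R powr (- \<gamma>) = \<theta>"
  proof -
    have "\<alpha> / 2 * - \<gamma> = - 1" "- (\<alpha> / 2) * - \<gamma> = 1" using \<gamma> by (simp_all add: \<open>\<alpha> = 2 / \<gamma>\<close>)
    then have "R powr (- \<gamma>) = A powr - 1 * \<theta> powr 1" unfolding R' by (simp only: powr_mult powr_powr)
    then show ?thesis using A0 \<theta>0 by (simp add: powr_minus)
  qed
  have k': "k = (1/2) * (R powr (n * (1 - p)) * L powr (1 - p))"
    using R0 L0 by (simp add: k L_def[symmetric] powr_mult powr_powr n_def flip: powr_realpow)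
  have "k * \<theta> powr p = (1/2) * (R powr (n * (1 - p)) * L powr (1 - p)) * (A powr p * R powr (- \<gamma> * p))"
    unfolding k' \<open>A * R powr (- \<gamma>) = \<theta>\<close>[symmetric] by (simp only: powr_mult powr_powr)
  also have "A powr p = 2 * young_const p * M * L powr (p - 1)"
    unfolding A_def L_def M_def by (rule A_const_powr[OF p(1) \<psi>])
  also have "(1/2) * (R powr (n * (1 - p)) * L powr (1 - p)) * (2 * young_const p * M * L powr (p - 1) * R powr (- \<gamma> * p))
      = young_const p * M * (R powr (n * (1 - p)) * R powr (- \<gamma> * p)) * (L powr (1 - p) * L powr (p - 1))"
    by simp
  also have "L powr (1 - p) * L powr (p - 1) = 1" using L0 by (simp flip: powr_add)
  also have "R powr (n * (1 - p)) * R powr (- \<gamma> * p) = R powr (n - 2 * conj_exp p)"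
  proof -
    have "n * (1 - p) + - \<gamma> * p = n - 2 * conj_exp p"
      by (simp add: \<gamma>_def conj_exp_def algebra_simps)
    then show ?thesis by (simp only: flip: powr_add)
  qed
  finally show "k * (\<epsilon> / 4 * I0) powr p = young_const p * R powr (n - 2 * conj_exp p)
      * (LINT x|lebesgue. \<bar>Phi l \<psi> x\<bar> powr conj_exp p * \<psi> x powr (real l - 2 * conj_exp p))"
    by (simp add: \<theta>_def M_def)
  have "R powr (n * (1 - p)) = A powr (\<alpha> / 2 * (n * (1 - p))) * \<theta> powr (- (\<alpha> / 2) * (n * (1 - p)))"
    unfolding R' by (simp only: powr_mult powr_powr)
  then have "k * \<theta> powr (p - 1) = (1/2) * A powr (\<alpha> / 2 * (n * (1 - p))) * L powr (1 - p)
      * (\<theta> powr (- (\<alpha> / 2) * (n * (1 - p))) * \<theta> powr (p - 1))"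
    unfolding k' by (simp only: mult_ac)
  also have "\<theta> powr (- (\<alpha> / 2) * (n * (1 - p))) * \<theta> powr (p - 1) = \<theta> powr \<alpha>"
  proof -
    have "- (\<alpha> / 2) * (n * (1 - p)) + (p - 1) = (p - 1) * (n + \<gamma>) / \<gamma>"
      using \<gamma> by (simp add: \<open>\<alpha> = 2 / \<gamma>\<close> field_simps)
    also have "(p - 1) * (n + \<gamma>) = (p - 1) * 2 / (p - 1)" by (simp add: \<gamma>_def)
    also have "(p - 1) * 2 / (p - 1) = 2" using p by (intro nonzero_mult_div_cancel_left) simp
    also have "2 / \<gamma> = \<alpha>" by (rule \<open>\<alpha> = 2 / \<gamma>\<close>[symmetric])
    finally show ?thesis by (simp only: flip: powr_add)
  qed
  also have "\<theta> powr \<alpha> = (I0 / 4) powr \<alpha> * \<epsilon> powr \<alpha>"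
  proof -
    have "\<theta> = (I0 / 4) * \<epsilon>" by (simp add: \<theta>_def)
    then show ?thesis by (simp only: powr_mult)
  qed
  finally show "k * (\<epsilon> / 4 * I0) powr (p - 1) = (1/2) * A_const p l \<psi> powr (\<alpha> / 2 * (n * (1 - p)))
      * (LINT x|lebesgue. \<psi> x ^ l) powr (1 - p) * (I0 / 4) powr \<alpha> * \<epsilon> powr \<alpha>"
    by (simp only: \<theta>_def A_def L_def mult.assoc)
qed

section \<open>Lower bound and lifespan\<close>

text \<open>The constants are kept abstract here: \<open>k\<close> is the coefficient in the scalar inequality, \<open>\<theta>\<close> its
  threshold, and \<open>\<mu>\<close> must be small relative to the rate \<open>k \<theta> powr (p - 1)\<close> and to the initial velocity.\<close>

lemma strong_solution_lower_bound:
  fixes \<psi> u0 u1 :: "real ^ 'n \<Rightarrow> real" and u :: "real \<Rightarrow> real ^ 'n \<Rightarrow> real"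
  assumes p: "1 < p" and l: "real l > 2 * conj_exp p" and \<eta>: "cutoff_profile \<eta>" and \<psi>: "\<psi> = radial \<eta>"
    and R: "R > 0" and L: "(LINT x|lebesgue. \<psi> x ^ l) > 0"
    and k: "k = (1/2) * (R ^ CARD('n) * (LINT x|lebesgue. \<psi> x ^ l)) powr (1 - p)"
    and k\<theta>: "k * \<theta> powr p = young_const p * R powr (real CARD('n) - 2 * conj_exp p)
      * (LINT x|lebesgue. \<bar>Phi l \<psi> x\<bar> powr conj_exp p * \<psi> x powr (real l - 2 * conj_exp p))"
    and \<theta>: "0 < \<theta>" and C: "0 < C" and \<mu>: "0 < \<mu>" "\<mu> \<le> 1"
    and b: "\<And>t. 0 \<le> t \<Longrightarrow> 0 < b t"
    and b': "\<And>t. 0 \<le> t \<Longrightarrow> (b has_real_derivative b' t) (at t within {0..})"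
    and B: "\<And>t. 0 \<le> t \<Longrightarrow> (B has_real_derivative inverse (b t)) (at t within {0..})"
      "\<And>r t. 0 \<le> r \<Longrightarrow> r \<le> t \<Longrightarrow> B r \<le> B t" "B 0 = 0"
    and est: "\<And>t. 0 \<le> t \<Longrightarrow> \<bar>b' t\<bar> / (b t)\<^sup>2 \<le> C" "\<And>t. 0 \<le> t \<Longrightarrow> 1 / (b t)\<^sup>2 \<le> C * (1 + B t)"
    and m: "m = 2 / (p - 1)"
    and \<kappa>: "\<mu> * (2 * C * m * (m + 1) + m * C + m) \<le> k * \<theta> powr (p - 1)"
    and sol: "strong_solution b p u0 u1 T u" and T: "T > 0"
    and data: "u0 \<in> borel_measurable lebesgue" "u1 \<in> borel_measurable lebesgue"
    and init: "2 * \<theta> \<le> (LINT x|lebesgue. u0 x * rescale R \<psi> x ^ l)"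
      "\<theta> * (m * \<mu> / b 0) < (LINT x|lebesgue. u1 x * rescale R \<psi> x ^ l)"
    and t: "t \<in> time_interval T"
  shows "\<mu> * B t < 1"
    and "\<theta> * (1 - \<mu> * B t) powr (- m) \<le> (LINT x|lebesgue. u t x * rescale R \<psi> x ^ l)"
proof -
  let ?I = "time_interval T"
  let ?\<phi> = "\<lambda>x. rescale R \<psi> x ^ l"
  have l0: "l > 0" using l conj_exp_props(1)[OF p] by (cases l) auto
  have t\<psi>: "test_function \<psi>" unfolding \<psi> by (rule test_function_radial[OF \<eta>])
  have \<psi>0: "0 \<le> \<psi> x" for x unfolding \<psi> by (rule radial_nonneg[OF \<eta>])
  have \<phi>: "test_function ?\<phi>" by (rule test_function_power[OF test_function_rescale[OF t\<psi> R] l0])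
  define J where "J s = (LINT x|lebesgue. u s x * ?\<phi> x)" for s
  have k0: "0 < k" using R L by (simp add: k)
  have m0: "0 < m" using p by (simp add: m)
  obtain J' J'' where J:
    "\<And>t. t \<in> ?I \<Longrightarrow> u t \<in> L2"
    "\<And>t. t \<in> ?I \<Longrightarrow> integrable lebesgue (\<lambda>x. \<bar>u t x\<bar> powr p * ?\<phi> x)"
    "\<And>t. t \<in> ?I \<Longrightarrow> (J has_real_derivative J' t) (at t within ?I)"
    "\<And>t. t \<in> ?I \<Longrightarrow> (J' has_real_derivative J'' t) (at t within ?I)"
    "\<And>t. t \<in> ?I \<Longrightarrow> J'' t + b t * J' t
      = (LINT x|lebesgue. \<bar>u t x\<bar> powr p * ?\<phi> x) + (LINT x|lebesgue. u t x * laplacian ?\<phi> x)"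
    "J 0 = (LINT x|lebesgue. u0 x * ?\<phi> x)" "J' 0 = (LINT x|lebesgue. u1 x * ?\<phi> x)"
    by (rule strong_solution_pairing[OF sol T data \<eta> \<phi>, folded J_def], rule that)
  have sub: "{0..s} \<subseteq> ?I" if "s \<in> ?I" for s
    using that by (auto simp: time_interval_def intro: le_less_trans[rotated])
  have ineq: "k * (J s powr p - \<theta> powr p) \<le> J'' s + b s * J' s" if s: "s \<in> ?I" and "0 \<le> J s" for s
    using localized_inequality[OF t\<psi> \<psi>0 p l R J(1)[OF s] J(2)[OF s] _ L] that
    unfolding J(5)[OF s] J_def[symmetric] k[symmetric] right_diff_distrib k\<theta> by simp
  have low: "\<theta> * (1 - \<mu> * B s) powr (- m) \<le> J s" if s: "s \<in> ?I" "\<mu> * B s < 1" for s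
  proof (rule damped_lower_bound[OF p \<mu> C \<theta> k0 b b' B est m \<kappa> _ s(2), where y=J and ?y1.0=J' and ?y2.0=J''])
    show "0 \<le> s" using s by (simp add: time_interval_def)
    fix t assume t: "t \<in> {0..s}"
    then have tI: "t \<in> ?I" using sub[OF s(1)] by blast
    show "(J has_real_derivative J' t) (at t within {0..s})" "(J' has_real_derivative J'' t) (at t within {0..s})"
      using DERIV_subset[OF J(3)[OF tI] sub[OF s(1)]] DERIV_subset[OF J(4)[OF tI] sub[OF s(1)]] by auto
    show "k * (J t powr p - \<theta> powr p) \<le> J'' t + b t * J' t" if "0 \<le> J t" by (rule ineq[OF tI that])
  qed (use init J(6,7) in auto)
  have t0: "0 \<le> t" using t by (simp add: time_interval_def)
  show lt: "\<mu> * B t < 1"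
  proof (rule damped_blowup[where B=B and y=J and s=t, OF \<mu>(1) m0 \<theta> _ B(3) t0])
    have "continuous_on {0..} B" using B(1) by (rule DERIV_continuous_on) auto
    then show "continuous_on {0..t} B" by (rule continuous_on_subset) auto
    show "continuous_on {0..t} J"
      using DERIV_continuous_on[OF J(3)] sub[OF t] by (auto elim: continuous_on_subset)
    show "\<theta> * (1 - \<mu> * B s) powr (- m) \<le> J s" if "s \<in> {0..t}" "\<mu> * B s < 1" for s
      using low that sub[OF t] by blast
  qed
  show "\<theta> * (1 - \<mu> * B t) powr (- m) \<le> (LINT x|lebesgue. u t x * rescale R \<psi> x ^ l)"
    using low[OF t lt] by (simp add: J_def)
qed

theorem corollary1p4:
  fixes b \<eta> :: "real \<Rightarrow> real" and \<psi> :: "real ^ 'n \<Rightarrow> real"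
    and \<beta> p n I0 I1 \<alpha> :: real and l :: nat
  assumes "-1 \<le> \<beta>" and "\<beta> \<le> 1" and "damping \<beta> b"
    and n_def: "n = real CARD('n)"
    and "1 < p" and "p < fujita n"
    and "real l > 2 * conj_exp p"
    and "cutoff_profile \<eta>" and psi_def: "\<psi> = radial \<eta>"
    and "I0 > 0" and "I1 > 0"
    and alpha_def: "\<alpha> = 1 / (1 / (p - 1) - n / 2)"
  shows "\<exists>\<mu>0>0. \<forall>(R::real) (a0 :: real ^ 'n \<Rightarrow> real) (a1 :: real ^ 'n \<Rightarrow> real) (\<epsilon>0::real).
    R > 0 \<and>
    a0 \<in> H1 \<and> integrable lebesgue a0 \<and> a1 \<in> L2 \<and> integrable lebesgue a1 \<and>
    (LINT x:ball 0 R|lebesgue. a0 x) = I0 \<and> (LINT x:ball 0 R|lebesgue. a1 x) = I1 \<and>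
    \<epsilon>0 > 0 \<and>
    (LINT x|lebesgue. rescale (R_scale p l \<psi> I0 \<epsilon>0) \<psi> x ^ l * a0 x) \<ge> I0 / 2 \<and>
    (LINT x|lebesgue. rescale (R_scale p l \<psi> I0 \<epsilon>0) \<psi> x ^ l * a1 x) \<ge> I1 / 2 \<and>
    \<epsilon>0 * I0 \<le> 2 powr (1 / (p - 1)) * (LINT x|lebesgue. \<psi> x ^ l)
       * R_scale p l \<psi> I0 \<epsilon>0 ^ CARD('n)
    \<longrightarrow>
    (\<forall>\<epsilon>. 0 < \<epsilon> \<and> \<epsilon> \<le> \<epsilon>0 \<and>
       (LINT x|lebesgue. rescale (R_scale p l \<psi> I0 \<epsilon>) \<psi> x ^ l * a0 x) \<ge> I0 / 2 \<and>
       (LINT x|lebesgue. rescale (R_scale p l \<psi> I0 \<epsilon>) \<psi> x ^ l * a1 x) \<ge> I1 / 2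
     \<longrightarrow>
     (\<forall>u T0.
        (\<exists>T>0. strong_solution b p (\<lambda>x. \<epsilon> * a0 x) (\<lambda>x. \<epsilon> * a1 x) T u) \<and>
        T0 = lifespan b p (\<lambda>x. \<epsilon> * a0 x) (\<lambda>x. \<epsilon> * a1 x) u
      \<longrightarrow>
        (\<forall>t. 0 \<le> t \<and> ereal t < T0 \<longrightarrow>
           (LINT x|lebesgue. u t x * rescale (R_scale p l \<psi> I0 \<epsilon>) \<psi> x ^ l)
             \<ge> \<epsilon> / 4 * I0 * (1 - \<mu>0 * \<epsilon> powr \<alpha> * damping_B b t) powr (- 2 / (p - 1))) \<and>
        T0 \<le> ereal (damping_B_inv b (inverse \<mu>0 * \<epsilon> powr (- \<alpha>)))))"
proof -
  have \<psi>0: "0 \<le> \<psi> x" for x unfolding psi_def by (rule radial_nonneg[OF \<open>cutoff_profile \<eta>\<close>])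
  define A where "A = A_const p l \<psi>"
  define L where "L = (LINT x|lebesgue. \<psi> x ^ l)"
  define m where "m = 2 / (p - 1)"
  have n0: "n > 0" by (simp add: n_def)
  have m0: "m > 0" using \<open>1 < p\<close> by (simp add: m_def)
  have \<alpha>0: "\<alpha> > 0"
    using fujita_gap(2)[OF n0 \<open>1 < p\<close> \<open>p < fujita n\<close>] by (simp add: alpha_def field_simps)
  have A_nn: "0 \<le> A"
    unfolding A_def A_const_def Let_def by (intro mult_nonneg_nonneg powr_ge_zero)
  have L_nn: "0 \<le> L" unfolding L_def using \<psi>0 by (intro integral_nonneg_AE AE_I2) simp
  show ?thesis
  proof (cases "A > 0 \<and> L > 0")
    case False
    \<comment> \<open>then the right-hand side of the smallness condition on \<open>\<epsilon>0\<close> vanishes\<close>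
    have zero: "2 powr (1 / (p - 1)) * L * R_scale p l \<psi> I0 \<epsilon>0 ^ CARD('n) = 0" for \<epsilon>0
      using False A_nn L_nn by (auto simp: R_scale_def Let_def A_def[symmetric] zero_power)
    have "\<not> \<epsilon>0 * I0 \<le> 2 powr (1 / (p - 1)) * L * R_scale p l \<psi> I0 \<epsilon>0 ^ CARD('n)" if "\<epsilon>0 > 0" for \<epsilon>0
      using mult_pos_pos[OF that \<open>I0 > 0\<close>] by (simp only: zero not_le)
    then show ?thesis unfolding L_def by (intro exI[of _ 1]) auto
  next
    case True
    then have A0: "A > 0" and L0: "L > 0" by auto
    obtain b' C where C: "C > 0" and b: "\<And>t. 0 \<le> t \<Longrightarrow> 0 < b t"
      and b': "\<And>t. 0 \<le> t \<Longrightarrow> (b has_real_derivative b' t) (at t within {0..})"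
      and B': "\<And>t. 0 \<le> t \<Longrightarrow> (damping_B b has_real_derivative inverse (b t)) (at t within {0..})"
      and est: "\<And>t. 0 \<le> t \<Longrightarrow> \<bar>b' t\<bar> / (b t)\<^sup>2 \<le> C"
        "\<And>t. 0 \<le> t \<Longrightarrow> 1 / (b t)\<^sup>2 \<le> C * (1 + damping_B b t)"
      and unb: "\<And>M. \<exists>t\<ge>0. M \<le> damping_B b t"
      by (rule damping_estimates[OF \<open>damping \<beta> b\<close> \<open>-1 \<le> \<beta>\<close> \<open>\<beta> \<le> 1\<close>], rule that)
    let ?B = "damping_B b"
    have B0: "?B 0 = 0" by (simp add: damping_B_def)
    have contB: "continuous_on {0..} ?B" using B' by (rule DERIV_continuous_on) auto
    have Bstrict: "?B r < ?B t" if "0 \<le> r" "r < t" for r t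
    proof (rule DERIV_pos_imp_increasing_open[OF \<open>r < t\<close>])
      show "\<exists>y. (?B has_real_derivative y) (at x) \<and> 0 < y" if "r < x" "x < t" for x
        using B'[of x] b[of x] at_within_interior[of x "{0..}"] that \<open>0 \<le> r\<close>
        by (auto intro!: exI[of _ "inverse (b x)"])
      show "continuous_on {r..t} ?B" using contB that by (auto elim: continuous_on_subset)
    qed
    have Bmono: "?B r \<le> ?B t" if "0 \<le> r" "r \<le> t" for r t
      using Bstrict[of r t] that by (cases "r = t") (auto intro: less_imp_le)
    \<comment> \<open>the rate is \<open>c0 * \<epsilon> powr \<alpha>\<close>, and \<open>\<mu> = \<mu>0 * \<epsilon> powr \<alpha>\<close> is the fraction \<open>\<delta>\<close> of it; the three
      bounds on \<open>\<delta>\<close> serve for \<open>\<mu> \<le> 1\<close>, the subsolution property and the initial velocity\<close>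
    define c0 where "c0 = (1/2) * A powr (\<alpha> / 2 * (n * (1 - p))) * L powr (1 - p) * (I0 / 4) powr \<alpha>"
    have c0: "c0 > 0" using A0 L0 \<open>I0 > 0\<close> by (simp add: c0_def)
    define K where "K = 2 * C * m * (m + 1) + m * C + m"
    have K: "K > 0" using C m0 by (simp add: K_def add_pos_pos)
    define \<delta> where "\<delta> = min 1 (min (1 / K) (I1 * b 0 / (I0 * m)))"
    have \<delta>: "0 < \<delta>" "\<delta> \<le> 1" "\<delta> \<le> 1 / K" "\<delta> \<le> I1 * b 0 / (I0 * m)"
      using K m0 b[of 0] \<open>I0 > 0\<close> \<open>I1 > 0\<close> by (auto simp: \<delta>_def)
    define \<mu>0 where "\<mu>0 = c0 * \<delta>"
    have \<mu>0: "\<mu>0 > 0" using c0 \<delta> by (simp add: \<mu>0_def)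
    have main: "(\<forall>t. 0 \<le> t \<and> ereal t < lifespan b p (\<lambda>x. \<epsilon> * a0 x) (\<lambda>x. \<epsilon> * a1 x) u \<longrightarrow>
           \<epsilon> / 4 * I0 * (1 - \<mu>0 * \<epsilon> powr \<alpha> * ?B t) powr (- 2 / (p - 1))
           \<le> (LINT x|lebesgue. u t x * rescale (R_scale p l \<psi> I0 \<epsilon>) \<psi> x ^ l)) \<and>
        lifespan b p (\<lambda>x. \<epsilon> * a0 x) (\<lambda>x. \<epsilon> * a1 x) u
          \<le> ereal (damping_B_inv b (inverse \<mu>0 * \<epsilon> powr (- \<alpha>)))"
      if a: "integrable lebesgue a0" "integrable lebesgue a1" and \<epsilon>0: "\<epsilon>0 > 0"
        and small: "\<epsilon>0 * I0 \<le> 2 powr (1 / (p - 1)) * L * R_scale p l \<psi> I0 \<epsilon>0 ^ CARD('n)"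
        and \<epsilon>: "0 < \<epsilon>" "\<epsilon> \<le> \<epsilon>0"
        and i0: "(LINT x|lebesgue. rescale (R_scale p l \<psi> I0 \<epsilon>) \<psi> x ^ l * a0 x) \<ge> I0 / 2"
        and i1: "(LINT x|lebesgue. rescale (R_scale p l \<psi> I0 \<epsilon>) \<psi> x ^ l * a1 x) \<ge> I1 / 2"
      for a0 a1 :: "real ^ 'n \<Rightarrow> real" and \<epsilon>0 \<epsilon> :: real and u
    proof -
      define R where "R = R_scale p l \<psi> I0 \<epsilon>"
      define \<theta> where "\<theta> = \<epsilon> / 4 * I0"
      have \<theta>: "\<theta> > 0" using \<epsilon> \<open>I0 > 0\<close> by (simp add: \<theta>_def)
      note scale = R_scale_props[OF \<open>1 < p\<close> \<open>p < fujita n\<close>[unfolded n_def] \<psi>0 A0[unfolded A_def]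
          L0[unfolded L_def] _ \<open>I0 > 0\<close> alpha_def[unfolded n_def] refl refl, folded L_def A_def n_def]
      define k where "k = (1/2) * (R ^ CARD('n) * L) powr (1 - p)"
      note s\<epsilon> = scale[OF \<epsilon>(1), folded R_def, folded k_def c0_def \<theta>_def]
      have R0: "R > 0" by (rule s\<epsilon>(1))
      have \<kappa>: "k * \<theta> powr (p - 1) = c0 * \<epsilon> powr \<alpha>" by (rule s\<epsilon>(3))
      \<comment> \<open>the smallness condition on \<open>\<epsilon>0\<close> says that the rate is bounded, uniformly in the data\<close>
      have \<kappa>1: "c0 * \<epsilon> powr \<alpha> \<le> 1"
      proof -
        define R0 where "R0 = R_scale p l \<psi> I0 \<epsilon>0"
        have R0: "R0 > 0" unfolding R0_def by (rule scale(1)[OF \<epsilon>0])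
        define S where "S = R0 ^ CARD('n) * L"
        have S: "S > 0" using R0 L0 by (simp add: S_def)
        have "c0 * \<epsilon> powr \<alpha> \<le> c0 * \<epsilon>0 powr \<alpha>"
          using c0 \<epsilon> \<alpha>0 by (intro mult_left_mono powr_mono2) auto
        also have "\<dots> = (1/2) * S powr (1 - p) * (\<epsilon>0 / 4 * I0) powr (p - 1)"
          using scale(3)[OF \<epsilon>0, folded c0_def] by (simp add: S_def R0_def)
        also have "\<dots> \<le> (1/2) * S powr (1 - p) * (2 powr (1 / (p - 1)) * S) powr (p - 1)"
        proof (intro mult_left_mono powr_mono2)
          have "\<epsilon>0 / 4 * I0 \<le> \<epsilon>0 * I0" using \<epsilon>0 \<open>I0 > 0\<close> by simp
          also have "\<dots> \<le> 2 powr (1 / (p - 1)) * S" using small by (simp add: S_def R0_def mult_ac)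
          finally show "\<epsilon>0 / 4 * I0 \<le> 2 powr (1 / (p - 1)) * S" .
        qed (use \<epsilon>0 \<open>I0 > 0\<close> \<open>1 < p\<close> in auto)
        also have "(2 powr (1 / (p - 1)) * S) powr (p - 1) = 2 * S powr (p - 1)"
          using \<open>1 < p\<close> S by (simp add: powr_mult powr_powr)
        also have "(1/2) * S powr (1 - p) * (2 * S powr (p - 1)) = S powr (1 - p) * S powr (p - 1)" by simp
        also have "\<dots> = 1" using S by (simp flip: powr_add)
        finally show ?thesis .
      qed
      define \<mu> where "\<mu> = \<mu>0 * \<epsilon> powr \<alpha>"
      have \<mu>\<delta>: "\<mu> = \<delta> * (c0 * \<epsilon> powr \<alpha>)" by (simp add: \<mu>_def \<mu>0_def)
      have \<mu>0': "\<mu> > 0" using \<mu>0 \<epsilon> by (simp add: \<mu>_def)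
      have \<mu>le: "\<mu> \<le> \<delta>" unfolding \<mu>\<delta> using mult_left_mono[OF \<kappa>1, of \<delta>] \<delta> by simp
      have \<mu>1: "\<mu> \<le> 1" using \<mu>le \<delta> by simp
      have \<mu>K: "\<mu> * K \<le> k * \<theta> powr (p - 1)"
      proof -
        have "\<delta> * K \<le> 1" using \<delta>(3) K by (simp add: field_simps)
        then have "(\<delta> * K) * (c0 * \<epsilon> powr \<alpha>) \<le> 1 * (c0 * \<epsilon> powr \<alpha>)"
          using c0 by (intro mult_right_mono) auto
        then show ?thesis by (simp add: \<kappa> \<mu>\<delta> mult_ac)
      qed
      have meas: "(\<lambda>x. \<epsilon> * a0 x) \<in> borel_measurable lebesgue" "(\<lambda>x. \<epsilon> * a1 x) \<in> borel_measurable lebesgue"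
        using a by (auto intro!: borel_measurable_times borel_measurable_integrable)
      have eq: "(LINT x|lebesgue. \<epsilon> * a x * rescale R \<psi> x ^ l)
          = \<epsilon> * (LINT x|lebesgue. rescale R \<psi> x ^ l * a x)" for a
        by (simp add: mult.assoc mult.commute[of "a _"])
      have init: "2 * \<theta> \<le> (LINT x|lebesgue. \<epsilon> * a0 x * rescale R \<psi> x ^ l)"
        "\<theta> * (m * \<mu> / b 0) < (LINT x|lebesgue. \<epsilon> * a1 x * rescale R \<psi> x ^ l)"
      proof -
        have "2 * \<theta> = \<epsilon> * (I0 / 2)" by (simp add: \<theta>_def)
        also have "\<dots> \<le> \<epsilon> * (LINT x|lebesgue. rescale R \<psi> x ^ l * a0 x)"
          using i0 \<epsilon> by (intro mult_left_mono) (auto simp: R_def)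
        finally show "2 * \<theta> \<le> (LINT x|lebesgue. \<epsilon> * a0 x * rescale R \<psi> x ^ l)" by (simp add: eq)
        have "\<mu> \<le> I1 * b 0 / (I0 * m)" using \<mu>le \<delta>(4) by simp
        then have "I0 * (m * \<mu> / b 0) \<le> I1" using b[of 0] \<open>I0 > 0\<close> m0 by (simp add: field_simps)
        then have "\<epsilon> / 4 * (I0 * (m * \<mu> / b 0)) \<le> \<epsilon> / 4 * I1" using \<epsilon> by (intro mult_left_mono) auto
        also have "\<dots> < \<epsilon> * (I1 / 2)" using \<epsilon> \<open>I1 > 0\<close> by simp
        also have "\<dots> \<le> \<epsilon> * (LINT x|lebesgue. rescale R \<psi> x ^ l * a1 x)"
          using i1 \<epsilon> by (intro mult_left_mono) (auto simp: R_def)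
        finally show "\<theta> * (m * \<mu> / b 0) < (LINT x|lebesgue. \<epsilon> * a1 x * rescale R \<psi> x ^ l)"
          by (simp only: eq \<theta>_def mult.assoc[of "\<epsilon> / 4"])
      qed
      note bound = strong_solution_lower_bound[OF \<open>1 < p\<close> \<open>real l > 2 * conj_exp p\<close>
          \<open>cutoff_profile \<eta>\<close> psi_def R0 L0[unfolded L_def] k_def[unfolded L_def] s\<epsilon>(2)[unfolded n_def] \<theta> C \<mu>0' \<mu>1
          b b' B' Bmono B0 est m_def \<mu>K[unfolded K_def] _ _ meas init]
      have "?B 0 \<le> 1 / \<mu>" using B0 \<mu>0' by simp
      obtain S where S: "0 \<le> S" "1 / \<mu> \<le> ?B S" using unb by blast
      then obtain t' where t': "0 \<le> t'" "?B t' = 1 / \<mu>"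
        using IVT'[of ?B 0 "1 / \<mu>" S] \<open>?B 0 \<le> 1 / \<mu>\<close> continuous_on_subset[OF contB, of "{0..S}"] by auto
      have "inj_on ?B {0..}"
        by (rule linorder_inj_onI') (use Bstrict in force)
      then have inv: "damping_B_inv b (inverse \<mu>0 * \<epsilon> powr (- \<alpha>)) = t'"
        unfolding damping_B_inv_def using t' \<mu>0 \<epsilon>
        by (intro inv_into_f_eq) (auto simp: \<mu>_def powr_minus divide_inverse)
      let ?S = "{T. 0 < T \<and> strong_solution b p (\<lambda>x. \<epsilon> * a0 x) (\<lambda>x. \<epsilon> * a1 x) T u}"
      have "T \<le> ereal t'" if "T \<in> ?S" for T
      proof (rule ccontr)
        assume "\<not> T \<le> ereal t'"
        then have "t' \<in> time_interval T" using t' by (simp add: time_interval_def)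
        then have "\<mu> * ?B t' < 1" using bound(1) that by blast
        then show False using t' \<mu>0' by simp
      qed
      then have "lifespan b p (\<lambda>x. \<epsilon> * a0 x) (\<lambda>x. \<epsilon> * a1 x) u \<le> ereal t'"
        unfolding lifespan_def by (rule Sup_least)
      moreover have "\<epsilon> / 4 * I0 * (1 - \<mu>0 * \<epsilon> powr \<alpha> * ?B t) powr (- 2 / (p - 1))
           \<le> (LINT x|lebesgue. u t x * rescale (R_scale p l \<psi> I0 \<epsilon>) \<psi> x ^ l)"
        if t: "0 \<le> t" "ereal t < lifespan b p (\<lambda>x. \<epsilon> * a0 x) (\<lambda>x. \<epsilon> * a1 x) u" for t
      proof -
        obtain T where T: "T \<in> ?S" "ereal t < T"
          using t(2) unfolding lifespan_def less_Sup_iff by blast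
        then have "t \<in> time_interval T" using t by (simp add: time_interval_def)
        then have "\<theta> * (1 - \<mu> * ?B t) powr (- m) \<le> (LINT x|lebesgue. u t x * rescale R \<psi> x ^ l)"
          using bound(2) T(1) by blast
        then show ?thesis by (simp add: \<theta>_def \<mu>_def m_def R_def)
      qed
      ultimately show ?thesis using inv by simp
    qed
    show ?thesis
      by (rule exI[of _ \<mu>0]) (use \<mu>0 main in \<open>unfold L_def, blast\<close>)
  qed
qed

end
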